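(* Let $T>0$, $Q=(0,1)\times(0,T)$, and $y_0,y_T\in L^2(0,1)$. Put $$d_n=y_{T,n}-e^{-\lambda_nT}y_{0,n},\qquad a_n=\frac{1-e^{-2\lambda_nT}}{2\lambda_n}\qquad(n\ge1).$$ Let $u^*$ be the optimal control of the hard terminal constraint problem and, for $\alpha>0$, let $u_\alpha^*$ be the optimal control of the penalized problem with parameter $\alpha$, with corresponding state $y_\alpha$. 1. Let $0\le\theta\le\frac12$ and assume $\sum_{n=1}^\infty \frac{|d_n|^2}{a_n^{1+2\theta}}<\infty$. Then there exists a constant $C_\theta>0$, independent of $\alpha$, such that for all $\alpha>0$ $$\|y_\alpha(\cdot,T)-y_T\|_{L^2(0,1)}\le\frac{C_\theta}{\alpha^{\frac12+\theta}}.$$ 2. Let $0<\theta\le1$ and assume $\sum_{n=1}^\infty \frac{|d_n|^2}{a_n^{1+2\theta}}<\infty$. Then there exists a constant $D_\theta>0$, independent of $\alpha$, such that for all $\alpha>0$ $$\|u_\alpha^*-u^*\|_{L^2(Q)}\le\frac{D_\theta}{\alpha^{\theta}}.$$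
   Context: All functions are real-valued. Fix $T>0$ and put $Q=(0,1)\times(0,T)$. For $y_0\in L^2(0,1)$ and $u\in L^2(Q)$, the controlled heat equation is $$y_t-y_{xx}=u\ \text{ in }Q,\qquad y(0,t)=y(1,t)=0\ \text{ for }t\in(0,T),\qquad y(x,0)=y_0(x)\ \text{ for }x\in(0,1).$$ It has a unique weak solution $y=y^u\in L^2(0,T;H_0^1(0,1))$ (in the standard sense, with $y_t\in L^2(0,T;H^{-1}(0,1))$, so that $y\in C([0,T];L^2(0,1))$ and $y(\cdot,T)\in L^2(0,1)$ is well defined). Let $e_n(x)=\sqrt2\sin(n\pi x)$ and $\lambda_n=(n\pi)^2$ for $n\ge1$; $\{e_n\}$ is an orthonormal basis of $L^2(0,1)$. For $y_0,y_T\in L^2(0,1)$ let $y_{0,n}=\int_0^1 y_0e_n\,dx$ and $y_{T,n}=\int_0^1 y_Te_n\,dx$. Hard terminal constraint problem: minimize $J(u)=\frac12\|u\|_{L^2(Q)}^2$ over all $u\in L^2(Q)$ with $y^u(\cdot,T)=y_T$. Whenever $\sum_{n=1}^\infty |d_n|^2/a_n<\infty$ (with $d_n,a_n$ as defined in the claim; this condition is implied by each of the summability hypotheses in the claim) it has a unique minimizer, denoted $u^*$. Penalized problem: for $\alpha>0$, minimize $J_\alpha(u)=\frac12\|u\|_{L^2(Q)}^2+\frac{\alpha}{2}\|y^u(\cdot,T)-y_T\|_{L^2(0,1)}^2$ over all $u\in L^2(Q)$. It has a unique minimizer, denoted $u_\alpha^*$, and $y_\alpha=y^{u_\alpha^*}$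 denotes the corresponding state. *)

theory Defs
  imports "HOL-Analysis.Analysis"
begin

text \<open>
  An element of an \<open>L\<^sup>2\<close> space is given by a Borel representative, so equality of elements is
  equality almost everywhere. Every almost-everywhere class of Lebesgue measurable functions
  contains such a representative.
\<close>

definition L2_on :: "'a::euclidean_space set \<Rightarrow> ('a \<Rightarrow> real) \<Rightarrow> bool" where
  "L2_on S f \<longleftrightarrow> set_borel_measurable lborel S f \<and> set_integrable lborel S (\<lambda>x. (f x)\<^sup>2)"

definition L2_inner :: "'a::euclidean_space set \<Rightarrow> ('a \<Rightarrow> real) \<Rightarrow> ('a \<Rightarrow> real) \<Rightarrow> real" where
  "L2_inner S f g = (LINT x:S|lborel. f x * g x)"

definition L2_norm :: "'a::euclidean_space set \<Rightarrow> ('a \<Rightarrow> real) \<Rightarrow> real" where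
  "L2_norm S f = sqrt (LINT x:S|lborel. (f x)\<^sup>2)"

abbreviation unit_ival :: "real set" where
  "unit_ival \<equiv> {0<..<1}"

text \<open>
  Sobolev spaces on an interval, with test functions in \<open>C\<^sub>c\<^sup>1\<close> (as in Brezis, Functional
  Analysis, Sobolev Spaces and PDE, Chapter 8); \<open>C\<^sub>c\<^sup>\<infinity>\<close> test functions give the same spaces
  and the same weak derivatives. The interval is bounded, so the support is automatically compact.
\<close>

definition C1c :: "real \<Rightarrow> real \<Rightarrow> (real \<Rightarrow> real) \<Rightarrow> bool" where
  "C1c a b \<phi> \<longleftrightarrow> \<phi> C1_differentiable_on UNIV \<and> closure {x. \<phi> x \<noteq> 0} \<subseteq> {a<..<b}"

definition has_weak_deriv :: "real \<Rightarrow> real \<Rightarrow> (real \<Rightarrow> real) \<Rightarrow> (real \<Rightarrow> real) \<Rightarrow> bool" where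
  "has_weak_deriv a b v g \<longleftrightarrow>
     (\<forall>\<phi>. C1c a b \<phi> \<longrightarrow> L2_inner {a<..<b} v (deriv \<phi>) = - L2_inner {a<..<b} g \<phi>)"

text \<open>\<open>H1 v g\<close>: \<open>v\<close> belongs to \<open>H\<^sup>1(0,1)\<close> and \<open>g\<close> is its weak derivative.\<close>

definition H1 :: "(real \<Rightarrow> real) \<Rightarrow> (real \<Rightarrow> real) \<Rightarrow> bool" where
  "H1 v g \<longleftrightarrow> L2_on unit_ival v \<and> L2_on unit_ival g \<and> has_weak_deriv 0 1 v g"

definition H1_norm :: "(real \<Rightarrow> real) \<Rightarrow> (real \<Rightarrow> real) \<Rightarrow> real" where
  "H1_norm v g = sqrt ((L2_norm unit_ival v)\<^sup>2 + (L2_norm unit_ival g)\<^sup>2)"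

text \<open>
  \<open>H01 v g\<close>: \<open>v\<close> lies in the \<open>H\<^sup>1\<close>-closure of \<open>C\<^sub>c\<^sup>1(0,1)\<close> and \<open>g\<close> is its weak derivative.
\<close>

definition H01 :: "(real \<Rightarrow> real) \<Rightarrow> (real \<Rightarrow> real) \<Rightarrow> bool" where
  "H01 v g \<longleftrightarrow> H1 v g \<and>
     (\<exists>\<phi>. (\<forall>k. C1c 0 1 (\<phi> k)) \<and>
          (\<lambda>k::nat. H1_norm (\<lambda>x. \<phi> k x - v x) (\<lambda>x. deriv (\<phi> k) x - g x)) \<longlonglongrightarrow> 0)"

text \<open>
  The dual \<open>H\<^sup>-\<^sup>1(0,1)\<close>. Functionals act on representatives; linearity and boundedness
  force them to agree on representatives that are equal almost everywhere.
\<close>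

definition Hm1 :: "((real \<Rightarrow> real) \<Rightarrow> real) \<Rightarrow> bool" where
  "Hm1 l \<longleftrightarrow>
     (\<forall>v g w h a b. H01 v g \<and> H01 w h \<longrightarrow> l (\<lambda>x. a * v x + b * w x) = a * l v + b * l w) \<and>
     (\<exists>c. \<forall>v g. H01 v g \<longrightarrow> \<bar>l v\<bar> \<le> c * H1_norm v g)"

definition Hm1_norm :: "((real \<Rightarrow> real) \<Rightarrow> real) \<Rightarrow> real" where
  "Hm1_norm l = Sup {\<bar>l v\<bar> |v g. H01 v g \<and> H1_norm v g \<le> 1}"

text \<open>
  \<open>L\<^sup>2(0,T;H\<^sup>-\<^sup>1(0,1))\<close>. Since \<open>H\<^sub>0\<^sup>1(0,1)\<close> is separable and reflexive, strong measurability amounts to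
  measurability of \<open>t \<mapsto> \<langle>w(t),v\<rangle>\<close> for all \<open>v\<close> (Pettis). The norm \<open>t \<mapsto> \<parallel>w(t)\<parallel>\<close> is then almost
  everywhere equal to a measurable function, so it is square integrable exactly when it
  is dominated by some \<open>h\<close> in \<open>L\<^sup>2(0,T)\<close>.
\<close>

definition L2_Hm1 :: "real \<Rightarrow> (real \<Rightarrow> (real \<Rightarrow> real) \<Rightarrow> real) \<Rightarrow> bool" where
  "L2_Hm1 T w \<longleftrightarrow>
     (\<forall>v g. H01 v g \<longrightarrow> set_borel_measurable lborel {0<..<T} (\<lambda>t. w t v)) \<and>
     (\<exists>h. L2_on {0<..<T} h \<and> (AE t\<in>{0<..<T} in lborel. Hm1 (w t) \<and> Hm1_norm (w t) \<le> h t))"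

text \<open>
  \<open>L\<^sup>2(0,T;H\<^sub>0\<^sup>1(0,1))\<close>, with \<open>g\<close> the spatial weak derivative of \<open>y\<close>; here \<open>L\<^sup>2(0,T;L\<^sup>2(0,1))\<close> is
  identified with \<open>L\<^sup>2(Q)\<close>. Points of \<open>Q\<close> are pairs \<open>(x, t)\<close>.
\<close>

definition cyl :: "real \<Rightarrow> (real \<times> real) set" where
  "cyl T = {0<..<1} \<times> {0<..<T}"

definition L2_H01 :: "real \<Rightarrow> (real \<times> real \<Rightarrow> real) \<Rightarrow> (real \<times> real \<Rightarrow> real) \<Rightarrow> bool" where
  "L2_H01 T y g \<longleftrightarrow> L2_on (cyl T) y \<and> L2_on (cyl T) g \<and>
     (AE t\<in>{0<..<T} in lborel. H01 (\<lambda>x. y (x, t)) (\<lambda>x. g (x, t)))"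

definition C_L2 :: "real \<Rightarrow> (real \<times> real \<Rightarrow> real) \<Rightarrow> bool" where
  "C_L2 T y \<longleftrightarrow>
     (\<forall>t\<in>{0..T}. L2_on unit_ival (\<lambda>x. y (x, t))) \<and>
     (\<forall>t\<in>{0..T}. ((\<lambda>s. L2_norm unit_ival (\<lambda>x. y (x, s) - y (x, t))) \<longlongrightarrow> 0) (at t within {0..T}))"

text \<open>
  The function \<open>w\<close> is the time derivative \<open>y\<^sub>t\<close>: the identity of Bochner integrals in \<open>H\<^sup>-\<^sup>1\<close> that
  defines it is tested against \<open>v\<close> in \<open>H\<^sub>0\<^sup>1\<close>. The representative \<open>y\<close> is the one in
  \<open>C([0,T];L\<^sup>2(0,1))\<close>, so \<open>\<lambda>x. y (x, t)\<close> is meaningful for every \<open>t\<close> in \<open>[0,T]\<close>, including \<open>0\<close> and \<open>T\<close>.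
\<close>

definition heat_weak_solution ::
  "real \<Rightarrow> (real \<Rightarrow> real) \<Rightarrow> (real \<times> real \<Rightarrow> real) \<Rightarrow> (real \<times> real \<Rightarrow> real) \<Rightarrow> bool" where
  "heat_weak_solution T y0 u y \<longleftrightarrow>
     C_L2 T y \<and>
     (AE x\<in>unit_ival in lborel. y (x, 0) = y0 x) \<and>
     (\<exists>g w. L2_H01 T y g \<and> L2_Hm1 T w \<and>
       (\<forall>v v'. H01 v v' \<longrightarrow>
          has_weak_deriv 0 T (\<lambda>t. L2_inner unit_ival (\<lambda>x. y (x, t)) v) (\<lambda>t. w t v) \<and>
          (AE t\<in>{0<..<T} in lborel.
             w t v + L2_inner unit_ival (\<lambda>x. g (x, t)) v' = L2_inner unit_ival (\<lambda>x. u (x, t)) v)))"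

text \<open>
  Since the weak solution is unique, the state \<open>y\<^sup>u\<close> enters the control problems as any \<open>y\<close> with
  \<open>heat_weak_solution T y0 u y\<close>.
\<close>

definition J_hard :: "real \<Rightarrow> (real \<times> real \<Rightarrow> real) \<Rightarrow> real" where
  "J_hard T u = 1/2 * (L2_norm (cyl T) u)\<^sup>2"

definition J_pen :: "real \<Rightarrow> (real \<Rightarrow> real) \<Rightarrow> real \<Rightarrow>
    (real \<times> real \<Rightarrow> real) \<Rightarrow> (real \<times> real \<Rightarrow> real) \<Rightarrow> real" where
  "J_pen T yT \<alpha> u y =
     1/2 * (L2_norm (cyl T) u)\<^sup>2 + \<alpha>/2 * (L2_norm unit_ival (\<lambda>x. y (x, T) - yT x))\<^sup>2"

definition feasible ::
  "real \<Rightarrow> (real \<Rightarrow> real) \<Rightarrow> (real \<Rightarrow> real) \<Rightarrow> (real \<times> real \<Rightarrow> real) \<Rightarrow> bool" where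
  "feasible T y0 yT u \<longleftrightarrow> L2_on (cyl T) u \<and>
     (\<exists>y. heat_weak_solution T y0 u y \<and> (AE x\<in>unit_ival in lborel. y (x, T) = yT x))"

definition optimal_hard ::
  "real \<Rightarrow> (real \<Rightarrow> real) \<Rightarrow> (real \<Rightarrow> real) \<Rightarrow> (real \<times> real \<Rightarrow> real) \<Rightarrow> bool" where
  "optimal_hard T y0 yT u \<longleftrightarrow>
     feasible T y0 yT u \<and> (\<forall>v. feasible T y0 yT v \<longrightarrow> J_hard T u \<le> J_hard T v)"

definition optimal_pen ::
  "real \<Rightarrow> (real \<Rightarrow> real) \<Rightarrow> (real \<Rightarrow> real) \<Rightarrow> real \<Rightarrow> (real \<times> real \<Rightarrow> real) \<Rightarrow> bool" where
  "optimal_pen T y0 yT \<alpha> u \<longleftrightarrow> L2_on (cyl T) u \<and>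
     (\<exists>y. heat_weak_solution T y0 u y \<and>
        (\<forall>v z. L2_on (cyl T) v \<and> heat_weak_solution T y0 v z \<longrightarrow>
           J_pen T yT \<alpha> u y \<le> J_pen T yT \<alpha> v z))"

definition eig :: "nat \<Rightarrow> real \<Rightarrow> real" where
  "eig n x = sqrt 2 * sin (real n * pi * x)"

definition lam :: "nat \<Rightarrow> real" where
  "lam n = (real n * pi)\<^sup>2"

definition coef :: "(real \<Rightarrow> real) \<Rightarrow> nat \<Rightarrow> real" where
  "coef f n = L2_inner unit_ival f (eig n)"

definition dcoef :: "real \<Rightarrow> (real \<Rightarrow> real) \<Rightarrow> (real \<Rightarrow> real) \<Rightarrow> nat \<Rightarrow> real" where
  "dcoef T y0 yT n = coef yT n - exp (- lam n * T) * coef y0 n"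

definition acoef :: "real \<Rightarrow> nat \<Rightarrow> real" where
  "acoef T n = (1 - exp (- 2 * lam n * T)) / (2 * lam n)"

text \<open>The series starts at \<open>n = 1\<close>, hence the shift by \<open>Suc\<close>.\<close>

definition source_cond :: "real \<Rightarrow> (real \<Rightarrow> real) \<Rightarrow> (real \<Rightarrow> real) \<Rightarrow> real \<Rightarrow> bool" where
  "source_cond T y0 yT \<theta> \<longleftrightarrow>
     summable (\<lambda>n. \<bar>dcoef T y0 yT (Suc n)\<bar>\<^sup>2 / acoef T (Suc n) powr (1 + 2 * \<theta>))"

end

theory Submission imports Defs begin

text \<open>
  Everything decouples in the modes \<open>e\<^sub>n(x)\<close>. Testing the weak equation with \<open>e\<^sub>n\<close> and the
  integrating factor \<open>\<rho>\<^sub>n(t) = exp(-\<lambda>\<^sub>n(T - t))\<close> (lemma \<open>coef_terminal_state\<close>) shows that the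
  \<open>n\<close>-th coefficient of \<open>y(T) - y\<^sub>T\<close> is \<open>r\<^sub>n = \<langle>u, e\<^sub>n \<otimes> \<rho>\<^sub>n\<rangle> - d\<^sub>n\<close>, and \<open>a\<^sub>n\<close> is the square of the
  norm of \<open>\<rho>\<^sub>n\<close> in \<open>L\<^sup>2(0,T)\<close>.

  Conversely, changing the control by \<open>e\<^sub>n \<otimes> \<psi>\<close> with \<open>\<psi>\<close> continuous changes the state by
  \<open>e\<^sub>n \<otimes> \<zeta>\<close>, where \<open>\<zeta>\<close> solves a scalar linear equation (\<open>heat_weak_solution_add_mode\<close>). These explicit
  variations carry all the information in the optimality conditions. For the penalized problem they give
  \<open>\<langle>u\<^sub>\<alpha>, e\<^sub>n \<otimes> \<psi>\<rangle> = -\<alpha> r\<^sub>n \<langle>\<psi>, \<rho>\<^sub>n\<rangle>\<close> (\<open>optimal_pen_modes\<close>), and with \<open>\<psi> = \<rho>\<^sub>n\<close> this becomes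
  \<open>r\<^sub>n = -d\<^sub>n / (1 + \<alpha> a\<^sub>n)\<close>. For the hard problem, variations with \<open>\<psi>\<close> orthogonal to \<open>\<rho>\<^sub>n\<close> keep the terminal
  state, whence \<open>\<langle>u\<^sup>*, e\<^sub>n \<otimes> \<psi>\<rangle> = (d\<^sub>n / a\<^sub>n) \<langle>\<psi>, \<rho>\<^sub>n\<rangle>\<close> (\<open>optimal_hard_modes\<close>).

  By completeness of the sine system (\<open>mode_bessel_converse\<close>, \<open>sine_bessel_converse\<close>),
  \<open>\<parallel>y\<^sub>\<alpha>(T) - y\<^sub>T\<parallel>\<^sup>2 \<le> \<Sum>\<^sub>n d\<^sub>n\<^sup>2 / (1 + \<alpha> a\<^sub>n)\<^sup>2\<close> and
  \<open>\<parallel>u\<^sub>\<alpha> - u\<^sup>*\<parallel>\<^sup>2 \<le> \<Sum>\<^sub>n d\<^sub>n\<^sup>2 / (a\<^sub>n (1 + \<alpha> a\<^sub>n)\<^sup>2)\<close>,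
  and both rates follow from \<open>(\<alpha> a\<^sub>n)\<^sup>p \<le> (1 + \<alpha> a\<^sub>n)\<^sup>2\<close> for \<open>0 \<le> p \<le> 2\<close>, used with \<open>p = 1 + 2\<theta>\<close> and
  with \<open>p = 2\<theta>\<close>. These two choices are the reason for the upper limits \<open>1/2\<close> and \<open>1\<close> on \<open>\<theta>\<close>.
\<close>

section \<open>The space L2\<close>

lemma L2_on_measurable:
  assumes "L2_on S f" shows "(\<lambda>x. indicator S x *\<^sub>R f x) \<in> borel_measurable lborel"
  using assms by (simp add: L2_on_def set_borel_measurable_def)

lemma L2_on_mult_integrable:
  assumes "L2_on S f" "L2_on S g"
  shows "set_integrable lborel S (\<lambda>x. f x * g x)"
  unfolding set_integrable_def
proof (rule Bochner_Integration.integrable_bound)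
  show "integrable lborel (\<lambda>x. indicator S x *\<^sub>R (f x)\<^sup>2 + indicator S x *\<^sub>R (g x)\<^sup>2)"
    using assms by (auto simp: L2_on_def set_integrable_def)
  have "(\<lambda>x. indicator S x *\<^sub>R (f x * g x)) =
        (\<lambda>x. (indicator S x *\<^sub>R f x) * (indicator S x *\<^sub>R g x))"
    by (auto simp: indicator_def)
  then show "(\<lambda>x. indicator S x *\<^sub>R (f x * g x)) \<in> borel_measurable lborel"
    using L2_on_measurable[OF assms(1)] L2_on_measurable[OF assms(2)] by simp
  have "\<bar>f x * g x\<bar> \<le> (f x)\<^sup>2 + (g x)\<^sup>2" for x
    using sum_squares_bound[of "\<bar>f x\<bar>" "\<bar>g x\<bar>"] mult_nonneg_nonneg[of "\<bar>f x\<bar>" "\<bar>g x\<bar>"]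
    unfolding abs_mult power2_abs by linarith
  then show "AE x in lborel. norm (indicator S x *\<^sub>R (f x * g x))
      \<le> norm (indicator S x *\<^sub>R (f x)\<^sup>2 + indicator S x *\<^sub>R (g x)\<^sup>2)"
    by (auto simp: indicator_def)
qed

lemma L2_on_add:
  assumes "L2_on S f" "L2_on S g"
  shows "L2_on S (\<lambda>x. f x + g x)"
  unfolding L2_on_def
proof
  have "(\<lambda>x. indicator S x *\<^sub>R (f x + g x)) =
        (\<lambda>x. indicator S x *\<^sub>R f x + indicator S x *\<^sub>R g x)"
    by (auto simp: algebra_simps)
  then show "set_borel_measurable lborel S (\<lambda>x. f x + g x)"
    using L2_on_measurable[OF assms(1)] L2_on_measurable[OF assms(2)]
    by (simp add: set_borel_measurable_def)
  have "(\<lambda>x. (f x + g x)\<^sup>2) = (\<lambda>x. ((f x)\<^sup>2 + (g x)\<^sup>2) + 2 * (f x * g x))"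
    by (auto simp: power2_eq_square algebra_simps)
  then show "set_integrable lborel S (\<lambda>x. (f x + g x)\<^sup>2)"
    using L2_on_mult_integrable[OF assms] assms
    by (simp only: L2_on_def) (intro set_integral_add(1) set_integrable_mult_right; blast)
qed

lemma L2_on_cmult:
  assumes "L2_on S f"
  shows "L2_on S (\<lambda>x. c * f x)"
  unfolding L2_on_def
proof
  have "(\<lambda>x. indicator S x *\<^sub>R (c * f x)) = (\<lambda>x. c * (indicator S x *\<^sub>R f x))"
    by (auto simp: algebra_simps)
  then show "set_borel_measurable lborel S (\<lambda>x. c * f x)"
    using L2_on_measurable[OF assms(1)] by (simp add: set_borel_measurable_def)
  show "set_integrable lborel S (\<lambda>x. (c * f x)\<^sup>2)"
    using assms by (auto simp: L2_on_def power_mult_distrib)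
qed

lemma L2_on_diff:
  assumes "L2_on S f" "L2_on S g"
  shows "L2_on S (\<lambda>x. f x - g x)"
  using L2_on_add[OF assms(1) L2_on_cmult[OF assms(2), of "-1"]] by simp

lemma L2_on_zero: "L2_on S (\<lambda>x. 0)"
  by (simp add: L2_on_def set_borel_measurable_def set_integrable_def)

lemma L2_on_sum:
  assumes "\<And>i. i \<in> I \<Longrightarrow> L2_on S (f i)"
  shows "L2_on S (\<lambda>x. \<Sum>i\<in>I. f i x)"
  using assms by (induction I rule: infinite_finite_induct) (auto intro: L2_on_zero L2_on_add)

lemma L2_on_continuous:
  fixes f :: "'a::euclidean_space \<Rightarrow> real"
  assumes K: "compact K" "continuous_on K f" and S: "S \<subseteq> K" "S \<in> sets borel"
  shows "L2_on S f"
  unfolding L2_on_def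
proof
  have "set_integrable lborel K f"
    using K unfolding set_integrable_def by (rule borel_integrable_compact)
  then have "set_integrable lborel S f"
    by (rule set_integrable_subset) (use S in auto)
  then show "set_borel_measurable lborel S f"
    by (simp add: set_integrable_def set_borel_measurable_def)
  have "set_integrable lborel K (\<lambda>x. (f x)\<^sup>2)"
    using K unfolding set_integrable_def by (intro borel_integrable_compact continuous_intros)
  then show "set_integrable lborel S (\<lambda>x. (f x)\<^sup>2)"
    by (rule set_integrable_subset) (use S in auto)
qed

lemma L2_on_ival:
  assumes "continuous_on {a..b::real} f" shows "L2_on {a<..<b} f"
  by (rule L2_on_continuous[OF _ assms]) auto

lemma L2_inner_commute: "L2_inner S f g = L2_inner S g f"
  by (simp add: L2_inner_def mult.commute)

lemma L2_inner_add_left: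
  assumes "L2_on S f" "L2_on S g" "L2_on S h"
  shows "L2_inner S (\<lambda>x. f x + g x) h = L2_inner S f h + L2_inner S g h"
  using set_integral_add(2)[OF L2_on_mult_integrable[OF assms(1,3)] L2_on_mult_integrable[OF assms(2,3)]]
  by (simp add: L2_inner_def algebra_simps)

lemma L2_inner_cmult_left: "L2_inner S (\<lambda>x. c * f x) h = c * L2_inner S f h"
  by (simp add: L2_inner_def mult.assoc)

lemma L2_inner_diff_left:
  assumes "L2_on S f" "L2_on S g" "L2_on S h"
  shows "L2_inner S (\<lambda>x. f x - g x) h = L2_inner S f h - L2_inner S g h"
  using set_integral_diff(2)[OF L2_on_mult_integrable[OF assms(1,3)] L2_on_mult_integrable[OF assms(2,3)]]
  by (simp add: L2_inner_def algebra_simps)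

lemma L2_inner_zero_left: "L2_inner S (\<lambda>x. 0) h = 0"
  by (simp add: L2_inner_def)

lemma L2_inner_sum_left:
  assumes "\<And>i. i \<in> I \<Longrightarrow> L2_on S (f i)" "L2_on S h"
  shows "L2_inner S (\<lambda>x. \<Sum>i\<in>I. f i x) h = (\<Sum>i\<in>I. L2_inner S (f i) h)"
  using assms
  by (induction I rule: infinite_finite_induct)
     (auto simp: L2_inner_zero_left L2_inner_add_left L2_on_sum)

lemma L2_inner_self_nonneg: "0 \<le> L2_inner S f f"
  unfolding L2_inner_def set_lebesgue_integral_def by (rule integral_nonneg_AE) auto

lemma L2_norm_power2: "(L2_norm S f)\<^sup>2 = L2_inner S f f"
  using L2_inner_self_nonneg[of S f] by (simp add: L2_norm_def L2_inner_def power2_eq_square)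

lemma L2_norm_nonneg: "0 \<le> L2_norm S f"
  using L2_inner_self_nonneg[of S f] by (simp add: L2_norm_def L2_inner_def power2_eq_square)

lemma L2_inner_self_add:
  assumes f: "L2_on S f" and g: "L2_on S g"
  shows "L2_inner S (\<lambda>x. f x + c * g x) (\<lambda>x. f x + c * g x)
       = L2_inner S f f + 2 * c * L2_inner S f g + c\<^sup>2 * L2_inner S g g"
proof -
  have cg: "L2_on S (\<lambda>x. c * g x)" by (rule L2_on_cmult[OF g])
  have s: "L2_on S (\<lambda>x. f x + c * g x)" by (rule L2_on_add[OF f cg])
  have "L2_inner S (\<lambda>x. f x + c * g x) h = L2_inner S f h + c * L2_inner S g h" if "L2_on S h" for h
    using that by (simp add: L2_inner_add_left[OF f cg] L2_inner_cmult_left)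
  note left = this
  have right: "L2_inner S h (\<lambda>x. f x + c * g x) = L2_inner S h f + c * L2_inner S h g" if "L2_on S h" for h
    using left[OF that] by (metis L2_inner_commute)
  show ?thesis
    unfolding left[OF s] right[OF f] right[OF g] L2_inner_commute[of S g f]
    by (simp add: algebra_simps power2_eq_square)
qed

text \<open>
  The first-order condition for the minimum at \<open>\<tau> = 0\<close> of a quadratic function of the size \<open>\<tau>\<close> of a
  variation.
\<close>

lemma quadratic_nonneg_imp_linear_zero:
  fixes b c :: real
  assumes "\<And>\<tau>. 0 \<le> 2 * \<tau> * b + \<tau>\<^sup>2 * c"
  shows "b = 0"
proof (rule ccontr)
  assume b: "b \<noteq> 0"
  have 1: "0 \<le> -2 * b\<^sup>2 * s + s\<^sup>2 * b\<^sup>2 * c" for s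
    using assms[of "- s * b"] by (simp add: power2_eq_square algebra_simps)
  have "0 < b\<^sup>2" using b by simp
  have "0 \<le> b\<^sup>2 * (s * (s * c - 2))" for s
    using 1[of s] by (simp add: power2_eq_square algebra_simps)
  then have *: "0 \<le> s * (s * c - 2)" for s
    using \<open>0 < b\<^sup>2\<close> by (meson zero_le_mult_iff not_less)
  show False
  proof (cases "c \<le> 0")
    case True then show False using *[of 1] by simp
  next
    case False then show False using *[of "1 / c"] by (simp add: zero_le_mult_iff)
  qed
qed

lemma L2_Cauchy_Schwarz:
  assumes f: "L2_on S f" and g: "L2_on S g"
  shows "\<bar>L2_inner S f g\<bar> \<le> L2_norm S f * L2_norm S g"
proof -
  let ?F = "L2_inner S f f" and ?G = "L2_inner S g g" and ?b = "L2_inner S f g"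
  have q: "0 \<le> ?F + 2 * c * ?b + c\<^sup>2 * ?G" for c
    using L2_inner_self_add[OF f g, of c] L2_inner_self_nonneg by metis
  have "?b\<^sup>2 \<le> ?F * ?G"
  proof (cases "?G = 0")
    case True
    have "?b = 0"
    proof (rule ccontr)
      assume "?b \<noteq> 0"
      \<comment> \<open>The quadratic form is affine here, and this \<open>c\<close> makes it equal to \<open>-1\<close>.\<close>
      then show False using q[of "- (?F + 1) / (2 * ?b)"] True by (simp add: field_simps)
    qed
    then show ?thesis using True by simp
  next
    case False
    then have G: "?G > 0" using L2_inner_self_nonneg[of S g] by linarith
    have "0 \<le> ?F - ?b\<^sup>2 / ?G"
      using q[of "- ?b / ?G"] G by (simp add: field_simps power2_eq_square)
    then show ?thesis using G by (simp add: field_simps)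
  qed
  also have "\<dots> = (L2_norm S f * L2_norm S g)\<^sup>2"
    by (simp add: power_mult_distrib L2_norm_power2)
  finally show ?thesis
    using L2_norm_nonneg[of S f] L2_norm_nonneg[of S g]
    by (simp add: abs_le_square_iff[symmetric])
qed

lemma L2_norm_triangle:
  assumes f: "L2_on S f" and g: "L2_on S g"
  shows "L2_norm S (\<lambda>x. f x + g x) \<le> L2_norm S f + L2_norm S g"
proof (rule power2_le_imp_le)
  have "(L2_norm S (\<lambda>x. f x + g x))\<^sup>2 = L2_inner S f f + 2 * L2_inner S f g + L2_inner S g g"
    using L2_inner_self_add[OF f g, of 1] by (simp add: L2_norm_power2)
  also have "\<dots> \<le> (L2_norm S f + L2_norm S g)\<^sup>2"
    using L2_Cauchy_Schwarz[OF f g] by (simp add: power2_sum L2_norm_power2)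
  finally show "(L2_norm S (\<lambda>x. f x + g x))\<^sup>2 \<le> (L2_norm S f + L2_norm S g)\<^sup>2" .
qed (simp add: L2_norm_nonneg)

lemma L2_norm_cmult: "L2_norm S (\<lambda>x. c * f x) = \<bar>c\<bar> * L2_norm S f"
  by (simp add: L2_norm_def power_mult_distrib real_sqrt_mult)

lemma L2_inner_cong_AE:
  assumes "L2_on S f" "L2_on S f'" "L2_on S g" and ae: "AE x\<in>S in lborel. f x = f' x"
  shows "L2_inner S f g = L2_inner S f' g"
  unfolding L2_inner_def set_lebesgue_integral_def
proof (rule integral_cong_AE)
  show "(\<lambda>x. indicator S x *\<^sub>R (f x * g x)) \<in> borel_measurable lborel"
    "(\<lambda>x. indicator S x *\<^sub>R (f' x * g x)) \<in> borel_measurable lborel"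
    using L2_on_mult_integrable[OF assms(1,3)] L2_on_mult_integrable[OF assms(2,3)]
    by (auto simp: set_integrable_def)
  show "AE x in lborel. indicator S x *\<^sub>R (f x * g x) = indicator S x *\<^sub>R (f' x * g x)"
    using ae by eventually_elim (auto simp: indicator_def)
qed

section \<open>Test functions and weak derivatives on an interval\<close>

lemma set_integral_Ioo_eq_Icc:
  fixes f :: "real \<Rightarrow> real"
  shows "(LINT x:{a<..<b}|lborel. f x) = (LINT x:{a..b}|lborel. f x)"
  unfolding set_lebesgue_integral_def
proof (rule integral_discrete_difference[of "{a,b}"])
  show "\<And>x. x \<notin> {a, b} \<Longrightarrow> indicator {a<..<b} x *\<^sub>R f x = indicator {a..b} x *\<^sub>R f x"
    by (auto simp: indicator_def)
qed auto

lemma set_integral_FTC: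
  fixes F f :: "real \<Rightarrow> real"
  assumes "a \<le> b"
    and "\<And>x. x \<in> {a..b} \<Longrightarrow> (F has_vector_derivative f x) (at x within {a..b})"
    and "continuous_on {a..b} f"
  shows "(LINT x:{a<..<b}|lborel. f x) = F b - F a"
  unfolding set_integral_Ioo_eq_Icc
  unfolding set_lebesgue_integral_def
  using assms by (intro integral_FTC_atLeastAtMost) auto

lemma C1c_has_deriv:
  assumes "C1c a b \<phi>" shows "(\<phi> has_real_derivative deriv \<phi> x) (at x)"
  using assms unfolding C1c_def C1_differentiable_on_def
  by (metis DERIV_imp_deriv has_real_derivative_iff_has_vector_derivative iso_tuple_UNIV_I)

lemma C1c_continuous: assumes "C1c a b \<phi>" shows "continuous_on A \<phi>"
  using C1c_has_deriv[OF assms] DERIV_continuous_on has_field_derivative_at_within by blast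

lemma C1c_continuous_deriv:
  assumes "C1c a b \<phi>" shows "continuous_on A (deriv \<phi>)"
proof -
  obtain D where D: "\<And>x. (\<phi> has_vector_derivative D x) (at x)" "continuous_on UNIV D"
    using assms unfolding C1c_def C1_differentiable_on_def by auto
  have "deriv \<phi> = D"
    using D(1) by (auto simp: has_real_derivative_iff_has_vector_derivative[symmetric] DERIV_imp_deriv)
  then show ?thesis using D(2) continuous_on_subset by blast
qed

lemma C1c_outside:
  assumes "C1c a b \<phi>" "x \<notin> {a<..<b}" shows "\<phi> x = 0"
  using assms closure_subset[of "{x. \<phi> x \<noteq> 0}"] unfolding C1c_def by blast

text \<open>
  A \<open>C\<^sup>1\<close> function that vanishes off a compact subinterval is a test function; the subinterval
  contains the closure of the support.
\<close>

lemma C1cI: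
  assumes d: "\<And>x. (\<phi> has_real_derivative \<phi>' x) (at x)" and c: "continuous_on UNIV \<phi>'"
    and "a < a'" "b' < b" and z: "\<And>x. x \<notin> {a'..b'} \<Longrightarrow> \<phi> x = 0"
  shows "C1c a b \<phi>" "deriv \<phi> = \<phi>'"
proof -
  have "closure {x. \<phi> x \<noteq> 0} \<subseteq> {a'..b'}"
    by (intro closure_minimal) (use z in \<open>auto simp del: not_le, (meson atLeastAtMost_iff)+\<close>)
  then show "C1c a b \<phi>"
    using assms unfolding C1c_def C1_differentiable_on_def
    by (force simp: has_real_derivative_iff_has_vector_derivative[symmetric])
  show "deriv \<phi> = \<phi>'" using d by (auto intro: DERIV_imp_deriv)
qed

text \<open>
  Integration by parts: test functions vanish at the end points.
\<close>

lemma has_weak_deriv_C1: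
  assumes ab: "a \<le> b"
    and F: "\<And>x. x \<in> {a..b} \<Longrightarrow> (F has_vector_derivative f x) (at x within {a..b})"
    and f: "continuous_on {a..b} f"
  shows "has_weak_deriv a b F f"
  unfolding has_weak_deriv_def
proof (intro allI impI)
  fix \<phi> assume \<phi>: "C1c a b \<phi>"
  have cF: "continuous_on {a..b} F"
    using F by (rule continuous_on_vector_derivative)
  have d: "((\<lambda>x. F x * \<phi> x) has_vector_derivative (F x * deriv \<phi> x + f x * \<phi> x)) (at x within {a..b})"
    if "x \<in> {a..b}" for x
    using F[OF that] C1c_has_deriv[OF \<phi>, of x]
    unfolding has_real_derivative_iff_has_vector_derivative[symmetric]
    by (auto intro!: derivative_eq_intros dest: has_field_derivative_at_within)
  have c: "continuous_on {a..b} (\<lambda>x. F x * deriv \<phi> x + f x * \<phi> x)"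
    by (intro continuous_intros cF f C1c_continuous[OF \<phi>] C1c_continuous_deriv[OF \<phi>])
  have "(LINT x:{a<..<b}|lborel. F x * deriv \<phi> x + f x * \<phi> x) = 0"
    using set_integral_FTC[OF ab d c] C1c_outside[OF \<phi>] by auto
  moreover have "(LINT x:{a<..<b}|lborel. F x * deriv \<phi> x + f x * \<phi> x)
      = L2_inner {a<..<b} F (deriv \<phi>) + L2_inner {a<..<b} f \<phi>"
    unfolding L2_inner_def
    by (intro set_integral_add L2_on_mult_integrable L2_on_ival cF f
        C1c_continuous[OF \<phi>] C1c_continuous_deriv[OF \<phi>])
  ultimately show "L2_inner {a<..<b} F (deriv \<phi>) = - L2_inner {a<..<b} f \<phi>" by simp
qed

section \<open>Functions on the cylinder\<close>

abbreviation tensor :: "(real \<Rightarrow> real) \<Rightarrow> (real \<Rightarrow> real) \<Rightarrow> real \<times> real \<Rightarrow> real" where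
  "tensor v \<psi> \<equiv> (\<lambda>q. v (fst q) * \<psi> (snd q))"

lemma indicator_cyl: "indicator (cyl T) (x, t) = (indicator unit_ival x * indicator {0<..<T} t :: real)"
  by (auto simp: cyl_def indicator_def)

lemma cyl_Fubini:
  fixes F :: "real \<times> real \<Rightarrow> real"
  assumes F: "set_integrable lborel (cyl T) F"
  shows "set_integrable lborel {0<..<T} (\<lambda>t. LINT x:unit_ival|lborel. F (x, t))"
    and "(LINT t:{0<..<T}|lborel. LINT x:unit_ival|lborel. F (x, t)) = (LINT q:cyl T|lborel. F q)"
    and "AE t\<in>{0<..<T} in lborel. set_integrable lborel unit_ival (\<lambda>x. F (x, t))"
proof -
  let ?G = "\<lambda>x t. indicator (cyl T) (x, t) *\<^sub>R F (x, t)"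
  have G: "integrable (lborel \<Otimes>\<^sub>M lborel) (case_prod ?G)"
    using F unfolding set_integrable_def lborel_prod by (simp add: case_prod_unfold)
  have e: "(LINT x|lborel. ?G x t) = indicator {0<..<T} t *\<^sub>R (LINT x:unit_ival|lborel. F (x, t))" for t
    by (cases "t \<in> {0<..<T}") (auto simp: indicator_cyl set_lebesgue_integral_def)
  show "set_integrable lborel {0<..<T} (\<lambda>t. LINT x:unit_ival|lborel. F (x, t))"
    using lborel_pair.integrable_snd[OF G] unfolding e set_integrable_def .
  show "(LINT t:{0<..<T}|lborel. LINT x:unit_ival|lborel. F (x, t)) = (LINT q:cyl T|lborel. F q)"
    using lborel_pair.integral_snd[OF G] unfolding e lborel_prod set_lebesgue_integral_def
    by (simp add: case_prod_unfold)
  show "AE t\<in>{0<..<T} in lborel. set_integrable lborel unit_ival (\<lambda>x. F (x, t))"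
    using lborel_pair.AE_integrable_snd[OF G]
    by eventually_elim (auto simp: indicator_cyl set_integrable_def)
qed

text \<open>
  Tonelli's theorem applies because the integral of the modulus factorizes.
\<close>

lemma integrable_mult_prod:
  fixes f g :: "real \<Rightarrow> real"
  assumes f: "integrable lborel f" and g: "integrable lborel g"
  shows "integrable (lborel \<Otimes>\<^sub>M lborel) (\<lambda>(x, t). f x * g t)"
proof -
  have [measurable]: "f \<in> borel_measurable lborel" "g \<in> borel_measurable lborel"
    using f g by auto
  show ?thesis
  proof (rule lborel_pair.Fubini_integrable)
    show "(\<lambda>(x, t). f x * g t) \<in> borel_measurable (lborel \<Otimes>\<^sub>M lborel)" by measurable
    show "integrable lborel (\<lambda>x. LINT y|lborel. norm (case (x, y) of (x, t) \<Rightarrow> f x * g t))"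
      using f by (simp add: abs_mult)
    show "AE x in lborel. integrable lborel (\<lambda>y. case (x, y) of (x, t) \<Rightarrow> f x * g t)"
      using g by simp
  qed
qed

lemma L2_on_tensor:
  assumes v: "L2_on unit_ival v" and \<psi>: "L2_on {0<..<T} \<psi>"
  shows "L2_on (cyl T) (tensor v \<psi>)"
  unfolding L2_on_def
proof
  have e: "(\<lambda>q. indicator (cyl T) q *\<^sub>R (v (fst q) * \<psi> (snd q)))
     = (\<lambda>(x, t). (indicator unit_ival x *\<^sub>R v x) * (indicator {0<..<T} t *\<^sub>R \<psi> t))"
    by (auto simp: indicator_cyl)
  have "(\<lambda>(x, t). (indicator unit_ival x *\<^sub>R v x) * (indicator {0<..<T} t *\<^sub>R \<psi> t))
     \<in> borel_measurable (lborel \<Otimes>\<^sub>M lborel)"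
    using L2_on_measurable[OF v] L2_on_measurable[OF \<psi>]
    by (auto simp: split_beta intro!: borel_measurable_times measurable_compose[OF measurable_fst] measurable_compose[OF measurable_snd])
  then show "set_borel_measurable lborel (cyl T) (tensor v \<psi>)"
    unfolding set_borel_measurable_def e lborel_prod .
  have e2: "(\<lambda>q. indicator (cyl T) q *\<^sub>R (v (fst q) * \<psi> (snd q))\<^sup>2)
     = (\<lambda>(x, t). (indicator unit_ival x *\<^sub>R (v x)\<^sup>2) * (indicator {0<..<T} t *\<^sub>R (\<psi> t)\<^sup>2))"
    by (auto simp: indicator_cyl power_mult_distrib)
  have "integrable (lborel \<Otimes>\<^sub>M lborel)
     (\<lambda>(x, t). (indicator unit_ival x *\<^sub>R (v x)\<^sup>2) * (indicator {0<..<T} t *\<^sub>R (\<psi> t)\<^sup>2))"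
    using v \<psi> unfolding L2_on_def set_integrable_def
    by (intro integrable_mult_prod) auto
  then show "set_integrable lborel (cyl T) (\<lambda>q. (v (fst q) * \<psi> (snd q))\<^sup>2)"
    unfolding set_integrable_def e2 lborel_prod .
qed

lemma L2_norm_dominated_convergence:
  fixes g :: "nat \<Rightarrow> 'a::euclidean_space \<Rightarrow> real"
  assumes h: "L2_on S h" and g: "\<And>k. L2_on S (g k)"
    and bd: "\<And>k x. x \<in> S \<Longrightarrow> \<bar>g k x\<bar> \<le> h x"
    and lim: "AE x\<in>S in lborel. (\<lambda>k. g k x) \<longlonglongrightarrow> 0"
  shows "(\<lambda>k. L2_norm S (g k)) \<longlonglongrightarrow> 0"
proof -
  have "(\<lambda>k. LINT x|lborel. indicator S x *\<^sub>R (g k x)\<^sup>2) \<longlonglongrightarrow> (LINT x::'a|lborel. (0::real))"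
  proof (rule integral_dominated_convergence[where w = "\<lambda>x. indicator S x *\<^sub>R (h x)\<^sup>2"])
    show "integrable lborel (\<lambda>x. indicator S x *\<^sub>R (h x)\<^sup>2)"
      using h by (simp add: L2_on_def set_integrable_def)
    show "(\<lambda>x. indicator S x *\<^sub>R (g k x)\<^sup>2) \<in> borel_measurable lborel" for k
      using g[of k] unfolding L2_on_def set_integrable_def by (blast intro: borel_measurable_integrable)
    show "AE x in lborel. (\<lambda>k. indicator S x *\<^sub>R (g k x)\<^sup>2) \<longlonglongrightarrow> 0"
      using lim
    proof eventually_elim
      case (elim x)
      then show ?case using tendsto_power[of "\<lambda>k. g k x" 0 sequentially 2]
        by (cases "x \<in> S") auto
    qed
    show "AE x in lborel. norm (indicator S x *\<^sub>R (g k x)\<^sup>2) \<le> indicator S x *\<^sub>R (h x)\<^sup>2" for k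
      using bd by (intro AE_I2) (auto simp: indicator_def abs_le_square_iff[symmetric] intro: order_trans[OF bd abs_ge_self])
  qed auto
  then show ?thesis
    using tendsto_real_sqrt[of "\<lambda>k. LINT x|lborel. indicator S x *\<^sub>R (g k x)\<^sup>2" 0 sequentially]
    by (simp add: L2_norm_def set_lebesgue_integral_def)
qed

lemma L2_norm_bounded_convergence:
  fixes g :: "nat \<Rightarrow> 'a::euclidean_space \<Rightarrow> real"
  assumes S: "S \<in> sets borel" "bounded S"
    and g: "\<And>k. L2_on S (g k)"
    and bd: "\<And>k x. x \<in> S \<Longrightarrow> \<bar>g k x\<bar> \<le> B"
    and lim: "AE x\<in>S in lborel. (\<lambda>k. g k x) \<longlonglongrightarrow> 0"
  shows "(\<lambda>k. L2_norm S (g k)) \<longlonglongrightarrow> 0"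
proof (rule L2_norm_dominated_convergence[OF _ g bd lim])
  show "L2_on S (\<lambda>_. B)"
    using S by (intro L2_on_continuous[of "closure S"] closure_subset continuous_intros) auto
qed

section \<open>Cutoff functions\<close>

lemma has_real_derivative_pos_part_squared:
  "((\<lambda>x::real. (max 0 x)\<^sup>2) has_real_derivative 2 * max 0 x) (at x)"
proof -
  consider "x > 0" | "x < 0" | "x = 0" by linarith
  then show ?thesis
  proof cases
    case 1
    have "((\<lambda>x::real. x\<^sup>2) has_real_derivative 2 * max 0 x) (at x)"
      using 1 by (auto intro!: derivative_eq_intros)
    then show ?thesis
      by (rule has_field_derivative_transform_within_open[of _ _ _ "{0<..}"]) (use 1 in auto)
  next
    case 2
    have "((\<lambda>x::real. 0) has_real_derivative 2 * max 0 x) (at x)"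
      using 2 by (auto intro!: derivative_eq_intros)
    then show ?thesis
      by (rule has_field_derivative_transform_within_open[of _ _ _ "{..<0}"]) (use 2 in auto)
  next
    case 3
    have eq: "\<forall>\<^sub>F h in at (0::real). max 0 h = (max 0 h)\<^sup>2 / h"
      by (simp add: eventually_at_filter max_def power2_eq_square)
    have "((\<lambda>h. max 0 h) \<longlongrightarrow> max 0 0) (at (0::real))"
      by (intro tendsto_intros)
    then have "((\<lambda>h::real. (max 0 h)\<^sup>2 / h) \<longlongrightarrow> 0) (at 0)"
      using Lim_transform_eventually[OF _ eq] by simp
    then show ?thesis using 3 by (simp add: DERIV_def)
  qed
qed

text \<open>
  A quadratic spline rising from \<open>0\<close> at \<open>r = 1\<close> to \<open>1\<close> at \<open>r = 2\<close>. Squares of positive parts are \<open>C\<^sup>1\<close>,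
  and its derivative is a hat function.
\<close>

definition ramp :: "real \<Rightarrow> real" where
  "ramp r = 2 * (max 0 (r - 1))\<^sup>2 - 4 * (max 0 (r - 3/2))\<^sup>2 + 2 * (max 0 (r - 2))\<^sup>2"

definition ramp' :: "real \<Rightarrow> real" where
  "ramp' r = 4 * max 0 (r - 1) - 8 * max 0 (r - 3/2) + 4 * max 0 (r - 2)"

lemma ramp_deriv: "(ramp has_real_derivative ramp' r) (at r)"
proof -
  have d: "((\<lambda>r. (max 0 (r - c))\<^sup>2) has_real_derivative 2 * max 0 (r - c) * (1 - 0)) (at r)" for c
    by (rule DERIV_chain2[where f = "\<lambda>x. (max 0 x)\<^sup>2" and g = "\<lambda>r. r - c"])
       (rule has_real_derivative_pos_part_squared DERIV_diff DERIV_ident DERIV_const)+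
  have "((\<lambda>r. 2 * (max 0 (r - 1))\<^sup>2 - 4 * (max 0 (r - 3/2))\<^sup>2 + 2 * (max 0 (r - 2))\<^sup>2)
     has_real_derivative 2 * (2 * max 0 (r - 1) * (1 - 0)) - 4 * (2 * max 0 (r - 3/2) * (1 - 0))
        + 2 * (2 * max 0 (r - 2) * (1 - 0))) (at r)"
    by (intro DERIV_add DERIV_diff DERIV_cmult d)
  then show ?thesis unfolding ramp_def[abs_def] ramp'_def by (simp add: mult.assoc)
qed

lemma ramp'_continuous: "continuous_on A ramp'"
  unfolding ramp'_def by (intro continuous_intros)

lemma ramp_0: "r \<le> 1 \<Longrightarrow> ramp r = 0"
  by (auto simp: ramp_def)

lemma ramp_1: "r \<ge> 2 \<Longrightarrow> ramp r = 1" and ramp'_1: "r \<ge> 2 \<Longrightarrow> ramp' r = 0"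
  by (auto simp: ramp_def ramp'_def power2_eq_square algebra_simps)

lemma ramp'_bounds: "0 \<le> ramp' r" "ramp' r \<le> 2"
  unfolding ramp'_def max_def by (auto split: if_splits)

lemma ramp_bounds: "0 \<le> ramp r" "ramp r \<le> 1"
proof -
  have mono: "ramp a \<le> ramp b" if "a \<le> b" for a b
    using DERIV_nonneg_imp_nondecreasing[OF that, of ramp] ramp_deriv ramp'_bounds by blast
  show "0 \<le> ramp r" using mono[of "min r 1" r] ramp_0[of "min r 1"] by auto
  show "ramp r \<le> 1" using mono[of r "max r 2"] ramp_1[of "max r 2"] by auto
qed

text \<open>
  At most one of the two ramps differs from \<open>1\<close> at any given point when \<open>4\<epsilon> \<le> T\<close>, so this sum acts as the
  product of the two ramps while its derivative splits into one bump near \<open>0\<close> and one near \<open>T\<close>.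
\<close>

definition cutoff :: "real \<Rightarrow> real \<Rightarrow> real \<Rightarrow> real" where
  "cutoff T \<epsilon> t = ramp (t / \<epsilon>) + ramp ((T - t) / \<epsilon>) - 1"

definition cutoff' :: "real \<Rightarrow> real \<Rightarrow> real \<Rightarrow> real" where
  "cutoff' T \<epsilon> t = ramp' (t / \<epsilon>) / \<epsilon> - ramp' ((T - t) / \<epsilon>) / \<epsilon>"

lemma cutoff_deriv:
  "(cutoff T \<epsilon> has_real_derivative cutoff' T \<epsilon> t) (at t)"
proof -
  have "((\<lambda>t. ramp (t / \<epsilon>)) has_real_derivative ramp' (t / \<epsilon>) * (1 / \<epsilon>)) (at t)"
    by (rule DERIV_chain2[OF ramp_deriv DERIV_cdivide[OF DERIV_ident]])
  moreover have "((\<lambda>t. ramp ((T - t) / \<epsilon>)) has_real_derivative ramp' ((T - t) / \<epsilon>) * ((0 - 1) / \<epsilon>)) (at t)"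
    by (rule DERIV_chain2[OF ramp_deriv DERIV_cdivide[OF DERIV_diff[OF DERIV_const DERIV_ident]]])
  ultimately have "((\<lambda>t. ramp (t / \<epsilon>) + ramp ((T - t) / \<epsilon>) - 1) has_real_derivative
      ramp' (t / \<epsilon>) * (1 / \<epsilon>) + ramp' ((T - t) / \<epsilon>) * ((0 - 1) / \<epsilon>) - 0) (at t)"
    by (intro DERIV_diff DERIV_add DERIV_const)
  then show ?thesis unfolding cutoff_def[abs_def] cutoff'_def by simp
qed

lemma cutoff'_continuous: "\<epsilon> > 0 \<Longrightarrow> continuous_on A (cutoff' T \<epsilon>)"
  unfolding cutoff'_def[abs_def]
  by (intro continuous_intros continuous_on_compose2[OF ramp'_continuous[of UNIV]]) auto

context
  fixes T \<epsilon> :: real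
  assumes \<epsilon>: "0 < \<epsilon>" "4 * \<epsilon> \<le> T"
begin

lemma cutoff_alt:
  "t \<le> 2 * \<epsilon> \<or> t \<le> T - 2 * \<epsilon> \<Longrightarrow> cutoff T \<epsilon> t = ramp (t / \<epsilon>)"
  "t \<ge> 2 * \<epsilon> \<or> t \<ge> T - 2 * \<epsilon> \<Longrightarrow> cutoff T \<epsilon> t = ramp ((T - t) / \<epsilon>)"
  "t \<le> 2 * \<epsilon> \<or> t \<le> T - 2 * \<epsilon> \<Longrightarrow> cutoff' T \<epsilon> t = ramp' (t / \<epsilon>) / \<epsilon>"
  "t \<ge> 2 * \<epsilon> \<or> t \<ge> T - 2 * \<epsilon> \<Longrightarrow> cutoff' T \<epsilon> t = - ramp' ((T - t) / \<epsilon>) / \<epsilon>"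
proof -
  have "2 \<le> (T - t) / \<epsilon>" if "t \<le> 2 * \<epsilon> \<or> t \<le> T - 2 * \<epsilon>" using that \<epsilon> by (simp add: field_simps) linarith
  then show "t \<le> 2 * \<epsilon> \<or> t \<le> T - 2 * \<epsilon> \<Longrightarrow> cutoff T \<epsilon> t = ramp (t / \<epsilon>)"
    "t \<le> 2 * \<epsilon> \<or> t \<le> T - 2 * \<epsilon> \<Longrightarrow> cutoff' T \<epsilon> t = ramp' (t / \<epsilon>) / \<epsilon>"
    by (simp_all add: cutoff_def cutoff'_def ramp_1 ramp'_1)
  have "2 \<le> t / \<epsilon>" if "t \<ge> 2 * \<epsilon> \<or> t \<ge> T - 2 * \<epsilon>" using that \<epsilon> by (simp add: field_simps) linarith
  then show "t \<ge> 2 * \<epsilon> \<or> t \<ge> T - 2 * \<epsilon> \<Longrightarrow> cutoff T \<epsilon> t = ramp ((T - t) / \<epsilon>)"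
    "t \<ge> 2 * \<epsilon> \<or> t \<ge> T - 2 * \<epsilon> \<Longrightarrow> cutoff' T \<epsilon> t = - ramp' ((T - t) / \<epsilon>) / \<epsilon>"
    by (simp_all add: cutoff_def cutoff'_def ramp_1 ramp'_1)
qed

lemma cutoff_cases:
  obtains "t \<le> 2 * \<epsilon> \<or> t \<le> T - 2 * \<epsilon>" | "t \<ge> 2 * \<epsilon> \<or> t \<ge> T - 2 * \<epsilon>"
  by linarith

lemma cutoff_bounds: "0 \<le> cutoff T \<epsilon> t" "cutoff T \<epsilon> t \<le> 1"
  by (cases rule: cutoff_cases[of t]; simp add: cutoff_alt ramp_bounds)+

lemma cutoff_outside: "t \<notin> {\<epsilon>..T - \<epsilon>} \<Longrightarrow> cutoff T \<epsilon> t = 0"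
proof -
  assume "t \<notin> {\<epsilon>..T - \<epsilon>}"
  then consider "t < \<epsilon>" | "t > T - \<epsilon>" by force
  then show ?thesis
    using \<epsilon> by cases (auto simp: cutoff_alt intro!: ramp_0)
qed

lemma cutoff_middle: "2 * \<epsilon> \<le> t \<Longrightarrow> t \<le> T - 2 * \<epsilon> \<Longrightarrow> cutoff T \<epsilon> t = 1 \<and> cutoff' T \<epsilon> t = 0"
  using \<epsilon> by (auto simp: cutoff_alt ramp_1 ramp'_1 field_simps)

text \<open>
  The derivative has size \<open>2/\<epsilon>\<close> but lives within distance \<open>2\<epsilon>\<close> of the boundary. Hence it is
  uniformly bounded against functions that vanish linearly at the boundary.
\<close>

lemma cutoff'_bound: 
  assumes "t \<in> {0..T}" shows "\<bar>cutoff' T \<epsilon> t\<bar> * min t (T - t) \<le> 4"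
proof -
  have *: "\<bar>ramp' (s / \<epsilon>) / \<epsilon>\<bar> * s \<le> 4" if "s \<ge> 0" for s
  proof (cases "s \<le> 2 * \<epsilon>")
    case True
    then have "ramp' (s / \<epsilon>) * s \<le> 2 * (2 * \<epsilon>)"
      using that \<epsilon> ramp'_bounds by (intro mult_mono) auto
    then show ?thesis using \<epsilon> ramp'_bounds[of "s / \<epsilon>"] by (simp add: field_simps)
  next
    case False
    then have "ramp' (s / \<epsilon>) = 0" using \<epsilon> by (intro ramp'_1) (simp add: field_simps)
    then show ?thesis by simp
  qed
  have m: "\<bar>c\<bar> * min t (T - t) \<le> \<bar>c\<bar> * t" "\<bar>c\<bar> * min t (T - t) \<le> \<bar>c\<bar> * (T - t)" for c
    by (auto intro: mult_left_mono)
  show ?thesis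
  proof (cases rule: cutoff_cases[of t])
    case 1
    then show ?thesis using *[of t] m(1)[of "ramp' (t / \<epsilon>) / \<epsilon>"] assms cutoff_alt(3)[OF 1] by auto
  next
    case 2
    then show ?thesis using *[of "T - t"] m(2)[of "ramp' ((T - t) / \<epsilon>) / \<epsilon>"] assms cutoff_alt(4)[OF 2] by auto
  qed
qed

lemma cutoff_mult_C1c:
  assumes F: "\<And>x. (F has_real_derivative f x) (at x)" and f: "continuous_on UNIV f"
  shows "C1c 0 T (\<lambda>x. F x * cutoff T \<epsilon> x)"
    and "deriv (\<lambda>x. F x * cutoff T \<epsilon> x) = (\<lambda>x. F x * cutoff' T \<epsilon> x + f x * cutoff T \<epsilon> x)"
proof -
  have "((\<lambda>x. F x * cutoff T \<epsilon> x) has_real_derivative F x * cutoff' T \<epsilon> x + f x * cutoff T \<epsilon> x) (at x)" for x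
    using DERIV_mult[OF F cutoff_deriv] by (simp add: algebra_simps)
  moreover have "continuous_on UNIV F" "continuous_on UNIV (cutoff T \<epsilon>)"
    by (rule DERIV_continuous_on[OF F]) (rule DERIV_continuous_on[OF cutoff_deriv])
  then have "continuous_on UNIV (\<lambda>x. F x * cutoff' T \<epsilon> x + f x * cutoff T \<epsilon> x)"
    using f \<epsilon> by (intro continuous_intros cutoff'_continuous)
  moreover have "F x * cutoff T \<epsilon> x = 0" if "x \<notin> {\<epsilon>..T - \<epsilon>}" for x
    using cutoff_outside[OF that] by simp
  ultimately show "C1c 0 T (\<lambda>x. F x * cutoff T \<epsilon> x)"
    "deriv (\<lambda>x. F x * cutoff T \<epsilon> x) = (\<lambda>x. F x * cutoff' T \<epsilon> x + f x * cutoff T \<epsilon> x)"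
    using \<epsilon> by (auto intro!: C1cI(1)[of "\<lambda>x. F x * cutoff T \<epsilon> x" "\<lambda>x. F x * cutoff' T \<epsilon> x + f x * cutoff T \<epsilon> x" 0 \<epsilon> "T - \<epsilon>" T]
        C1cI(2)[of "\<lambda>x. F x * cutoff T \<epsilon> x" "\<lambda>x. F x * cutoff' T \<epsilon> x + f x * cutoff T \<epsilon> x" 0 \<epsilon> "T - \<epsilon>" T])
qed

end

text \<open>
  The widths \<open>T/(4(k+1))\<close> satisfy the condition \<open>4\<epsilon> \<le> T\<close> and tend to zero.
\<close>

lemma eventually_cutoff_middle:
  assumes t: "0 < t" "t < T"
  shows "\<forall>\<^sub>F k in sequentially. cutoff T (T / (4 * real (Suc k))) t = 1 \<and> cutoff' T (T / (4 * real (Suc k))) t = 0"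
proof -
  have T: "T > 0" using t by simp
  have "(\<lambda>k. 2 * (T / (4 * real (Suc k)))) \<longlonglongrightarrow> 2 * 0"
    using LIMSEQ_Suc[OF lim_const_over_n[of "T/4"]]
    by (intro tendsto_mult_left) (simp add: field_simps)
  then have "\<forall>\<^sub>F k in sequentially. 2 * (T / (4 * real (Suc k))) < min t (T - t)"
    using t by (intro order_tendstoD) auto
  then show ?thesis
  proof eventually_elim
    case (elim k)
    then show ?case
      using T by (intro cutoff_middle) (simp_all only: min_less_iff_conj, simp_all add: field_simps)
  qed
qed

text \<open>
  The rescaled hat functions have integral one and shrink towards \<open>0\<close>: they form an
  approximation of the identity at the left end point.
\<close>

lemma ramp'_kernel_approximation:
  assumes C: "continuous_on {0..T} C" and T: "T > 0"
  shows "(\<lambda>k. LINT t:{0<..<T}|lborel. C t * (ramp' (t / (T / (4 * real (Suc k)))) / (T / (4 * real (Suc k)))))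
     \<longlonglongrightarrow> C 0"
proof (rule LIMSEQ_I)
  fix r :: real assume "r > 0"
  then obtain \<eta> where \<eta>: "0 < \<eta>" "\<eta> < r" using dense by blast
  obtain \<delta> where \<delta>: "\<delta> > 0" "\<And>t. t \<in> {0..T} \<Longrightarrow> \<bar>t\<bar> < \<delta> \<Longrightarrow> \<bar>C t - C 0\<bar> < \<eta>"
    using C T \<eta> unfolding continuous_on_iff dist_real_def
    by (metis atLeastAtMost_iff diff_zero order_less_imp_le order_refl)
  have "(\<lambda>k. 2 * (T / (4 * real (Suc k)))) \<longlonglongrightarrow> 2 * 0"
    using LIMSEQ_Suc[OF lim_const_over_n[of "T/4"]]
    by (intro tendsto_mult_left) (simp add: field_simps)
  then have "\<forall>\<^sub>F k in sequentially. 2 * (T / (4 * real (Suc k))) < \<delta>"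
    using \<delta> by (intro order_tendstoD) auto
  then obtain N where N: "\<And>k. k \<ge> N \<Longrightarrow> 2 * (T / (4 * real (Suc k))) < \<delta>"
    unfolding eventually_sequentially by blast
  have "norm ((LINT t:{0<..<T}|lborel. C t * (ramp' (t / (T / (4 * real (Suc k)))) / (T / (4 * real (Suc k))))) - C 0) < r"
    if "k \<ge> N" for k
  proof -
    define \<epsilon> where "\<epsilon> = T / (4 * real (Suc k))"
    have \<epsilon>: "0 < \<epsilon>" "4 * \<epsilon> \<le> T" "2 * \<epsilon> < \<delta>"
      using T N[OF that] by (auto simp: \<epsilon>_def field_simps)
    let ?K = "\<lambda>t. ramp' (t / \<epsilon>) / \<epsilon>"
    have cK: "continuous_on A ?K" for A
      using \<epsilon> by (intro continuous_intros continuous_on_compose2[OF ramp'_continuous[of UNIV]]) auto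
    have K1: "(LINT t:{0<..<T}|lborel. ?K t) = 1"
    proof -
      have "((\<lambda>t. ramp (t / \<epsilon>)) has_vector_derivative ?K t) (at t within {0..T})" for t
        using DERIV_chain2[OF ramp_deriv DERIV_cdivide[OF DERIV_ident], where s = "{0..T}"]
        by (simp add: has_real_derivative_iff_has_vector_derivative)
      then have "(LINT t:{0<..<T}|lborel. ?K t) = ramp (T / \<epsilon>) - ramp (0 / \<epsilon>)"
        using T cK by (intro set_integral_FTC) auto
      moreover have "2 \<le> T / \<epsilon>" using \<epsilon> by (simp add: field_simps)
      ultimately show ?thesis by (simp add: ramp_0 ramp_1)
    qed
    have int: "set_integrable lborel {0<..<T} (\<lambda>t. f t * ?K t)" if "continuous_on {0..T} f" for f
      by (intro L2_on_mult_integrable L2_on_ival that cK)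
    have intK: "set_integrable lborel {0<..<T} ?K" using int[of "\<lambda>_. 1"] by simp
    have "(LINT t:{0<..<T}|lborel. C t * ?K t) - C 0 = (LINT t:{0<..<T}|lborel. C t * ?K t) - (LINT t:{0<..<T}|lborel. C 0 * ?K t)"
      by (simp only: set_integral_mult_right K1 mult_1_right)
    also have "\<dots> = (LINT t:{0<..<T}|lborel. C t * ?K t - C 0 * ?K t)"
      by (rule set_integral_diff(2)[symmetric]) (rule int C continuous_on_const)+
    also have "\<bar>\<dots>\<bar> \<le> (LINT t:{0<..<T}|lborel. \<eta> * ?K t)"
      unfolding set_lebesgue_integral_def
    proof (rule integral_abs_bound_integral)
      show "integrable lborel (\<lambda>t. indicator {0<..<T} t *\<^sub>R (C t * ?K t - C 0 * ?K t))"
        using set_integral_diff(1)[OF int[OF C] int[of "\<lambda>_. C 0"]] by (simp add: set_integrable_def)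
      show "integrable lborel (\<lambda>t. indicator {0<..<T} t *\<^sub>R (\<eta> * ?K t))"
        using int[of "\<lambda>_. \<eta>"] by (simp add: set_integrable_def)
      show "\<bar>indicator {0<..<T} t *\<^sub>R (C t * ?K t - C 0 * ?K t)\<bar> \<le> indicator {0<..<T} t *\<^sub>R (\<eta> * ?K t)" for t
      proof (cases "t \<in> {0<..<T} \<and> t < 2 * \<epsilon>")
        case True
        then have "\<bar>C t - C 0\<bar> \<le> \<eta>" using \<delta>(2)[of t] \<epsilon> by auto
        then have "\<bar>C t - C 0\<bar> * ?K t \<le> \<eta> * ?K t"
          using ramp'_bounds[of "t / \<epsilon>"] \<epsilon> by (intro mult_right_mono) auto
        moreover have "\<bar>C t * ?K t - C 0 * ?K t\<bar> = \<bar>C t - C 0\<bar> * ?K t"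
          using ramp'_bounds[of "t / \<epsilon>"] \<epsilon>
          unfolding left_diff_distrib[symmetric] abs_mult by simp
        ultimately show ?thesis using True by (simp only: indicator_def) simp
      next
        case False
        then have "t \<notin> {0<..<T} \<or> ?K t = 0" using \<epsilon> by (auto intro!: ramp'_1 simp: field_simps)
        then show ?thesis by auto
      qed
    qed
    also have "\<dots> = \<eta>" using K1 by (simp only: set_integral_mult_right) 
    finally show ?thesis using \<eta> unfolding \<epsilon>_def by simp
  qed
  then show "\<exists>no. \<forall>k\<ge>no. norm ((LINT t:{0<..<T}|lborel. C t * (ramp' (t / (T / (4 * real (Suc k)))) / (T / (4 * real (Suc k))))) - C 0) < r"
    by blast
qed

lemma set_integral_reflect:
  fixes f :: "real \<Rightarrow> real"
  shows "(LINT t:{0<..<T}|lborel. f (T - t)) = (LINT t:{0<..<T}|lborel. f t)"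
proof -
  have "(LINT t|lborel. indicator {0<..<T} t *\<^sub>R f t)
      = (LINT t|lborel. indicator {0<..<T} (T - t) *\<^sub>R f (T - t))"
    using lborel_integral_real_affine[of "-1" "\<lambda>t. indicator {0<..<T} t *\<^sub>R f t" T] by simp
  moreover have "indicator {0<..<T} (T - t) = (indicator {0<..<T} t :: real)" for t
    by (auto simp: indicator_def)
  ultimately show ?thesis by (simp add: set_lebesgue_integral_def)
qed

text \<open>
  The derivatives of the cutoffs converge to the difference of the point masses at \<open>0\<close> and \<open>T\<close>.
  This recovers the boundary values of a continuous function from its pairing with test functions.
\<close>

lemma cutoff'_boundary_values:
  assumes C: "continuous_on {0..T} C" and T: "T > 0"
  shows "(\<lambda>k. L2_inner {0<..<T} C (cutoff' T (T / (4 * real (Suc k))))) \<longlonglongrightarrow> C 0 - C T"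
proof -
  let ?e = "\<lambda>k. T / (4 * real (Suc k))"
  let ?K = "\<lambda>k t. ramp' (t / ?e k) / ?e k"
  have cK: "continuous_on A (?K k)" "continuous_on A (\<lambda>t. ?K k (T - t))" for A k
    using T by (auto intro!: continuous_intros continuous_on_compose2[OF ramp'_continuous[of UNIV]])
  have C': "continuous_on {0..T} (\<lambda>t. C (T - t))"
    by (intro continuous_on_compose2[OF C] continuous_intros) auto
  have "L2_inner {0<..<T} C (cutoff' T (?e k))
      = (LINT t:{0<..<T}|lborel. C t * ?K k t) - (LINT t:{0<..<T}|lborel. C (T - t) * ?K k t)" for k
  proof -
    have "L2_inner {0<..<T} C (cutoff' T (?e k)) = (LINT t:{0<..<T}|lborel. C t * ?K k t - C t * ?K k (T - t))"
      unfolding L2_inner_def cutoff'_def by (simp add: right_diff_distrib)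
    also have "\<dots> = (LINT t:{0<..<T}|lborel. C t * ?K k t) - (LINT t:{0<..<T}|lborel. C t * ?K k (T - t))"
      by (intro set_integral_diff(2) L2_on_mult_integrable L2_on_ival C cK)
    finally show ?thesis
      unfolding set_integral_reflect[of T "\<lambda>t. C t * ?K k (T - t)", symmetric] diff_diff_eq2
      by simp
  qed
  then show ?thesis
    using tendsto_diff[OF ramp'_kernel_approximation[OF C T] ramp'_kernel_approximation[OF C' T]] by simp
qed

section \<open>The space H01 and the eigenfunctions\<close>

text \<open>
  Multiplication by the cutoffs approximates \<open>F\<close> in \<open>H\<^sup>1\<close>: the critical term \<open>F \<cdot> cutoff'\<close> stays bounded
  because \<open>F\<close> decays linearly at the boundary, and it tends to zero pointwise, so that bounded
  convergence applies.
\<close>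

lemma H01_boundary_decay:
  assumes F: "\<And>x. (F has_real_derivative f x) (at x)" and f: "continuous_on UNIV f"
    and M: "\<And>x. x \<in> unit_ival \<Longrightarrow> \<bar>F x\<bar> \<le> M * min x (1 - x)"
  shows "H01 F f"
proof -
  have cF: "continuous_on UNIV F" by (rule DERIV_continuous_on[OF F])
  have cont: "continuous_on A F" "continuous_on A f" for A
    using cF f continuous_on_subset by blast+
  have "has_weak_deriv 0 1 F f"
    using F by (intro has_weak_deriv_C1 cont)
      (auto simp: has_real_derivative_iff_has_vector_derivative[symmetric] intro: has_field_derivative_at_within)
  then have H1: "H1 F f" unfolding H1_def by (intro conjI L2_on_ival cont)
  define e where "e k = 1 / (4 * real (Suc k))" for k
  have e: "0 < e k" "4 * e k \<le> 1" for k by (auto simp: e_def field_simps)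
  define \<phi> where "\<phi> k = (\<lambda>x. F x * cutoff 1 (e k) x)" for k
  have C: "C1c 0 1 (\<phi> k)" for k
    unfolding \<phi>_def by (rule cutoff_mult_C1c(1)[OF e F f])
  have D: "deriv (\<phi> k) x - f x = F x * cutoff' 1 (e k) x + f x * (cutoff 1 (e k) x - 1)" for k x
    unfolding \<phi>_def cutoff_mult_C1c(2)[OF e F f] by (simp add: algebra_simps)
  have "compact (f ` {0..1})" using cont by (intro compact_continuous_image) auto
  then obtain B where B: "\<And>x. x \<in> {0..1} \<Longrightarrow> \<bar>f x\<bar> \<le> B"
    using compact_imp_bounded bounded_iff by (metis imageI real_norm_def)
  have "0 \<le> M" using M[of "1/2"] by auto
  have ev: "\<forall>\<^sub>F k in sequentially. cutoff 1 (e k) x = 1 \<and> cutoff' 1 (e k) x = 0" if "x \<in> unit_ival" for x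
    using eventually_cutoff_middle[of x 1] that unfolding e_def by auto
  have "(\<lambda>k. L2_norm unit_ival (\<lambda>x. \<phi> k x - F x)) \<longlonglongrightarrow> 0"
  proof (rule L2_norm_bounded_convergence[where B = M])
    show "L2_on unit_ival (\<lambda>x. \<phi> k x - F x)" for k
      by (intro L2_on_ival continuous_intros cont C1c_continuous[OF C])
    show "\<bar>\<phi> k x - F x\<bar> \<le> M" if x: "x \<in> unit_ival" for k x
    proof -
      have "\<bar>F x\<bar> * \<bar>cutoff 1 (e k) x - 1\<bar> \<le> (M * 1) * 1"
        using cutoff_bounds[OF e[of k], of x] x \<open>0 \<le> M\<close>
        by (intro mult_mono order_trans[OF M[OF x]] mult_left_mono) auto
      then show ?thesis by (simp add: \<phi>_def abs_mult[symmetric] algebra_simps)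
    qed
    show "AE x\<in>unit_ival in lborel. (\<lambda>k. \<phi> k x - F x) \<longlonglongrightarrow> 0"
    proof (intro AE_I2 impI)
      fix x :: real assume "x \<in> unit_ival"
      from ev[OF this] have "\<forall>\<^sub>F k in sequentially. \<phi> k x - F x = 0"
        by eventually_elim (simp add: \<phi>_def)
      then show "(\<lambda>k. \<phi> k x - F x) \<longlonglongrightarrow> 0" by (rule tendsto_eventually)
    qed
  qed auto
  moreover have "(\<lambda>k. L2_norm unit_ival (\<lambda>x. deriv (\<phi> k) x - f x)) \<longlonglongrightarrow> 0"
  proof (rule L2_norm_bounded_convergence[where B = "4 * M + B"])
    show "L2_on unit_ival (\<lambda>x. deriv (\<phi> k) x - f x)" for k
      by (intro L2_on_ival continuous_intros cont C1c_continuous_deriv[OF C])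
    show "\<bar>deriv (\<phi> k) x - f x\<bar> \<le> 4 * M + B" if x: "x \<in> unit_ival" for k x
    proof -
      have "\<bar>F x * cutoff' 1 (e k) x\<bar> \<le> M * min x (1 - x) * \<bar>cutoff' 1 (e k) x\<bar>"
        unfolding abs_mult by (intro mult_right_mono M x) auto
      also have "\<dots> \<le> M * 4"
        using mult_left_mono[of "\<bar>cutoff' 1 (e k) x\<bar> * min x (1 - x)" 4 M] cutoff'_bound[OF e[of k], of x] x \<open>0 \<le> M\<close>
        by (simp add: mult_ac)
      finally have 1: "\<bar>F x * cutoff' 1 (e k) x\<bar> \<le> 4 * M" by simp
      have "\<bar>f x\<bar> * \<bar>cutoff 1 (e k) x - 1\<bar> \<le> B * 1"
        using cutoff_bounds[OF e[of k], of x] x B[of x]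
        by (intro mult_mono) auto
      then show ?thesis
        unfolding D using 1 abs_triangle_ineq[of "F x * cutoff' 1 (e k) x" "f x * (cutoff 1 (e k) x - 1)"]
        by (simp add: abs_mult)
    qed
    show "AE x\<in>unit_ival in lborel. (\<lambda>k. deriv (\<phi> k) x - f x) \<longlonglongrightarrow> 0"
    proof (intro AE_I2 impI)
      fix x :: real assume "x \<in> unit_ival"
      from ev[OF this] have "\<forall>\<^sub>F k in sequentially. deriv (\<phi> k) x - f x = 0"
        by eventually_elim (simp add: D)
      then show "(\<lambda>k. deriv (\<phi> k) x - f x) \<longlonglongrightarrow> 0" by (rule tendsto_eventually)
    qed
  qed auto
  ultimately have "(\<lambda>k. H1_norm (\<lambda>x. \<phi> k x - F x) (\<lambda>x. deriv (\<phi> k) x - f x)) \<longlonglongrightarrow> sqrt (0\<^sup>2 + 0\<^sup>2)"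
    unfolding H1_norm_def by (intro tendsto_intros)
  then show ?thesis unfolding H01_def using H1 C by auto
qed

lemma H1_norm_ge:
  "L2_norm unit_ival v \<le> H1_norm v g" "L2_norm unit_ival g \<le> H1_norm v g"
  using L2_norm_nonneg[of unit_ival] by (auto simp: H1_norm_def intro!: real_le_rsqrt)

lemma H01_L2: assumes "H01 v g" shows "L2_on unit_ival v" "L2_on unit_ival g"
  using assms by (auto simp: H01_def H1_def)

lemma H01_approximation:
  assumes "H01 v g"
  obtains \<phi> where "\<And>k. C1c 0 1 (\<phi> k)"
    and "(\<lambda>k::nat. L2_norm unit_ival (\<lambda>x. \<phi> k x - v x)) \<longlonglongrightarrow> 0"
    and "(\<lambda>k. L2_norm unit_ival (\<lambda>x. deriv (\<phi> k) x - g x)) \<longlonglongrightarrow> 0"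
proof -
  obtain \<phi> where C: "\<And>k. C1c 0 1 (\<phi> k)"
    and lim: "(\<lambda>k::nat. H1_norm (\<lambda>x. \<phi> k x - v x) (\<lambda>x. deriv (\<phi> k) x - g x)) \<longlonglongrightarrow> 0"
    using assms by (auto simp: H01_def)
  show ?thesis
  proof (rule that[OF C])
    show "(\<lambda>k. L2_norm unit_ival (\<lambda>x. \<phi> k x - v x)) \<longlonglongrightarrow> 0"
      by (rule tendsto_sandwich[OF _ _ tendsto_const lim]) (auto simp: L2_norm_nonneg H1_norm_ge)
    show "(\<lambda>k. L2_norm unit_ival (\<lambda>x. deriv (\<phi> k) x - g x)) \<longlonglongrightarrow> 0"
      by (rule tendsto_sandwich[OF _ _ tendsto_const lim]) (auto simp: L2_norm_nonneg H1_norm_ge)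
  qed
qed

lemma tendsto_L2_inner:
  assumes f: "\<And>k. L2_on S (f k)" "L2_on S f'" "L2_on S g"
    and lim: "(\<lambda>k. L2_norm S (\<lambda>x. f k x - f' x)) \<longlonglongrightarrow> 0"
  shows "(\<lambda>k::nat. L2_inner S (f k) g) \<longlonglongrightarrow> L2_inner S f' g"
proof (rule LIM_zero_cancel, rule Lim_null_comparison)
  show "\<forall>\<^sub>F k in sequentially. norm (L2_inner S (f k) g - L2_inner S f' g)
      \<le> L2_norm S (\<lambda>x. f k x - f' x) * L2_norm S g"
    using L2_Cauchy_Schwarz[OF L2_on_diff[OF f(1,2)] f(3)] f
    by (simp add: L2_inner_diff_left)
  show "(\<lambda>k. L2_norm S (\<lambda>x. f k x - f' x) * L2_norm S g) \<longlonglongrightarrow> 0"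
    using tendsto_mult_right[OF lim] by simp
qed

text \<open>
  The boundary term vanishes for the approximating test functions, and both sides are continuous in
  the \<open>H\<^sup>1\<close> norm.
\<close>

lemma H01_by_parts:
  assumes v: "H01 v g"
    and F: "\<And>x. x \<in> {0..1} \<Longrightarrow> (F has_vector_derivative f x) (at x within {0..1})"
    and f: "continuous_on {0..1} f"
  shows "L2_inner unit_ival g F = - L2_inner unit_ival v f"
proof -
  obtain \<phi> where C: "\<And>k. C1c 0 1 (\<phi> k)"
    and lim: "(\<lambda>k::nat. L2_norm unit_ival (\<lambda>x. \<phi> k x - v x)) \<longlonglongrightarrow> 0"
      "(\<lambda>k. L2_norm unit_ival (\<lambda>x. deriv (\<phi> k) x - g x)) \<longlonglongrightarrow> 0"
    using H01_approximation[OF v] by blast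
  have cF: "continuous_on {0..1} F" using F by (rule continuous_on_vector_derivative)
  have L: "L2_on unit_ival F" "L2_on unit_ival f" "L2_on unit_ival (\<phi> k)" "L2_on unit_ival (deriv (\<phi> k))" for k
    by (intro L2_on_ival cF f C1c_continuous[OF C] C1c_continuous_deriv[OF C])+
  have "has_weak_deriv 0 1 F f" by (rule has_weak_deriv_C1[OF _ F f]) auto
  then have "L2_inner unit_ival (deriv (\<phi> k)) F = - L2_inner unit_ival (\<phi> k) f" for k
    using C unfolding has_weak_deriv_def by (metis L2_inner_commute)
  moreover have "(\<lambda>k. L2_inner unit_ival (deriv (\<phi> k)) F) \<longlonglongrightarrow> L2_inner unit_ival g F"
    by (rule tendsto_L2_inner[OF L(4) H01_L2(2)[OF v] L(1) lim(2)])
  moreover have "(\<lambda>k. - L2_inner unit_ival (\<phi> k) f) \<longlonglongrightarrow> - L2_inner unit_ival v f"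
    by (rule tendsto_minus[OF tendsto_L2_inner[OF L(3) H01_L2(1)[OF v] L(2) lim(1)]])
  ultimately show ?thesis using LIMSEQ_unique by auto
qed

definition eig' :: "nat \<Rightarrow> real \<Rightarrow> real" where
  "eig' n x = sqrt 2 * (real n * pi) * cos (real n * pi * x)"

lemma eig_deriv: "(eig n has_real_derivative eig' n x) (at x)"
  unfolding eig_def[abs_def] eig'_def by (auto intro!: derivative_eq_intros)

lemma eig'_deriv: "(eig' n has_real_derivative - lam n * eig n x) (at x)"
  unfolding eig_def eig'_def[abs_def] lam_def
  by (auto intro!: derivative_eq_intros simp: power2_eq_square)

lemma eig_continuous: "continuous_on A (eig n)" "continuous_on A (eig' n)"
  unfolding eig_def[abs_def] eig'_def[abs_def] by (intro continuous_intros)+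

lemma L2_on_eig: "L2_on unit_ival (eig n)" "L2_on unit_ival (eig' n)"
  by (intro L2_on_ival eig_continuous)+

lemma H01_eig: "H01 (eig n) (eig' n)"
proof (rule H01_boundary_decay[OF eig_deriv eig_continuous(2), where M = "sqrt 2 * (real n * pi)"])
  fix x :: real assume x: "x \<in> unit_ival"
  have s: "\<bar>sin (real n * pi * y)\<bar> \<le> real n * pi * y" if "y \<ge> 0" for y
    using abs_sin_x_le_abs_x[of "real n * pi * y"] that by simp
  have "sin (real n * pi * x) = - cos (real n * pi) * sin (real n * pi * (1 - x))"
    using sin_diff[of "real n * pi" "real n * pi * (1 - x)"] sin_npi[of n]
    by (simp add: algebra_simps)
  then have "\<bar>sin (real n * pi * x)\<bar> = \<bar>sin (real n * pi * (1 - x))\<bar>"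
    by (simp add: abs_mult)
  then have "\<bar>sin (real n * pi * x)\<bar> \<le> real n * pi * min x (1 - x)"
    using s[of x] s[of "1 - x"] x by (auto simp: min_def)
  then have "sqrt 2 * \<bar>sin (real n * pi * x)\<bar> \<le> sqrt 2 * (real n * pi * min x (1 - x))"
    by (intro mult_left_mono) auto
  then show "\<bar>eig n x\<bar> \<le> sqrt 2 * (real n * pi) * min x (1 - x)"
    by (simp add: eig_def abs_mult mult.assoc)
qed

text \<open>
  The weak form of \<open>-e\<^sub>n'' = \<lambda>\<^sub>n e\<^sub>n\<close>.
\<close>

lemma H01_inner_eig':
  assumes "H01 v g"
  shows "L2_inner unit_ival g (eig' n) = lam n * L2_inner unit_ival v (eig n)"
proof -
  have "L2_inner unit_ival g (eig' n) = - L2_inner unit_ival v (\<lambda>x. - lam n * eig n x)"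
    using eig'_deriv
    by (intro H01_by_parts[OF assms] continuous_intros eig_continuous)
       (auto simp: has_real_derivative_iff_has_vector_derivative[symmetric] intro: has_field_derivative_at_within)
  then show ?thesis
    using L2_inner_cmult_left[of unit_ival "- lam n" "eig n" v] by (simp add: L2_inner_commute[of _ v])
qed

lemma lam_pos: "n \<ge> 1 \<Longrightarrow> lam n > 0"
  by (simp add: lam_def)

text \<open>
  Orthogonality is the symmetry of the form \<open>\<langle>e\<^sub>n', e\<^sub>m'\<rangle>\<close>, which equals both \<open>\<lambda>\<^sub>m \<langle>e\<^sub>n, e\<^sub>m\<rangle>\<close> and
  \<open>\<lambda>\<^sub>n \<langle>e\<^sub>n, e\<^sub>m\<rangle>\<close>. The normalization comes from the same identity for \<open>n = m\<close> together with
  \<open>(e\<^sub>n')\<^sup>2 = \<lambda>\<^sub>n (2 - e\<^sub>n\<^sup>2)\<close>.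
\<close>

lemma eig_orthonormal:
  assumes "n \<ge> 1" "m \<ge> 1"
  shows "L2_inner unit_ival (eig n) (eig m) = (if n = m then 1 else 0)"
proof (cases "n = m")
  case False
  have "lam m * L2_inner unit_ival (eig n) (eig m) = L2_inner unit_ival (eig' n) (eig' m)"
    by (rule H01_inner_eig'[OF H01_eig, symmetric])
  also have "\<dots> = lam n * L2_inner unit_ival (eig n) (eig m)"
    using H01_inner_eig'[OF H01_eig, of m n] by (simp add: L2_inner_commute)
  finally have "(lam m - lam n) * L2_inner unit_ival (eig n) (eig m) = 0"
    by (simp add: algebra_simps)
  moreover have "lam m \<noteq> lam n"
    using False assms by (simp add: lam_def power2_eq_iff_nonneg)
  ultimately show ?thesis using False by simp
next
  case True
  have "(eig' n x) * (eig' n x) = lam n * (2 - eig n x * eig n x)" for x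
  proof -
    have "eig' n x * eig' n x = lam n * (2 * (cos (real n * pi * x))\<^sup>2)"
      by (simp add: eig'_def lam_def power2_eq_square algebra_simps)
    also have "\<dots> = lam n * (2 - eig n x * eig n x)"
      unfolding cos_squared_eq eig_def by (simp add: power2_eq_square algebra_simps)
    finally show ?thesis .
  qed
  then have "L2_inner unit_ival (eig' n) (eig' n)
      = lam n * (LINT x:unit_ival|lborel. 2 - eig n x * eig n x)"
    by (simp add: L2_inner_def)
  also have "(LINT x:unit_ival|lborel. 2 - eig n x * eig n x)
      = (LINT x:unit_ival|lborel. 2 :: real) - L2_inner unit_ival (eig n) (eig n)"
    unfolding L2_inner_def
    by (intro set_integral_diff(2) L2_on_mult_integrable L2_on_eig) (simp add: set_integrable_def)
  finally show ?thesis
    using H01_inner_eig'[OF H01_eig, of n n] lam_pos[OF assms(1)] True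
    by (simp add: set_lebesgue_integral_def)
qed

section \<open>The terminal state of a weak solution\<close>

lemma set_integral_cong_AE_measurable:
  fixes f g :: "'a \<Rightarrow> real"
  assumes f: "set_integrable M S f" and g: "set_borel_measurable M S g"
    and ae: "AE x\<in>S in M. f x = g x"
  shows "set_integrable M S g" "(LINT x:S|M. g x) = (LINT x:S|M. f x)"
proof -
  have ae': "AE x in M. indicator S x *\<^sub>R g x = indicator S x *\<^sub>R f x"
    using ae by eventually_elim (auto simp: indicator_def)
  have m: "(\<lambda>x. indicator S x *\<^sub>R g x) \<in> borel_measurable M" "(\<lambda>x. indicator S x *\<^sub>R f x) \<in> borel_measurable M"
    using f g unfolding set_integrable_def set_borel_measurable_def by auto
  show "set_integrable M S g"
    using f integrable_cong_AE[OF m ae'] by (simp add: set_integrable_def)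
  show "(LINT x:S|M. g x) = (LINT x:S|M. f x)"
    unfolding set_lebesgue_integral_def by (rule integral_cong_AE[OF m ae'])
qed

text \<open>
  Fubini's theorem for \<open>p(x,t) v(x) \<phi>(t)\<close>. It also supplies the measurability in time of the
  coefficients of \<open>p\<close>.
\<close>

lemma cyl_inner_tensor:
  assumes p: "L2_on (cyl T) p" and v: "L2_on unit_ival v" and \<phi>: "L2_on {0<..<T} \<phi>"
  shows "set_integrable lborel {0<..<T} (\<lambda>t. L2_inner unit_ival (\<lambda>x. p (x, t)) v * \<phi> t)"
    and "L2_inner {0<..<T} (\<lambda>t. L2_inner unit_ival (\<lambda>x. p (x, t)) v) \<phi> = L2_inner (cyl T) p (tensor v \<phi>)"
proof -
  have i: "set_integrable lborel (cyl T) (\<lambda>q. p q * (v (fst q) * \<phi> (snd q)))"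
    by (rule L2_on_mult_integrable[OF p L2_on_tensor[OF v \<phi>]])
  have e: "(LINT x:unit_ival|lborel. p (x, t) * (v (fst (x, t)) * \<phi> (snd (x, t))))
      = L2_inner unit_ival (\<lambda>x. p (x, t)) v * \<phi> t" for t
    by (simp add: L2_inner_def mult.assoc[symmetric])
  show "set_integrable lborel {0<..<T} (\<lambda>t. L2_inner unit_ival (\<lambda>x. p (x, t)) v * \<phi> t)"
    using cyl_Fubini(1)[OF i] unfolding e .
  show "L2_inner {0<..<T} (\<lambda>t. L2_inner unit_ival (\<lambda>x. p (x, t)) v) \<phi> = L2_inner (cyl T) p (tensor v \<phi>)"
    using cyl_Fubini(2)[OF i] unfolding e by (simp add: L2_inner_def)
qed

lemma cyl_slice_integrable:
  assumes p: "L2_on (cyl T) p" and v: "L2_on unit_ival v"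
  shows "AE t\<in>{0<..<T} in lborel. set_integrable lborel unit_ival (\<lambda>x. p (x, t) * v x)"
proof -
  have "L2_on (cyl T) (tensor v (\<lambda>_. 1))" by (intro L2_on_tensor v L2_on_ival continuous_intros)
  from cyl_Fubini(3)[OF L2_on_mult_integrable[OF p this]] show ?thesis by simp
qed

text \<open>
  The equation, satisfied at almost every time, determines the time derivative against test
  functions; integrability of \<open>w \<phi>\<close> is inherited from the other two terms.
\<close>

lemma inner_time_derivative:
  assumes u: "L2_on (cyl T) u" and g: "L2_on (cyl T) g"
    and v: "L2_on unit_ival v" "L2_on unit_ival v'"
    and w: "set_borel_measurable lborel {0<..<T} w"
    and eq: "AE t\<in>{0<..<T} in lborel.
       w t + L2_inner unit_ival (\<lambda>x. g (x, t)) v' = L2_inner unit_ival (\<lambda>x. u (x, t)) v"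
    and \<phi>: "continuous_on {0..T} \<phi>"
  shows "set_integrable lborel {0<..<T} (\<lambda>t. w t * \<phi> t)"
    and "L2_inner {0<..<T} w \<phi> = L2_inner (cyl T) u (tensor v \<phi>) - L2_inner (cyl T) g (tensor v' \<phi>)"
proof -
  have L: "L2_on {0<..<T} \<phi>" by (rule L2_on_ival[OF \<phi>])
  let ?f = "\<lambda>t. L2_inner unit_ival (\<lambda>x. u (x, t)) v * \<phi> t - L2_inner unit_ival (\<lambda>x. g (x, t)) v' * \<phi> t"
  note iu = cyl_inner_tensor[OF u v(1) L] and ig = cyl_inner_tensor[OF g v(2) L]
  have i: "set_integrable lborel {0<..<T} ?f" by (rule set_integral_diff(1)[OF iu(1) ig(1)])
  have "(\<lambda>t. indicator {0<..<T} t *\<^sub>R (w t * \<phi> t)) = (\<lambda>t. (indicator {0<..<T} t *\<^sub>R w t) * (indicator {0<..<T} t *\<^sub>R \<phi> t))"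
    by (auto simp: indicator_def)
  then have m: "set_borel_measurable lborel {0<..<T} (\<lambda>t. w t * \<phi> t)"
    using w L2_on_measurable[OF L] unfolding set_borel_measurable_def by simp
  have ae: "AE t\<in>{0<..<T} in lborel. ?f t = w t * \<phi> t"
    using eq by eventually_elim (metis add_diff_cancel_right' left_diff_distrib)
  show "set_integrable lborel {0<..<T} (\<lambda>t. w t * \<phi> t)"
    by (rule set_integral_cong_AE_measurable(1)[OF i m ae])
  show "L2_inner {0<..<T} w \<phi> = L2_inner (cyl T) u (tensor v \<phi>) - L2_inner (cyl T) g (tensor v' \<phi>)"
    using set_integral_cong_AE_measurable(2)[OF i m ae] set_integral_diff(2)[OF iu(1) ig(1)] iu(2) ig(2)
    by (simp add: L2_inner_def)
qed

lemma C_L2_coef_continuous: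
  assumes y: "C_L2 T y" and v: "L2_on unit_ival v"
  shows "continuous_on {0..T} (\<lambda>t. L2_inner unit_ival (\<lambda>x. y (x, t)) v)"
  unfolding continuous_on_def
proof
  fix t assume t: "t \<in> {0..T}"
  have lim: "((\<lambda>s. L2_norm unit_ival (\<lambda>x. y (x, s) - y (x, t))) \<longlongrightarrow> 0) (at t within {0..T})"
    and L: "\<And>s. s \<in> {0..T} \<Longrightarrow> L2_on unit_ival (\<lambda>x. y (x, s))"
    using y t by (auto simp: C_L2_def)
  show "((\<lambda>t. L2_inner unit_ival (\<lambda>x. y (x, t)) v) \<longlongrightarrow> L2_inner unit_ival (\<lambda>x. y (x, t)) v) (at t within {0..T})"
  proof (rule LIM_zero_cancel, rule Lim_null_comparison)
    show "\<forall>\<^sub>F s in at t within {0..T}. norm (L2_inner unit_ival (\<lambda>x. y (x, s)) v - L2_inner unit_ival (\<lambda>x. y (x, t)) v)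
        \<le> L2_norm unit_ival (\<lambda>x. y (x, s) - y (x, t)) * L2_norm unit_ival v"
      using L2_Cauchy_Schwarz[OF L2_on_diff[OF L L[OF t]] v]
      by (auto simp: eventually_at_filter L2_inner_diff_left L v t[simplified])
    show "((\<lambda>s. L2_norm unit_ival (\<lambda>x. y (x, s) - y (x, t)) * L2_norm unit_ival v) \<longlongrightarrow> 0) (at t within {0..T})"
      using tendsto_mult_right[OF lim, of "L2_norm unit_ival v"] by simp
  qed
qed

text \<open>
  The time factor of the solution \<open>e\<^sub>n(x) exp(-\<lambda>\<^sub>n(T - t))\<close> of the adjoint (backward) heat equation.
\<close>

definition adjoint_mode :: "real \<Rightarrow> nat \<Rightarrow> real \<Rightarrow> real" where
  "adjoint_mode T n t = exp (- lam n * (T - t))"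

lemma adjoint_mode_deriv: "(adjoint_mode T n has_real_derivative lam n * adjoint_mode T n t) (at t)"
  unfolding adjoint_mode_def[abs_def] by (auto intro!: derivative_eq_intros)

lemma adjoint_mode_continuous: "continuous_on A (adjoint_mode T n)"
  unfolding adjoint_mode_def[abs_def] by (intro continuous_intros)

lemma abs_eig_le: "\<bar>eig n x\<bar> \<le> sqrt 2"
  by (simp add: eig_def abs_mult mult_left_le)

lemma cyl_borel: "cyl T \<in> sets borel" and cyl_bounded: "bounded (cyl T)"
proof -
  have "open (cyl T)" unfolding cyl_def by (intro open_Times) auto
  then show "cyl T \<in> sets borel" by auto
  show "bounded (cyl T)" unfolding cyl_def by (intro bounded_Times bounded_Ioo)
qed

text \<open>
  Duhamel's formula for the \<open>n\<close>-th coefficient \<open>c\<close>, which satisfies \<open>c' + \<lambda>\<^sub>n c = u\<^sub>n\<close> weakly on \<open>(0,T)\<close>.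
  Test functions vanish near \<open>0\<close> and \<open>T\<close>, so the integrating factor is multiplied by the cutoffs; in the
  limit their derivatives produce the values of \<open>c\<close> at the two end points. In particular,
  every weak solution with the same data has the same terminal coefficients.
\<close>

theorem coef_terminal_state:
  assumes T: "T > 0" and u: "L2_on (cyl T) u" and y0: "L2_on unit_ival y0"
    and sol: "heat_weak_solution T y0 u y"
  shows "coef (\<lambda>x. y (x, T)) n = exp (- lam n * T) * coef y0 n + L2_inner (cyl T) u (tensor (eig n) (adjoint_mode T n))"
proof -
  from sol obtain g w where C: "C_L2 T y" and ini: "AE x\<in>unit_ival in lborel. y (x, 0) = y0 x"
    and g: "L2_H01 T y g" and w: "L2_Hm1 T w"
    and weak: "\<And>v v'. H01 v v' \<Longrightarrow> has_weak_deriv 0 T (\<lambda>t. L2_inner unit_ival (\<lambda>x. y (x, t)) v) (\<lambda>t. w t v)"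
    and eq: "\<And>v v'. H01 v v' \<Longrightarrow> AE t\<in>{0<..<T} in lborel.
             w t v + L2_inner unit_ival (\<lambda>x. g (x, t)) v' = L2_inner unit_ival (\<lambda>x. u (x, t)) v"
    unfolding heat_weak_solution_def by auto
  have Lg: "L2_on (cyl T) g" and Ly: "L2_on (cyl T) y"
    and H: "AE t\<in>{0<..<T} in lborel. H01 (\<lambda>x. y (x, t)) (\<lambda>x. g (x, t))"
    using g by (auto simp: L2_H01_def)
  define c where "c t = L2_inner unit_ival (\<lambda>x. y (x, t)) (eig n)" for t
  have c: "continuous_on {0..T} c" unfolding c_def by (rule C_L2_coef_continuous[OF C L2_on_eig(1)])
  have wm: "set_borel_measurable lborel {0<..<T} (\<lambda>t. w t (eig n))"
    using w H01_eig by (auto simp: L2_Hm1_def)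
  have ode: "L2_inner {0<..<T} c (deriv \<phi>) = - L2_inner (cyl T) u (tensor (eig n) \<phi>) + lam n * L2_inner {0<..<T} c \<phi>"
    if \<phi>: "C1c 0 T \<phi>" for \<phi>
  proof -
    have c\<phi>: "continuous_on {0..T} \<phi>" by (rule C1c_continuous[OF \<phi>])
    then have L\<phi>: "L2_on {0<..<T} \<phi>" by (rule L2_on_ival)
    have "L2_inner {0<..<T} c (deriv \<phi>) = - L2_inner {0<..<T} (\<lambda>t. w t (eig n)) \<phi>"
      using weak[OF H01_eig] \<phi> unfolding has_weak_deriv_def c_def by blast
    also have "L2_inner {0<..<T} (\<lambda>t. w t (eig n)) \<phi>
       = L2_inner (cyl T) u (tensor (eig n) \<phi>) - L2_inner (cyl T) g (tensor (eig' n) \<phi>)"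
      by (rule inner_time_derivative(2)[OF u Lg L2_on_eig wm eq[OF H01_eig] c\<phi>])
    also have "L2_inner (cyl T) g (tensor (eig' n) \<phi>) = L2_inner {0<..<T} (\<lambda>t. L2_inner unit_ival (\<lambda>x. g (x, t)) (eig' n)) \<phi>"
      by (rule cyl_inner_tensor(2)[OF Lg L2_on_eig(2) L\<phi>, symmetric])
    also have "\<dots> = lam n * L2_inner {0<..<T} c \<phi>"
    proof -
      have i: "set_integrable lborel {0<..<T} (\<lambda>t. lam n * (c t * \<phi> t))"
        by (intro set_integrable_mult_right L2_on_mult_integrable L2_on_ival c c\<phi>)
      have m: "set_borel_measurable lborel {0<..<T} (\<lambda>t. L2_inner unit_ival (\<lambda>x. g (x, t)) (eig' n) * \<phi> t)"
        using cyl_inner_tensor(1)[OF Lg L2_on_eig(2) L\<phi>]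
        unfolding set_integrable_def set_borel_measurable_def by auto
      have ae: "AE t\<in>{0<..<T} in lborel. lam n * (c t * \<phi> t) = L2_inner unit_ival (\<lambda>x. g (x, t)) (eig' n) * \<phi> t"
        using H by eventually_elim (auto simp: H01_inner_eig' c_def)
      show ?thesis
        using set_integral_cong_AE_measurable(2)[OF i m ae] by (simp add: L2_inner_def)
    qed
    finally show ?thesis by simp
  qed
  define e where "e k = T / (4 * real (Suc k))" for k
  have e: "0 < e k" "4 * e k \<le> T" for k using T by (auto simp: e_def field_simps)
  define \<phi> where "\<phi> k = (\<lambda>t. adjoint_mode T n t * cutoff T (e k) t)" for k
  have dk: "continuous_on UNIV (\<lambda>t. lam n * adjoint_mode T n t)" by (intro continuous_intros adjoint_mode_continuous)
  have \<phi>: "C1c 0 T (\<phi> k)" for k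
    unfolding \<phi>_def by (rule cutoff_mult_C1c(1)[OF e adjoint_mode_deriv dk])
  have d\<phi>: "deriv (\<phi> k) = (\<lambda>t. adjoint_mode T n t * cutoff' T (e k) t + lam n * \<phi> k t)" for k
    unfolding \<phi>_def cutoff_mult_C1c(2)[OF e adjoint_mode_deriv dk] by (auto simp: mult.assoc)
  \<comment> \<open>The term \<open>\<lambda>\<^sub>n \<phi>\<^sub>k\<close> of the derivative cancels the zeroth order term of the equation.\<close>
  have key: "L2_inner {0<..<T} (\<lambda>t. c t * adjoint_mode T n t) (cutoff' T (e k)) = - L2_inner (cyl T) u (tensor (eig n) (\<phi> k))" for k
  proof -
    have Lc: "L2_on {0<..<T} c" and L\<phi>: "L2_on {0<..<T} (\<phi> k)" 
      and Lk: "L2_on {0<..<T} (\<lambda>t. adjoint_mode T n t * cutoff' T (e k) t)"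
      by (intro L2_on_ival c C1c_continuous[OF \<phi>] continuous_intros adjoint_mode_continuous cutoff'_continuous e)+
    have "L2_inner {0<..<T} c (deriv (\<phi> k)) = L2_inner {0<..<T} (\<lambda>t. adjoint_mode T n t * cutoff' T (e k) t) c
        + lam n * L2_inner {0<..<T} (\<phi> k) c"
      unfolding d\<phi> L2_inner_commute[of _ c]
      by (simp add: L2_inner_add_left[OF Lk L2_on_cmult[OF L\<phi>] Lc] L2_inner_cmult_left)
    moreover have "L2_inner {0<..<T} (\<lambda>t. adjoint_mode T n t * cutoff' T (e k) t) c
       = L2_inner {0<..<T} (\<lambda>t. c t * adjoint_mode T n t) (cutoff' T (e k))"
      by (simp add: L2_inner_def mult_ac)
    ultimately show ?thesis using ode[OF \<phi>[of k]] by (simp add: L2_inner_commute[of _ c])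
  qed
  have "(\<lambda>k. L2_inner {0<..<T} (\<lambda>t. c t * adjoint_mode T n t) (cutoff' T (e k)))
     \<longlonglongrightarrow> c 0 * adjoint_mode T n 0 - c T * adjoint_mode T n T"
    unfolding e_def by (intro cutoff'_boundary_values T continuous_intros c adjoint_mode_continuous)
  moreover have "(\<lambda>k. L2_inner (cyl T) (tensor (eig n) (\<phi> k)) u) \<longlonglongrightarrow> L2_inner (cyl T) (tensor (eig n) (adjoint_mode T n)) u"
  proof (rule tendsto_L2_inner[OF _ _ u])
    show L1: "L2_on (cyl T) (tensor (eig n) (\<phi> k))" for k
      by (intro L2_on_tensor L2_on_eig L2_on_ival C1c_continuous[OF \<phi>])
    show L2: "L2_on (cyl T) (tensor (eig n) (adjoint_mode T n))"
      by (intro L2_on_tensor L2_on_eig L2_on_ival adjoint_mode_continuous)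
    show "(\<lambda>k. L2_norm (cyl T) (\<lambda>q. eig n (fst q) * \<phi> k (snd q) - eig n (fst q) * adjoint_mode T n (snd q))) \<longlonglongrightarrow> 0"
    proof (rule L2_norm_bounded_convergence[OF cyl_borel cyl_bounded L2_on_diff[OF L1 L2], where B = "sqrt 2"])
      fix k q assume q: "q \<in> cyl T"
      have "0 \<le> lam n" by (simp add: lam_def)
      then have "\<bar>adjoint_mode T n (snd q)\<bar> \<le> 1" using q by (auto simp: adjoint_mode_def cyl_def)
      moreover have "\<bar>cutoff T (e k) (snd q) - 1\<bar> \<le> 1" using cutoff_bounds[OF e[of k], of "snd q"] by auto
      ultimately have "\<bar>eig n (fst q)\<bar> * (\<bar>adjoint_mode T n (snd q)\<bar> * \<bar>cutoff T (e k) (snd q) - 1\<bar>) \<le> sqrt 2 * (1 * 1)"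
        by (intro mult_mono abs_eig_le) auto
      then show "\<bar>eig n (fst q) * \<phi> k (snd q) - eig n (fst q) * adjoint_mode T n (snd q)\<bar> \<le> sqrt 2"
        by (simp add: \<phi>_def abs_mult[symmetric] right_diff_distrib)
    next
      show "AE q\<in>cyl T in lborel. (\<lambda>k. eig n (fst q) * \<phi> k (snd q) - eig n (fst q) * adjoint_mode T n (snd q)) \<longlonglongrightarrow> 0"
      proof (intro AE_I2 impI)
        fix q assume "q \<in> cyl T"
        then have "\<forall>\<^sub>F k in sequentially. cutoff T (e k) (snd q) = 1 \<and> cutoff' T (e k) (snd q) = 0"
          unfolding e_def by (intro eventually_cutoff_middle) (auto simp: cyl_def)
        then have "\<forall>\<^sub>F k in sequentially. eig n (fst q) * \<phi> k (snd q) - eig n (fst q) * adjoint_mode T n (snd q) = 0"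
          by eventually_elim (simp add: \<phi>_def)
        then show "(\<lambda>k. eig n (fst q) * \<phi> k (snd q) - eig n (fst q) * adjoint_mode T n (snd q)) \<longlonglongrightarrow> 0"
          by (rule tendsto_eventually)
      qed
    qed
  qed
  then have "(\<lambda>k. - L2_inner (cyl T) u (tensor (eig n) (\<phi> k))) \<longlonglongrightarrow> - L2_inner (cyl T) u (tensor (eig n) (adjoint_mode T n))"
    unfolding L2_inner_commute[of _ _ u] by (rule tendsto_minus)
  ultimately have "c 0 * adjoint_mode T n 0 - c T * adjoint_mode T n T = - L2_inner (cyl T) u (tensor (eig n) (adjoint_mode T n))"
    unfolding key using LIMSEQ_unique by blast
  moreover have "c 0 = coef y0 n"
    unfolding c_def coef_def using C T by (intro L2_inner_cong_AE L2_on_eig y0 ini) (auto simp: C_L2_def)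
  ultimately show ?thesis by (simp add: coef_def c_def adjoint_mode_def mult.commute)
qed

section \<open>Adding one mode to the control\<close>

lemma H01_zero: "H01 (\<lambda>x. 0) (\<lambda>x. 0)"
  by (rule H01_boundary_decay[where M = 0]) (auto intro!: continuous_intros)

lemma C1c_linear:
  assumes "C1c a b \<phi>" "C1c a b \<psi>"
  shows "C1c a b (\<lambda>x. \<phi> x + c * \<psi> x)" and "deriv (\<lambda>x. \<phi> x + c * \<psi> x) = (\<lambda>x. deriv \<phi> x + c * deriv \<psi> x)"
proof -
  have d: "((\<lambda>x. \<phi> x + c * \<psi> x) has_real_derivative (deriv \<phi> x + c * deriv \<psi> x)) (at x)" for x
    by (intro DERIV_add DERIV_cmult C1c_has_deriv[OF assms(1)] C1c_has_deriv[OF assms(2)])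
  then show e: "deriv (\<lambda>x. \<phi> x + c * \<psi> x) = (\<lambda>x. deriv \<phi> x + c * deriv \<psi> x)"
    by (auto intro: DERIV_imp_deriv)
  have "continuous_on UNIV (\<lambda>x. deriv \<phi> x + c * deriv \<psi> x)"
    by (intro continuous_intros C1c_continuous_deriv[OF assms(1)] C1c_continuous_deriv[OF assms(2)])
  then have "(\<lambda>x. \<phi> x + c * \<psi> x) C1_differentiable_on UNIV"
    unfolding C1_differentiable_on_def has_real_derivative_iff_has_vector_derivative[symmetric]
    using d by (intro exI[of _ "\<lambda>x. deriv \<phi> x + c * deriv \<psi> x"]) blast
  moreover have "closure {x. \<phi> x + c * \<psi> x \<noteq> 0} \<subseteq> closure {x. \<phi> x \<noteq> 0} \<union> closure {x. \<psi> x \<noteq> 0}"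
    unfolding closure_Un[symmetric] by (rule closure_mono) auto
  ultimately show "C1c a b (\<lambda>x. \<phi> x + c * \<psi> x)"
    using assms unfolding C1c_def by blast
qed

lemma H01_linear:
  assumes v: "H01 v g" and w: "H01 w h"
  shows "H01 (\<lambda>x. v x + c * w x) (\<lambda>x. g x + c * h x)"
proof -
  note L = H01_L2[OF v] H01_L2[OF w]
  have W: "has_weak_deriv 0 1 v g" "has_weak_deriv 0 1 w h" using v w by (auto simp: H01_def H1_def)
  have "has_weak_deriv 0 1 (\<lambda>x. v x + c * w x) (\<lambda>x. g x + c * h x)"
    unfolding has_weak_deriv_def
  proof (intro allI impI)
    fix \<phi> assume \<phi>: "C1c 0 1 \<phi>"
    have L\<phi>: "L2_on unit_ival \<phi>" "L2_on unit_ival (deriv \<phi>)"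
      by (intro L2_on_ival C1c_continuous[OF \<phi>] C1c_continuous_deriv[OF \<phi>])+
    show "L2_inner unit_ival (\<lambda>x. v x + c * w x) (deriv \<phi>) = - L2_inner unit_ival (\<lambda>x. g x + c * h x) \<phi>"
      using W \<phi> unfolding has_weak_deriv_def
      by (simp add: L2_inner_add_left L2_inner_cmult_left L L\<phi> L2_on_cmult)
  qed
  then have H1: "H1 (\<lambda>x. v x + c * w x) (\<lambda>x. g x + c * h x)"
    by (auto simp: H1_def intro!: L2_on_add L2_on_cmult L)
  obtain \<phi> where \<phi>: "\<And>k. C1c 0 1 (\<phi> k)"
    "(\<lambda>k::nat. L2_norm unit_ival (\<lambda>x. \<phi> k x - v x)) \<longlonglongrightarrow> 0"
    "(\<lambda>k. L2_norm unit_ival (\<lambda>x. deriv (\<phi> k) x - g x)) \<longlonglongrightarrow> 0"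
    using H01_approximation[OF v] by blast
  obtain \<psi> where \<psi>: "\<And>k. C1c 0 1 (\<psi> k)"
    "(\<lambda>k::nat. L2_norm unit_ival (\<lambda>x. \<psi> k x - w x)) \<longlonglongrightarrow> 0"
    "(\<lambda>k. L2_norm unit_ival (\<lambda>x. deriv (\<psi> k) x - h x)) \<longlonglongrightarrow> 0"
    using H01_approximation[OF w] by blast
  have conv: "(\<lambda>k. L2_norm unit_ival (\<lambda>x. (f k x + c * f' k x) - (p x + c * p' x))) \<longlonglongrightarrow> 0"
    if "\<And>k::nat. L2_on unit_ival (f k)" "\<And>k. L2_on unit_ival (f' k)" "L2_on unit_ival p" "L2_on unit_ival p'"
      and lim: "(\<lambda>k. L2_norm unit_ival (\<lambda>x. f k x - p x)) \<longlonglongrightarrow> 0" "(\<lambda>k. L2_norm unit_ival (\<lambda>x. f' k x - p' x)) \<longlonglongrightarrow> 0"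
    for f f' p p'
  proof (rule tendsto_sandwich[OF _ _ tendsto_const])
    show "\<forall>\<^sub>F k in sequentially. L2_norm unit_ival (\<lambda>x. (f k x + c * f' k x) - (p x + c * p' x))
        \<le> L2_norm unit_ival (\<lambda>x. f k x - p x) + \<bar>c\<bar> * L2_norm unit_ival (\<lambda>x. f' k x - p' x)"
    proof (intro always_eventually allI)
      fix k
      show "L2_norm unit_ival (\<lambda>x. (f k x + c * f' k x) - (p x + c * p' x))
        \<le> L2_norm unit_ival (\<lambda>x. f k x - p x) + \<bar>c\<bar> * L2_norm unit_ival (\<lambda>x. f' k x - p' x)"
        using L2_norm_triangle[OF L2_on_diff[OF that(1,3)] L2_on_cmult[OF L2_on_diff[OF that(2,4)], of c], of k k]
        unfolding L2_norm_cmult by (simp add: algebra_simps)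
    qed
    show "(\<lambda>k. L2_norm unit_ival (\<lambda>x. f k x - p x) + \<bar>c\<bar> * L2_norm unit_ival (\<lambda>x. f' k x - p' x)) \<longlonglongrightarrow> 0"
      using tendsto_add[OF lim(1) tendsto_mult_left[OF lim(2), of "\<bar>c\<bar>"]] by simp
  qed (simp add: L2_norm_nonneg)
  have L': "L2_on unit_ival (\<phi> k)" "L2_on unit_ival (deriv (\<phi> k))" "L2_on unit_ival (\<psi> k)" "L2_on unit_ival (deriv (\<psi> k))" for k
    by (intro L2_on_ival C1c_continuous[OF \<phi>(1)] C1c_continuous_deriv[OF \<phi>(1)] C1c_continuous[OF \<psi>(1)] C1c_continuous_deriv[OF \<psi>(1)])+
  define \<rho> where "\<rho> k = (\<lambda>x. \<phi> k x + c * \<psi> k x)" for k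
  have d: "deriv (\<rho> k) = (\<lambda>x. deriv (\<phi> k) x + c * deriv (\<psi> k) x)" for k
    unfolding \<rho>_def by (rule C1c_linear(2)[OF \<phi>(1) \<psi>(1)])
  have "(\<lambda>k. L2_norm unit_ival (\<lambda>x. \<rho> k x - (v x + c * w x))) \<longlonglongrightarrow> 0"
    unfolding \<rho>_def by (rule conv[OF L'(1) L'(3) L(1) L(3) \<phi>(2) \<psi>(2)])
  moreover have "(\<lambda>k. L2_norm unit_ival (\<lambda>x. deriv (\<rho> k) x - (g x + c * h x))) \<longlonglongrightarrow> 0"
    unfolding d by (rule conv[OF L'(2) L'(4) L(2) L(4) \<phi>(3) \<psi>(3)])
  ultimately have "(\<lambda>k. H1_norm (\<lambda>x. \<rho> k x - (v x + c * w x)) (\<lambda>x. deriv (\<rho> k) x - (g x + c * h x))) \<longlonglongrightarrow> sqrt (0\<^sup>2 + 0\<^sup>2)"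
    unfolding H1_norm_def by (intro tendsto_intros)
  moreover have "C1c 0 1 (\<rho> k)" for k unfolding \<rho>_def by (rule C1c_linear(1)[OF \<phi>(1) \<psi>(1)])
  ultimately show ?thesis unfolding H01_def using H1 by auto
qed

lemma Hm1_bound:
  assumes l: "Hm1 l" and v: "H01 v g" "H1_norm v g \<le> 1"
  shows "\<bar>l v\<bar> \<le> Hm1_norm l"
proof -
  obtain c where c: "\<And>v g. H01 v g \<Longrightarrow> \<bar>l v\<bar> \<le> c * H1_norm v g" using l by (auto simp: Hm1_def)
  have nn: "0 \<le> H1_norm v g" for v g by (simp add: H1_norm_def)
  have "bdd_above {\<bar>l v\<bar> |v g. H01 v g \<and> H1_norm v g \<le> 1}"
  proof (rule bdd_aboveI[of _ "\<bar>c\<bar>"])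
    fix r assume "r \<in> {\<bar>l v\<bar> |v g. H01 v g \<and> H1_norm v g \<le> 1}"
    then obtain v g where r: "r = \<bar>l v\<bar>" "H01 v g" "H1_norm v g \<le> 1" by auto
    have "c * H1_norm v g \<le> \<bar>c\<bar> * 1" by (intro mult_mono r nn) auto
    then show "r \<le> \<bar>c\<bar>" using c[OF r(2)] r(1) by simp
  qed
  then show ?thesis unfolding Hm1_norm_def using v by (intro cSup_upper) auto
qed

text \<open>
  Pairing with an \<open>L\<^sup>2\<close> function is a bounded functional on \<open>H\<^sub>0\<^sup>1\<close> by the Cauchy-Schwarz inequality.
\<close>

lemma Hm1_add_L2:
  assumes l: "Hm1 l" and e: "L2_on unit_ival e"
  shows "Hm1 (\<lambda>v. l v + c * L2_inner unit_ival e v)"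
    and "Hm1_norm (\<lambda>v. l v + c * L2_inner unit_ival e v) \<le> Hm1_norm l + \<bar>c\<bar> * L2_norm unit_ival e"
proof -
  have b: "\<bar>c * L2_inner unit_ival e v\<bar> \<le> \<bar>c\<bar> * L2_norm unit_ival e * H1_norm v g" if "H01 v g" for v g
  proof -
    have "\<bar>L2_inner unit_ival e v\<bar> \<le> L2_norm unit_ival e * H1_norm v g"
      by (rule order_trans[OF L2_Cauchy_Schwarz[OF e H01_L2(1)[OF that]]])
         (intro mult_left_mono H1_norm_ge L2_norm_nonneg)
    then show ?thesis by (simp add: abs_mult mult.assoc mult_left_mono)
  qed
  obtain k where k: "\<And>v g. H01 v g \<Longrightarrow> \<bar>l v\<bar> \<le> k * H1_norm v g" using l by (auto simp: Hm1_def)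
  show "Hm1 (\<lambda>v. l v + c * L2_inner unit_ival e v)"
    unfolding Hm1_def
  proof (intro conjI allI impI exI)
    fix v g w h a b assume H: "H01 v g \<and> H01 w h"
    have "L2_inner unit_ival e (\<lambda>x. a * v x + b * w x) = a * L2_inner unit_ival e v + b * L2_inner unit_ival e w"
    proof -
      have L: "L2_on unit_ival v" "L2_on unit_ival w" using H H01_L2(1) by blast+
      show ?thesis
        unfolding L2_inner_commute[of _ e]
        by (simp add: L2_inner_add_left[OF L2_on_cmult[OF L(1)] L2_on_cmult[OF L(2)] e] L2_inner_cmult_left)
    qed
    moreover have "l (\<lambda>x. a * v x + b * w x) = a * l v + b * l w" using l H unfolding Hm1_def by blast
    ultimately show "l (\<lambda>x. a * v x + b * w x) + c * L2_inner unit_ival e (\<lambda>x. a * v x + b * w x)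
        = a * (l v + c * L2_inner unit_ival e v) + b * (l w + c * L2_inner unit_ival e w)"
      by (simp add: algebra_simps)
  next
    fix v g assume H: "H01 v g"
    show "\<bar>l v + c * L2_inner unit_ival e v\<bar> \<le> (k + \<bar>c\<bar> * L2_norm unit_ival e) * H1_norm v g"
      using k[OF H] b[OF H] by (simp add: algebra_simps)
  qed
  show "Hm1_norm (\<lambda>v. l v + c * L2_inner unit_ival e v) \<le> Hm1_norm l + \<bar>c\<bar> * L2_norm unit_ival e"
    unfolding Hm1_norm_def[of "\<lambda>v. l v + c * L2_inner unit_ival e v"]
  proof (rule cSup_least)
    have "H01 (\<lambda>x. 0) (\<lambda>x. 0) \<and> H1_norm (\<lambda>x. 0) (\<lambda>x. 0) \<le> 1"
      using H01_zero by (simp add: H1_norm_def L2_norm_def)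
    then show "{\<bar>l v + c * L2_inner unit_ival e v\<bar> |v g. H01 v g \<and> H1_norm v g \<le> 1} \<noteq> {}" by blast
    fix r assume "r \<in> {\<bar>l v + c * L2_inner unit_ival e v\<bar> |v g. H01 v g \<and> H1_norm v g \<le> 1}"
    then obtain v g where r: "r = \<bar>l v + c * L2_inner unit_ival e v\<bar>" "H01 v g" "H1_norm v g \<le> 1" by auto
    have "\<bar>c\<bar> * L2_norm unit_ival e * H1_norm v g \<le> \<bar>c\<bar> * L2_norm unit_ival e * 1"
      by (intro mult_left_mono r) (simp add: L2_norm_nonneg)
    then show "r \<le> Hm1_norm l + \<bar>c\<bar> * L2_norm unit_ival e"
      using Hm1_bound[OF l r(2,3)] b[OF r(2)] r(1) by simp
  qed
qed

text \<open>
  The function \<open>e\<^sub>n \<otimes> \<zeta>\<close> solves the heat equation with source \<open>e\<^sub>n \<otimes> (\<zeta>' + \<lambda>\<^sub>n \<zeta>)\<close>. Its gradient is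
  \<open>e\<^sub>n' \<otimes> \<zeta>\<close> and its time derivative is the functional \<open>v \<mapsto> \<zeta>' \<langle>e\<^sub>n, v\<rangle>\<close>; both are added to those of the
  given solution.
\<close>

theorem heat_weak_solution_add_mode:
  assumes T: "T > 0" and u: "L2_on (cyl T) u" and sol: "heat_weak_solution T y0 u y"
    and d\<zeta>: "\<And>t. t \<in> {0..T} \<Longrightarrow> (\<zeta> has_vector_derivative (\<psi> t - lam n * \<zeta> t)) (at t within {0..T})"
    and \<psi>: "continuous_on {0..T} \<psi>" and "\<zeta> 0 = 0"
  shows "heat_weak_solution T y0 (\<lambda>q. u q + eig n (fst q) * \<psi> (snd q)) (\<lambda>q. y q + eig n (fst q) * \<zeta> (snd q))"
proof -
  from sol obtain g w where C: "C_L2 T y" and ini: "AE x\<in>unit_ival in lborel. y (x, 0) = y0 x"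
    and g: "L2_H01 T y g" and w: "L2_Hm1 T w"
    and weak: "\<And>v v'. H01 v v' \<Longrightarrow> has_weak_deriv 0 T (\<lambda>t. L2_inner unit_ival (\<lambda>x. y (x, t)) v) (\<lambda>t. w t v)"
    and eq: "\<And>v v'. H01 v v' \<Longrightarrow> AE t\<in>{0<..<T} in lborel.
             w t v + L2_inner unit_ival (\<lambda>x. g (x, t)) v' = L2_inner unit_ival (\<lambda>x. u (x, t)) v"
    unfolding heat_weak_solution_def by auto
  have Lg: "L2_on (cyl T) g" and Ly: "L2_on (cyl T) y"
    and H: "AE t\<in>{0<..<T} in lborel. H01 (\<lambda>x. y (x, t)) (\<lambda>x. g (x, t))"
    using g by (auto simp: L2_H01_def)
  have Lyt: "L2_on unit_ival (\<lambda>x. y (x, t))" if "t \<in> {0..T}" for t using C that by (auto simp: C_L2_def)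
  have c\<zeta>: "continuous_on {0..T} \<zeta>" using d\<zeta> by (rule continuous_on_vector_derivative)
  define \<zeta>' where "\<zeta>' t = \<psi> t - lam n * \<zeta> t" for t
  have c\<zeta>': "continuous_on {0..T} \<zeta>'" unfolding \<zeta>'_def by (intro continuous_intros \<psi> c\<zeta>)
  have scale: "(\<lambda>x. eig n x * c) = (\<lambda>x. c * eig n x)" "(\<lambda>x. eig' n x * c) = (\<lambda>x. c * eig' n x)" for c
    by auto
  let ?y = "\<lambda>q. y q + eig n (fst q) * \<zeta> (snd q)"
  let ?u = "\<lambda>q. u q + eig n (fst q) * \<psi> (snd q)"
  let ?g = "\<lambda>q. g q + eig' n (fst q) * \<zeta> (snd q)"
  let ?w = "\<lambda>t v. w t v + \<zeta>' t * L2_inner unit_ival (eig n) v"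
  have Lez: "L2_on unit_ival (\<lambda>x. eig n x * c)" for c unfolding scale by (intro L2_on_cmult L2_on_eig)
  have "C_L2 T ?y"
    unfolding C_L2_def fst_conv snd_conv
  proof (intro conjI ballI)
    fix t assume t: "t \<in> {0..T}"
    show "L2_on unit_ival (\<lambda>x. y (x, t) + eig n x * \<zeta> t)" by (intro L2_on_add Lyt t Lez)
    show "((\<lambda>s. L2_norm unit_ival (\<lambda>x. y (x, s) + eig n x * \<zeta> s - (y (x, t) + eig n x * \<zeta> t))) \<longlongrightarrow> 0) (at t within {0..T})"
    proof (rule tendsto_sandwich[OF _ _ tendsto_const])
      show "\<forall>\<^sub>F s in at t within {0..T}. L2_norm unit_ival (\<lambda>x. y (x, s) + eig n x * \<zeta> s - (y (x, t) + eig n x * \<zeta> t))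
         \<le> L2_norm unit_ival (\<lambda>x. y (x, s) - y (x, t)) + \<bar>\<zeta> s - \<zeta> t\<bar> * L2_norm unit_ival (eig n)"
        unfolding eventually_at_filter
      proof (intro always_eventually allI impI)
        fix s assume "s \<noteq> t" "s \<in> {0..T}"
        have "L2_norm unit_ival (\<lambda>x. y (x, s) + eig n x * \<zeta> s - (y (x, t) + eig n x * \<zeta> t))
          = L2_norm unit_ival (\<lambda>x. (y (x, s) - y (x, t)) + (\<zeta> s - \<zeta> t) * eig n x)"
          by (simp add: algebra_simps)
        also have "\<dots> \<le> L2_norm unit_ival (\<lambda>x. y (x, s) - y (x, t)) + L2_norm unit_ival (\<lambda>x. (\<zeta> s - \<zeta> t) * eig n x)"
          by (intro L2_norm_triangle L2_on_diff L2_on_cmult L2_on_eig Lyt t \<open>s \<in> {0..T}\<close>)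
        finally show "L2_norm unit_ival (\<lambda>x. y (x, s) + eig n x * \<zeta> s - (y (x, t) + eig n x * \<zeta> t))
         \<le> L2_norm unit_ival (\<lambda>x. y (x, s) - y (x, t)) + \<bar>\<zeta> s - \<zeta> t\<bar> * L2_norm unit_ival (eig n)"
          unfolding L2_norm_cmult .
      qed
      have "(\<zeta> \<longlongrightarrow> \<zeta> t) (at t within {0..T})" using c\<zeta> t by (auto simp: continuous_on_def)
      then have "((\<lambda>s. \<bar>\<zeta> s - \<zeta> t\<bar> * L2_norm unit_ival (eig n)) \<longlongrightarrow> \<bar>\<zeta> t - \<zeta> t\<bar> * L2_norm unit_ival (eig n)) (at t within {0..T})"
        by (intro tendsto_intros)
      moreover have "((\<lambda>s. L2_norm unit_ival (\<lambda>x. y (x, s) - y (x, t))) \<longlongrightarrow> 0) (at t within {0..T})"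
        using C t by (auto simp: C_L2_def)
      ultimately show "((\<lambda>s. L2_norm unit_ival (\<lambda>x. y (x, s) - y (x, t)) + \<bar>\<zeta> s - \<zeta> t\<bar> * L2_norm unit_ival (eig n)) \<longlongrightarrow> 0) (at t within {0..T})"
        using tendsto_add by fastforce
    qed (simp add: L2_norm_nonneg)
  qed
  moreover have "AE x\<in>unit_ival in lborel. ?y (x, 0) = y0 x" using ini \<open>\<zeta> 0 = 0\<close> by simp
  moreover have "L2_H01 T ?y ?g"
    unfolding L2_H01_def
  proof (intro conjI)
    show "L2_on (cyl T) ?y" by (intro L2_on_add L2_on_tensor Ly L2_on_eig L2_on_ival c\<zeta>)
    show "L2_on (cyl T) ?g" by (intro L2_on_add L2_on_tensor Lg L2_on_eig L2_on_ival c\<zeta>)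
    show "AE t\<in>{0<..<T} in lborel. H01 (\<lambda>x. ?y (x, t)) (\<lambda>x. ?g (x, t))"
      using H
    proof eventually_elim
      case (elim t)
      then show ?case using H01_linear[OF _ H01_eig[of n], of _ _ "\<zeta> t"] by (auto simp: scale mult.commute)
    qed
  qed
  moreover have "L2_Hm1 T ?w"
    unfolding L2_Hm1_def
  proof (intro conjI allI impI)
    fix v g' assume "H01 v g'"
    then have "set_borel_measurable lborel {0<..<T} (\<lambda>t. w t v)" using w by (auto simp: L2_Hm1_def)
    moreover have "(\<lambda>t. indicator {0<..<T} t *\<^sub>R \<zeta>' t) \<in> borel_measurable lborel"
      by (intro L2_on_measurable L2_on_ival c\<zeta>')
    moreover have "(\<lambda>t. indicator {0<..<T} t *\<^sub>R ?w t v)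
      = (\<lambda>t. indicator {0<..<T} t *\<^sub>R w t v + (indicator {0<..<T} t *\<^sub>R \<zeta>' t) * L2_inner unit_ival (eig n) v)"
      by (auto simp: algebra_simps)
    ultimately show "set_borel_measurable lborel {0<..<T} (\<lambda>t. ?w t v)"
      unfolding set_borel_measurable_def by simp
  next
    obtain h where h: "L2_on {0<..<T} h" "AE t\<in>{0<..<T} in lborel. Hm1 (w t) \<and> Hm1_norm (w t) \<le> h t"
      using w by (auto simp: L2_Hm1_def)
    show "\<exists>h. L2_on {0<..<T} h \<and> (AE t\<in>{0<..<T} in lborel. Hm1 (?w t) \<and> Hm1_norm (?w t) \<le> h t)"
    proof (intro exI conjI)
      show "L2_on {0<..<T} (\<lambda>t. h t + \<bar>\<zeta>' t\<bar> * L2_norm unit_ival (eig n))"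
        by (intro L2_on_add h(1) L2_on_ival continuous_intros c\<zeta>')
      show "AE t\<in>{0<..<T} in lborel. Hm1 (?w t) \<and> Hm1_norm (?w t) \<le> h t + \<bar>\<zeta>' t\<bar> * L2_norm unit_ival (eig n)"
        using h(2)
      proof eventually_elim
        case (elim t)
        then show ?case
          using Hm1_add_L2(1)[OF _ L2_on_eig(1), of "w t" "\<zeta>' t" n] Hm1_add_L2(2)[OF _ L2_on_eig(1), of "w t" "\<zeta>' t" n]
          by force
      qed
    qed
  qed
  moreover have "has_weak_deriv 0 T (\<lambda>t. L2_inner unit_ival (\<lambda>x. ?y (x, t)) v) (\<lambda>t. ?w t v)
      \<and> (AE t\<in>{0<..<T} in lborel.
             ?w t v + L2_inner unit_ival (\<lambda>x. ?g (x, t)) v' = L2_inner unit_ival (\<lambda>x. ?u (x, t)) v)"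
    if v: "H01 v v'" for v v'
  proof
    note Lv = H01_L2[OF v]
    let ?k = "L2_inner unit_ival (eig n) v"
    define c where "c t = L2_inner unit_ival (\<lambda>x. y (x, t)) v" for t
    have cc: "continuous_on {0..T} c" unfolding c_def by (rule C_L2_coef_continuous[OF C Lv(1)])
    have yv: "L2_inner unit_ival (\<lambda>x. ?y (x, t)) v = c t + ?k * \<zeta> t" if "t \<in> {0..T}" for t
      using L2_inner_add_left[OF Lyt[OF that] Lez Lv(1)]
      by (simp add: scale L2_inner_cmult_left c_def)
    have wm: "set_borel_measurable lborel {0<..<T} (\<lambda>t. w t v)" using w v by (auto simp: L2_Hm1_def)
    show "has_weak_deriv 0 T (\<lambda>t. L2_inner unit_ival (\<lambda>x. ?y (x, t)) v) (\<lambda>t. ?w t v)"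
      unfolding has_weak_deriv_def
    proof (intro allI impI)
      fix \<phi> assume \<phi>: "C1c 0 T \<phi>"
      have c\<phi>: "continuous_on {0..T} \<phi>" "continuous_on {0..T} (deriv \<phi>)"
        by (rule C1c_continuous[OF \<phi>] C1c_continuous_deriv[OF \<phi>])+
      have "L2_inner {0<..<T} (\<lambda>t. L2_inner unit_ival (\<lambda>x. ?y (x, t)) v) (deriv \<phi>)
          = L2_inner {0<..<T} (\<lambda>t. c t + ?k * \<zeta> t) (deriv \<phi>)"
        unfolding L2_inner_def[of "{0<..<T}"]
        by (rule set_lebesgue_integral_cong) (auto simp del: fst_conv snd_conv simp: yv)
      also have "\<dots> = L2_inner {0<..<T} c (deriv \<phi>) + ?k * L2_inner {0<..<T} \<zeta> (deriv \<phi>)"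
        by (simp add: L2_inner_add_left L2_inner_cmult_left L2_on_ival cc c\<zeta> c\<phi> L2_on_cmult)
      also have "L2_inner {0<..<T} c (deriv \<phi>) = - L2_inner {0<..<T} (\<lambda>t. w t v) \<phi>"
        using weak[OF v] \<phi> unfolding has_weak_deriv_def c_def by blast
      also have "L2_inner {0<..<T} \<zeta> (deriv \<phi>) = - L2_inner {0<..<T} \<zeta>' \<phi>"
        using has_weak_deriv_C1[of 0 T \<zeta> \<zeta>'] d\<zeta> c\<zeta>' T \<phi> unfolding has_weak_deriv_def \<zeta>'_def by auto
      also have "- L2_inner {0<..<T} (\<lambda>t. w t v) \<phi> + ?k * - L2_inner {0<..<T} \<zeta>' \<phi>
         = - L2_inner {0<..<T} (\<lambda>t. ?w t v) \<phi>"
      proof -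
        have "set_integrable lborel {0<..<T} (\<lambda>t. w t v * \<phi> t)"
          by (rule inner_time_derivative(1)[OF u Lg Lv wm eq[OF v] c\<phi>(1)])
        moreover have "set_integrable lborel {0<..<T} (\<lambda>t. ?k * (\<zeta>' t * \<phi> t))"
          by (intro set_integrable_mult_right L2_on_mult_integrable L2_on_ival c\<zeta>' c\<phi>)
        ultimately have "(LINT t:{0<..<T}|lborel. w t v * \<phi> t + ?k * (\<zeta>' t * \<phi> t))
           = (LINT t:{0<..<T}|lborel. w t v * \<phi> t) + (LINT t:{0<..<T}|lborel. ?k * (\<zeta>' t * \<phi> t))"
          by (rule set_integral_add(2))
        then show ?thesis
          unfolding set_integral_mult_right L2_inner_def[of "{0<..<T}"] by (simp add: algebra_simps)
      qed
      finally show "L2_inner {0<..<T} (\<lambda>t. L2_inner unit_ival (\<lambda>x. ?y (x, t)) v) (deriv \<phi>) = - L2_inner {0<..<T} (\<lambda>t. ?w t v) \<phi>" .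
    qed
    \<comment> \<open>The weak eigenvalue equation turns the gradient of the added mode into \<open>\<lambda>\<^sub>n \<zeta>\<close>.\<close>
    have ev: "L2_inner unit_ival (eig' n) v' = lam n * ?k"
      using H01_inner_eig'[OF v] by (simp add: L2_inner_commute)
    show "AE t\<in>{0<..<T} in lborel.
             ?w t v + L2_inner unit_ival (\<lambda>x. ?g (x, t)) v' = L2_inner unit_ival (\<lambda>x. ?u (x, t)) v"
      using eq[OF v] cyl_slice_integrable[OF Lg Lv(2)] cyl_slice_integrable[OF u Lv(1)]
    proof eventually_elim
      case (elim t)
      show ?case
      proof
        assume t: "t \<in> {0<..<T}"
        have "L2_inner unit_ival (\<lambda>x. ?g (x, t)) v' = L2_inner unit_ival (\<lambda>x. g (x, t)) v' + \<zeta> t * L2_inner unit_ival (eig' n) v'"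
          using set_integral_add(2)[OF elim(2)[rule_format, OF t] set_integrable_mult_right[OF L2_on_mult_integrable[OF L2_on_eig(2)[of n] Lv(2)], of "\<zeta> t"]]
          unfolding set_integral_mult_right by (simp add: L2_inner_def algebra_simps)
        moreover have "L2_inner unit_ival (\<lambda>x. ?u (x, t)) v = L2_inner unit_ival (\<lambda>x. u (x, t)) v + \<psi> t * ?k"
          using set_integral_add(2)[OF elim(3)[rule_format, OF t] set_integrable_mult_right[OF L2_on_mult_integrable[OF L2_on_eig(1)[of n] Lv(1)], of "\<psi> t"]]
          unfolding set_integral_mult_right by (simp add: L2_inner_def algebra_simps)
        ultimately show "?w t v + L2_inner unit_ival (\<lambda>x. ?g (x, t)) v' = L2_inner unit_ival (\<lambda>x. ?u (x, t)) v"
          using elim(1) t ev by (simp add: \<zeta>'_def algebra_simps)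
      qed
    qed
  qed
  ultimately show ?thesis unfolding heat_weak_solution_def by blast
qed

text \<open>
  The solution of \<open>\<zeta>' + \<lambda>\<^sub>n \<zeta> = \<psi>\<close> with \<open>\<zeta>(0) = 0\<close>.
\<close>

definition response :: "nat \<Rightarrow> (real \<Rightarrow> real) \<Rightarrow> real \<Rightarrow> real" where
  "response n \<psi> t = exp (- lam n * t) * integral {0..t} (\<lambda>s. exp (lam n * s) * \<psi> s)"

lemma response_deriv:
  assumes \<psi>: "continuous_on {0..T} \<psi>" and t: "t \<in> {0..T}"
  shows "(response n \<psi> has_vector_derivative (\<psi> t - lam n * response n \<psi> t)) (at t within {0..T})"
proof -
  have "((\<lambda>t. integral {0..t} (\<lambda>s. exp (lam n * s) * \<psi> s)) has_vector_derivative exp (lam n * t) * \<psi> t) (at t within {0..T})"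
    using t by (intro integral_has_vector_derivative continuous_intros \<psi>)
  then have i: "((\<lambda>t. integral {0..t} (\<lambda>s. exp (lam n * s) * \<psi> s)) has_real_derivative exp (lam n * t) * \<psi> t) (at t within {0..T})"
    by (simp add: has_real_derivative_iff_has_vector_derivative)
  have e: "((\<lambda>t. exp (- lam n * t)) has_real_derivative - lam n * exp (- lam n * t)) (at t within {0..T})"
    by (auto intro!: derivative_eq_intros)
  have "exp (- lam n * t) * (exp (lam n * t) * \<psi> t) = \<psi> t"
    by (simp add: mult.assoc[symmetric] exp_add[symmetric])
  then have eq: "- lam n * exp (- lam n * t) * integral {0..t} (\<lambda>s. exp (lam n * s) * \<psi> s)
      + exp (lam n * t) * \<psi> t * exp (- lam n * t) = \<psi> t - lam n * response n \<psi> t"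
    by (simp add: response_def mult_ac)
  have R: "response n \<psi> = (\<lambda>t. exp (- lam n * t) * integral {0..t} (\<lambda>s. exp (lam n * s) * \<psi> s))"
    by (rule ext) (rule response_def)
  show ?thesis
    using DERIV_mult[OF e i]
    unfolding eq R[symmetric] has_real_derivative_iff_has_vector_derivative .
qed

lemma response_terminal:
  assumes \<psi>: "continuous_on {0..T} \<psi>"  and T: "T > 0"
  shows "response n \<psi> T = L2_inner {0<..<T} \<psi> (adjoint_mode T n)"
proof -
  have "((\<lambda>t. response n \<psi> t * adjoint_mode T n t) has_vector_derivative \<psi> t * adjoint_mode T n t) (at t within {0..T})"
    if "t \<in> {0..T}" for t
  proof -
    have 1: "(response n \<psi> has_real_derivative (\<psi> t - lam n * response n \<psi> t)) (at t within {0..T})"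
      using response_deriv[OF \<psi> that] by (simp add: has_real_derivative_iff_has_vector_derivative)
    show ?thesis
      using DERIV_mult[OF 1 has_field_derivative_at_within[OF adjoint_mode_deriv[of T n t]]]
      unfolding has_real_derivative_iff_has_vector_derivative by (simp add: algebra_simps)
  qed
  then have "(LINT t:{0<..<T}|lborel. \<psi> t * adjoint_mode T n t) = response n \<psi> T * adjoint_mode T n T - response n \<psi> 0 * adjoint_mode T n 0"
    using T by (intro set_integral_FTC continuous_intros \<psi> adjoint_mode_continuous) auto
  then show ?thesis by (simp add: L2_inner_def adjoint_mode_def response_def)
qed

lemma response_cmult: "response n (\<lambda>t. c * \<psi> t) t = c * response n \<psi> t"
  by (simp add: response_def mult.left_commute)

lemma add_mode_control:
  assumes T: "T > 0" and u: "L2_on (cyl T) u" and sol: "heat_weak_solution T y0 u y"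
    and \<psi>: "continuous_on {0..T} \<psi>"
  shows "heat_weak_solution T y0 (\<lambda>q. u q + eig n (fst q) * \<psi> (snd q)) (\<lambda>q. y q + eig n (fst q) * response n \<psi> (snd q))"
  by (rule heat_weak_solution_add_mode[OF T u sol response_deriv[OF \<psi>] \<psi>]) (auto simp: response_def)

lemma adjoint_mode_norm:
  assumes "T > 0" "n \<ge> 1" shows "L2_inner {0<..<T} (adjoint_mode T n) (adjoint_mode T n) = acoef T n"
proof -
  have l: "lam n > 0" using lam_pos[OF assms(2)] .
  have "((\<lambda>t. adjoint_mode T n t * adjoint_mode T n t / (2 * lam n)) has_vector_derivative adjoint_mode T n t * adjoint_mode T n t) (at t within {0..T})" for t
    using l DERIV_cdivide[OF DERIV_mult[OF has_field_derivative_at_within[OF adjoint_mode_deriv[of T n t]] has_field_derivative_at_within[OF adjoint_mode_deriv[of T n t]]], where c = "2 * lam n"]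
    unfolding has_real_derivative_iff_has_vector_derivative by (simp add: mult_ac)
  then have "L2_inner {0<..<T} (adjoint_mode T n) (adjoint_mode T n) = adjoint_mode T n T * adjoint_mode T n T / (2 * lam n) - adjoint_mode T n 0 * adjoint_mode T n 0 / (2 * lam n)"
    unfolding L2_inner_def using assms by (intro set_integral_FTC continuous_intros adjoint_mode_continuous) auto
  then show ?thesis
    by (simp add: adjoint_mode_def acoef_def exp_add[symmetric] diff_divide_distrib mult.commute)
qed

lemma acoef_pos: assumes "T > 0" "n \<ge> 1" shows "acoef T n > 0"
  using lam_pos[OF assms(2)] assms(1) by (simp add: acoef_def)

section \<open>Completeness of the sine modes\<close>

lemma L2_inner_tensor:
  assumes a: "L2_on unit_ival a" and b: "L2_on {0<..<T} b" and c: "L2_on unit_ival c" and d: "L2_on {0<..<T} d"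
  shows "L2_inner (cyl T) (tensor a b) (tensor c d) = L2_inner unit_ival a c * L2_inner {0<..<T} b d"
proof -
  have "L2_inner unit_ival (\<lambda>x. a x * b t) c = L2_inner unit_ival a c * b t" for t
    using L2_inner_cmult_left[of unit_ival "b t" a c] by (simp add: mult.commute)
  then show ?thesis
    using cyl_inner_tensor(2)[OF L2_on_tensor[OF a b] c d] L2_inner_cmult_left[of "{0<..<T}" _ b d]
    by simp
qed

text \<open>
  The linear span of the products \<open>e\<^sub>n(x) \<psi>(t)\<close>. The mode \<open>e\<^sub>0 = 0\<close> is included because it
  appears in \<open>2 e\<^sub>1(x) cos(\<pi>x) = e\<^sub>2(x) + e\<^sub>0(x)\<close>.
\<close>

inductive sine_span :: "(real \<times> real \<Rightarrow> real) \<Rightarrow> bool" where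
  mode: "continuous_on UNIV \<psi> \<Longrightarrow> sine_span (tensor (eig n) \<psi>)"
| add: "sine_span f \<Longrightarrow> sine_span g \<Longrightarrow> sine_span (\<lambda>q. f q + g q)"

lemma sine_span_mult_cos: "sine_span f \<Longrightarrow> sine_span (\<lambda>q. f q * cos (pi * fst q))"
proof (induction rule: sine_span.induct)
  case (mode \<psi> n)
  show ?case
  proof (cases n)
    case 0
    then show ?thesis using sine_span.mode[OF mode, of 0] by (simp add: eig_def)
  next
    case (Suc m)
    have "eig n x * cos (pi * x) = eig (Suc n) x / 2 + eig m x / 2" for x
    proof -
      have "sin (real (Suc n) * pi * x) + sin (real m * pi * x) = 2 * (sin (real n * pi * x) * cos (pi * x))"
        using sin_add[of "real n * pi * x" "pi * x"] sin_diff[of "real n * pi * x" "pi * x"] Suc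
        by (simp add: algebra_simps)
      then show ?thesis by (simp add: eig_def add_divide_distrib[symmetric] distrib_left[symmetric] del: of_nat_Suc)
    qed
    then have "(\<lambda>q. eig n (fst q) * \<psi> (snd q) * cos (pi * fst q))
      = (\<lambda>q. eig (Suc n) (fst q) * (\<psi> (snd q) / 2) + eig m (fst q) * (\<psi> (snd q) / 2))"
      by (auto simp: fun_eq_iff mult.commute mult.left_commute distrib_left)
    moreover have "continuous_on UNIV (\<lambda>t. \<psi> t / 2)" using mode by (intro continuous_intros) auto
    ultimately show ?thesis
      using sine_span.add[OF sine_span.mode sine_span.mode, of "\<lambda>t. \<psi> t / 2" "\<lambda>t. \<psi> t / 2" "Suc n" m] by simp
  qed
next
  case (add f g)
  then show ?case using sine_span.add[OF add.IH] by (simp add: distrib_right)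
qed

text \<open>
  Powers of \<open>cos(\<pi>x)\<close> rather than the functions \<open>cos(k\<pi>x)\<close>, so that closure under products is immediate.
  This algebra separates the points of the closed cylinder, and multiplication by
  \<open>e\<^sub>1\<close> maps it into the span of the sine modes.
\<close>

inductive cosine_algebra :: "(real \<times> real \<Rightarrow> real) \<Rightarrow> bool" where
  mode: "continuous_on UNIV \<psi> \<Longrightarrow> cosine_algebra (\<lambda>q. cos (pi * fst q) ^ k * \<psi> (snd q))"
| add: "cosine_algebra f \<Longrightarrow> cosine_algebra g \<Longrightarrow> cosine_algebra (\<lambda>q. f q + g q)"

lemma cosine_algebra_continuous: "cosine_algebra f \<Longrightarrow> continuous_on A f"
proof (induction rule: cosine_algebra.induct)
  case (mode \<psi> k)
  then show ?case by (intro continuous_intros continuous_on_compose2[OF mode]) auto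
qed (intro continuous_intros)

lemma cosine_algebra_mult:
  assumes "cosine_algebra f" "cosine_algebra g"
  shows "cosine_algebra (\<lambda>q. f q * g q)"
  using assms
proof (induction rule: cosine_algebra.induct)
  case (mode \<psi> k)
  note \<psi> = mode.hyps
  show ?case
    using mode.prems
  proof (induction rule: cosine_algebra.induct)
    case (mode \<psi>' j)
    have "continuous_on UNIV (\<lambda>t. \<psi> t * \<psi>' t)" using \<psi> mode by (intro continuous_intros)
    from cosine_algebra.mode[OF this, of "k + j"] show ?case
      by (simp add: power_add mult_ac)
  next
    case (add f g)
    show ?case using cosine_algebra.add[OF add.IH] by (simp add: distrib_left)
  qed
next
  case (add f g')
  show ?case using cosine_algebra.add[OF add.IH(1)[OF add.prems] add.IH(2)[OF add.prems]] by (simp add: distrib_right)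
qed

lemma cosine_algebra_dense:
  assumes G: "continuous_on ({0..1} \<times> {0..T}) G" and "0 < \<epsilon>"
  shows "\<exists>p. cosine_algebra p \<and> (\<forall>q\<in>{0..1} \<times> {0..T}. \<bar>G q - p q\<bar> < \<epsilon>)"
proof (rule Stone_Weierstrass_HOL)
  show "compact ({0..1} \<times> {0..T} :: (real \<times> real) set)" by (intro compact_Times) auto
  show "cosine_algebra (\<lambda>x. c)" for c using cosine_algebra.mode[of "\<lambda>_. c" 0] by simp
  fix q r :: "real \<times> real" assume qr: "q \<in> {0..1} \<times> {0..T} \<and> r \<in> {0..1} \<times> {0..T} \<and> q \<noteq> r"
  show "\<exists>f. cosine_algebra f \<and> f q \<noteq> f r"
  proof (cases "snd q = snd r")
    case False
    then show ?thesis using cosine_algebra.mode[of "\<lambda>t. t" 0] by auto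
  next
    case True
    then have "fst q \<noteq> fst r" using qr by (auto simp: prod_eq_iff)
    then have "cos (pi * fst q) \<noteq> cos (pi * fst r)"
      using qr cos_inj_pi[of "pi * fst q" "pi * fst r"] by (auto simp: mult_left_le)
    then show ?thesis using cosine_algebra.mode[of "\<lambda>t. 1" 1] by auto
  qed
qed (use assms cosine_algebra_continuous cosine_algebra.add cosine_algebra_mult in auto)

lemma sine_span_cosine_algebra:
  assumes "cosine_algebra p" shows "sine_span (\<lambda>q. eig 1 (fst q) * p q)"
  using assms
proof (induction rule: cosine_algebra.induct)
  case (mode \<psi> k)
  show ?case
  proof (induction k)
    case 0
    then show ?case using sine_span.mode[OF mode, of 1] by simp
  next
    case (Suc k)
    then show ?case using sine_span_mult_cos[OF Suc] by (simp add: mult_ac)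
  qed
next
  case (add f g)
  then show ?case using sine_span.add[OF add.IH] by (simp add: distrib_left)
qed

lemma sine_span_sum:
  assumes "sine_span f"
  shows "\<exists>N \<psi>. (\<forall>n. continuous_on UNIV (\<psi> n)) \<and> f = (\<lambda>q. \<Sum>n=1..N. eig n (fst q) * \<psi> n (snd q))"
  using assms
proof (induction rule: sine_span.induct)
  case (mode \<psi> n)
  show ?case
  proof (intro exI conjI allI)
    show "continuous_on UNIV (\<lambda>t. if m = n then \<psi> t else 0)" for m using mode by (cases "m = n") auto
    have "(\<Sum>m=1..n. eig m x * (if m = n then \<psi> t else 0)) = eig n x * \<psi> t" for x t
      by (cases "n = 0") (auto simp: eig_def if_distrib cong: if_cong)
    then show "tensor (eig n) \<psi> = (\<lambda>q. \<Sum>m=1..n. eig m (fst q) * (if m = n then \<psi> (snd q) else 0))" by simp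
  qed
next
  case (add f g)
  then obtain N \<psi> M \<rho> where 1: "\<And>n. continuous_on UNIV (\<psi> n)" "f = (\<lambda>q. \<Sum>n=1..N. eig n (fst q) * \<psi> n (snd q))"
    and 2: "\<And>n. continuous_on UNIV (\<rho> n)" "g = (\<lambda>q. \<Sum>n=1..M. eig n (fst q) * \<rho> n (snd q))" by blast
  have pad: "(\<Sum>n=1..N. F n) = (\<Sum>n=1..max N M. if n \<le> N then F n else 0)" 
     "(\<Sum>n=1..M. F n) = (\<Sum>n=1..max N M. if n \<le> M then F n else 0)" for F :: "nat \<Rightarrow> real"
    by (auto intro!: sum.mono_neutral_cong_left)
  show ?case
  proof (intro exI conjI allI)
    show "continuous_on UNIV (\<lambda>t. (if n \<le> N then \<psi> n t else 0) + (if n \<le> M then \<rho> n t else 0))" for n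
      using 1 2 by (cases "n \<le> N"; cases "n \<le> M") (auto intro!: continuous_intros)
    show "(\<lambda>q. f q + g q) = (\<lambda>q. \<Sum>n=1..max N M. eig n (fst q) *
        ((if n \<le> N then \<psi> n (snd q) else 0) + (if n \<le> M then \<rho> n (snd q) else 0)))"
      unfolding 1(2) 2(2) pad by (auto simp: fun_eq_iff sum.distrib[symmetric] distrib_left intro!: sum.cong)
  qed
qed

definition clip :: "real \<Rightarrow> real \<Rightarrow> real" where
  "clip M r = max (- M) (min M r)"

lemma clip_bounds: "0 \<le> M \<Longrightarrow> \<bar>clip M r\<bar> \<le> M" "0 \<le> M \<Longrightarrow> \<bar>clip M r\<bar> \<le> \<bar>r\<bar>" "0 \<le> M \<Longrightarrow> \<bar>r - clip M r\<bar> \<le> \<bar>r\<bar>"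
  by (auto simp: clip_def)

lemma clip_id: "\<bar>r\<bar> \<le> M \<Longrightarrow> clip M r = r"
  by (auto simp: clip_def)

lemma clip_continuous: "continuous_on A (clip M)"
  unfolding clip_def by (intro continuous_intros)

lemma L2_on_clip:
  assumes f: "L2_on S f" and M: "0 \<le> M"
  shows "L2_on S (\<lambda>q. clip M (f q))"
proof -
  have "indicator S q *\<^sub>R clip M (f q) = clip M (indicator S q *\<^sub>R f q)" for q
    using M by (auto simp: indicator_def clip_def)
  moreover have [measurable]: "clip M \<in> borel_measurable borel"
    by (intro borel_measurable_continuous_onI clip_continuous)
  have "(\<lambda>q. clip M (indicator S q *\<^sub>R f q)) \<in> borel_measurable lborel"
    using L2_on_measurable[OF f] by measurable
  ultimately have m: "(\<lambda>q. indicator S q *\<^sub>R clip M (f q)) \<in> borel_measurable lborel" by simp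
  have "integrable lborel (\<lambda>q. indicator S q *\<^sub>R (clip M (f q))\<^sup>2)"
  proof (rule Bochner_Integration.integrable_bound)
    show "integrable lborel (\<lambda>q. indicator S q *\<^sub>R (f q)\<^sup>2)" using f by (simp add: L2_on_def set_integrable_def)
    have "indicator S q *\<^sub>R (clip M (f q))\<^sup>2 = (indicator S q *\<^sub>R clip M (f q))\<^sup>2" for q
      by (auto simp: indicator_def)
    then show "(\<lambda>q. indicator S q *\<^sub>R (clip M (f q))\<^sup>2) \<in> borel_measurable lborel" using m by simp
    show "AE q in lborel. norm (indicator S q *\<^sub>R (clip M (f q))\<^sup>2) \<le> norm (indicator S q *\<^sub>R (f q)\<^sup>2)"
      using clip_bounds(2)[OF M] by (auto simp: indicator_def abs_le_square_iff)
  qed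
  then show ?thesis using m by (simp add: L2_on_def set_integrable_def set_borel_measurable_def)
qed

lemma sine_span_L2: assumes "sine_span s" shows "L2_on (cyl T) s"
  using assms
  by (induction rule: sine_span.induct) (auto intro!: L2_on_tensor L2_on_eig L2_on_ival L2_on_add intro: continuous_on_subset)

text \<open>
  Truncation reduces the claim to bounded \<open>f\<close>, and a bounded \<open>f\<close> is almost everywhere the limit of
  uniformly bounded continuous functions \<open>g\<^sub>n\<close>. Since \<open>e\<^sub>1 > 0\<close> on \<open>(0,1)\<close>, the quotient of \<open>g\<^sub>n\<close> by \<open>e\<^sub>1\<close>,
  regularized at the zeros of \<open>e\<^sub>1\<close>, is continuous; approximating it uniformly in the cosine
  algebra and multiplying by \<open>e\<^sub>1\<close> gives elements of the span that stay bounded and converge to \<open>f\<close>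
  almost everywhere.
\<close>

theorem sine_span_dense:
  assumes f: "L2_on (cyl T) f" and e: "0 < \<epsilon>"
  shows "\<exists>s. sine_span s \<and> L2_norm (cyl T) (\<lambda>q. f q - s q) < \<epsilon>"
proof -
  have "(\<lambda>k. L2_norm (cyl T) (\<lambda>q. f q - clip (real k) (f q))) \<longlonglongrightarrow> 0"
  proof (rule L2_norm_dominated_convergence)
    have "(\<lambda>q. indicator (cyl T) q *\<^sub>R \<bar>f q\<bar>) = (\<lambda>q. \<bar>indicator (cyl T) q *\<^sub>R f q\<bar>)" by (auto simp: abs_mult)
    then show "L2_on (cyl T) (\<lambda>q. \<bar>f q\<bar>)"
      using f borel_measurable_abs[OF L2_on_measurable[OF f]] by (simp add: L2_on_def set_borel_measurable_def)
    show "L2_on (cyl T) (\<lambda>q. f q - clip (real k) (f q))" for k by (intro L2_on_diff f L2_on_clip) auto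
    show "\<bar>f q - clip (real k) (f q)\<bar> \<le> \<bar>f q\<bar>" for k q by (intro clip_bounds) auto
    show "AE q\<in>cyl T in lborel. (\<lambda>k. f q - clip (real k) (f q)) \<longlonglongrightarrow> 0"
    proof (intro AE_I2 impI tendsto_eventually)
      fix q
      show "\<forall>\<^sub>F k in sequentially. f q - clip (real k) (f q) = 0"
        using eventually_ge_at_top[of "nat \<lceil>\<bar>f q\<bar>\<rceil>"]
        by eventually_elim (simp add: clip_id nat_le_iff ceiling_le_iff)
    qed
  qed
  then have "\<forall>\<^sub>F k in sequentially. L2_norm (cyl T) (\<lambda>q. f q - clip (real k) (f q)) < \<epsilon> / 2"
    using e by (intro order_tendstoD) auto
  then obtain k where k: "L2_norm (cyl T) (\<lambda>q. f q - clip (real k) (f q)) < \<epsilon> / 2"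
    using eventually_happens'[OF sequentially_bot] by blast
  define M where "M = real k"
  have M: "0 \<le> M" by (simp add: M_def)
  define F where "F q = indicator (cyl T) q *\<^sub>R f q" for q
  have "F \<in> borel_measurable lborel" unfolding F_def by (rule L2_on_measurable[OF f])
  then have "F \<in> borel_measurable lebesgue" by (rule measurable_completion)
  then have "F measurable_on UNIV"
    by (intro lebesgue_measurable_imp_measurable_on) (auto simp: lebesgue_on_UNIV_eq)
  then obtain N g where N: "negligible N" and g: "\<And>n. continuous_on UNIV (g n)"
    and lim: "\<And>q. q \<notin> N \<Longrightarrow> (\<lambda>n. g n q) \<longlonglongrightarrow> F q"
    unfolding measurable_on_def by auto
  have "AE q in lebesgue. q \<notin> N" using N by (intro AE_not_in) (simp add: negligible_iff_null_sets)
  then have aeN: "AE q in lborel. q \<notin> N" by (simp add: AE_completion_iff)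
  \<comment> \<open>The summand \<open>1/(n+1)\<close> keeps the denominator away from zero; on the cylinder it disappears in the limit.\<close>
  define G where "G n q = clip M (g n q) / (\<bar>eig 1 (fst q)\<bar> + 1 / real (Suc n))" for n q
  have den: "\<bar>eig 1 x\<bar> + 1 / real (Suc n) > 0" for x n by (intro add_nonneg_pos) auto
  have G: "continuous_on A (G n)" for A n
    unfolding G_def using den[of _ n]
    by (intro continuous_intros continuous_on_compose2[OF clip_continuous[of UNIV]] continuous_on_compose2[OF eig_continuous(1)[of UNIV]] continuous_on_subset[OF g])
       (auto simp: less_imp_neq[symmetric])
  have "\<exists>p. cosine_algebra p \<and> (\<forall>q\<in>{0..1} \<times> {0..T}. \<bar>G n q - p q\<bar> < 1 / real (Suc n))" for n
    by (rule cosine_algebra_dense[OF G]) simp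
  then obtain p where p: "\<And>n. cosine_algebra (p n)"
    "\<And>n q. q \<in> {0..1} \<times> {0..T} \<Longrightarrow> \<bar>G n q - p n q\<bar> < 1 / real (Suc n)" by metis
  define s where "s n q = eig 1 (fst q) * p n q" for n q
  have s: "sine_span (s n)" for n unfolding s_def by (rule sine_span_cosine_algebra[OF p(1)])
  have near: "\<bar>s n q - eig 1 (fst q) * G n q\<bar> \<le> sqrt 2 * (1 / real (Suc n))" if "q \<in> cyl T" for n q
  proof -
    have "q \<in> {0..1} \<times> {0..T}" using that by (auto simp: cyl_def)
    from p(2)[OF this, of n] have "\<bar>eig 1 (fst q)\<bar> * \<bar>p n q - G n q\<bar> \<le> sqrt 2 * (1 / real (Suc n))"
      by (intro mult_mono abs_eig_le) auto
    then show ?thesis by (simp add: s_def abs_mult[symmetric] right_diff_distrib)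
  qed
  have EG: "\<bar>eig 1 (fst q) * G n q\<bar> \<le> M" for n q
  proof -
    have "\<bar>eig 1 (fst q) * G n q\<bar> = \<bar>clip M (g n q)\<bar> * (\<bar>eig 1 (fst q)\<bar> / (\<bar>eig 1 (fst q)\<bar> + 1 / real (Suc n)))"
      using den[of "fst q" n] by (simp add: G_def abs_mult del: of_nat_Suc)
    also have "\<dots> \<le> M * 1"
      using den[of "fst q" n] by (intro mult_mono clip_bounds M) (auto simp del: of_nat_Suc)
    finally show ?thesis by simp
  qed
  have "(\<lambda>n. L2_norm (cyl T) (\<lambda>q. clip M (f q) - s n q)) \<longlonglongrightarrow> 0"
  proof (rule L2_norm_bounded_convergence[OF cyl_borel cyl_bounded, where B = "2 * M + sqrt 2"])
    show "L2_on (cyl T) (\<lambda>q. clip M (f q) - s n q)" for n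
      by (intro L2_on_diff L2_on_clip f M sine_span_L2 s)
    show "\<bar>clip M (f q) - s n q\<bar> \<le> 2 * M + sqrt 2" if "q \<in> cyl T" for n q
    proof -
      have "sqrt 2 * (1 / real (Suc n)) \<le> sqrt 2 * 1" by (intro mult_left_mono) auto
      then show ?thesis using near[OF that, of n] EG[of q n] clip_bounds(1)[OF M, of "f q"] by linarith
    qed
    show "AE q\<in>cyl T in lborel. (\<lambda>n. clip M (f q) - s n q) \<longlonglongrightarrow> 0"
      using aeN
    proof (eventually_elim, intro impI)
      fix q assume "q \<notin> N" and q: "q \<in> cyl T"
      have pos: "eig 1 (fst q) > 0"
        using q sin_gt_zero[of "pi * fst q"] by (auto simp: eig_def cyl_def)
      have z: "(\<lambda>n. 1 / real (Suc n)) \<longlonglongrightarrow> 0" using LIMSEQ_Suc[OF lim_1_over_n] by simp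
      have "(\<lambda>n. g n q) \<longlonglongrightarrow> f q" using lim[OF \<open>q \<notin> N\<close>] q by (simp add: F_def)
      then have "(\<lambda>n. clip M (g n q)) \<longlonglongrightarrow> clip M (f q)"
        unfolding clip_def by (intro tendsto_intros)
      then have "(\<lambda>n. eig 1 (fst q) * G n q) \<longlonglongrightarrow> eig 1 (fst q) * (clip M (f q) / (\<bar>eig 1 (fst q)\<bar> + 0))"
        unfolding G_def using pos by (intro tendsto_intros z) auto
      then have 1: "(\<lambda>n. eig 1 (fst q) * G n q) \<longlonglongrightarrow> clip M (f q)" using pos by simp
      have 2: "(\<lambda>n. s n q - eig 1 (fst q) * G n q) \<longlonglongrightarrow> 0"
        by (rule Lim_null_comparison[OF _ tendsto_mult_right_zero[OF z, of "sqrt 2"]])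
           (use near[OF q] in auto)
      show "(\<lambda>n. clip M (f q) - s n q) \<longlonglongrightarrow> 0"
        using tendsto_diff[OF tendsto_const[of "clip M (f q)"] tendsto_add[OF 2 1]] by simp
    qed
  qed
  then have "\<forall>\<^sub>F n in sequentially. L2_norm (cyl T) (\<lambda>q. clip M (f q) - s n q) < \<epsilon> / 2"
    using e by (intro order_tendstoD) auto
  then obtain n where n: "L2_norm (cyl T) (\<lambda>q. clip M (f q) - s n q) < \<epsilon> / 2"
    using eventually_happens'[OF sequentially_bot] by blast
  have "L2_norm (cyl T) (\<lambda>q. (f q - clip M (f q)) + (clip M (f q) - s n q))
     \<le> L2_norm (cyl T) (\<lambda>q. f q - clip M (f q)) + L2_norm (cyl T) (\<lambda>q. clip M (f q) - s n q)"
    by (intro L2_norm_triangle L2_on_diff L2_on_clip f M sine_span_L2 s)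
  then show ?thesis using k n s[of n] unfolding M_def by (intro exI[of _ "s n"]) simp
qed

text \<open>
  The hypothesis says that the component of \<open>p\<close> in each mode \<open>e\<^sub>n\<close> is the multiple \<open>\<beta>\<^sub>n \<rho>\<^sub>n\<close> of a known
  function, and the conclusion is half of Parseval's identity. If \<open>s = \<Sum> e\<^sub>n \<otimes> \<psi>\<^sub>n\<close> approximates \<open>p\<close>, then \<open>\<parallel>p\<parallel>\<^sup>2 = \<parallel>p - s\<parallel>\<^sup>2 + 2\<langle>p, s\<rangle> - \<parallel>s\<parallel>\<^sup>2\<close>,
  and \<open>2\<langle>p, s\<rangle> - \<parallel>s\<parallel>\<^sup>2 = \<Sum> (2 \<beta>\<^sub>n \<langle>\<psi>\<^sub>n, \<rho>\<^sub>n\<rangle> - \<parallel>\<psi>\<^sub>n\<parallel>\<^sup>2)\<close>, whose \<open>n\<close>-th term is at most \<open>\<beta>\<^sub>n\<^sup>2 \<parallel>\<rho>\<^sub>n\<parallel>\<^sup>2\<close>.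
\<close>

theorem mode_bessel_converse:
  assumes p: "L2_on (cyl T) p" and \<rho>: "\<And>n. continuous_on UNIV (\<rho> n)"
    and \<beta>: "\<And>n \<psi>. 1 \<le> n \<Longrightarrow> continuous_on UNIV \<psi> \<Longrightarrow>
       L2_inner (cyl T) p (tensor (eig n) \<psi>) = \<beta> n * L2_inner {0<..<T} \<psi> (\<rho> n)"
    and B: "\<And>N. (\<Sum>n=1..N. (\<beta> n)\<^sup>2 * L2_inner {0<..<T} (\<rho> n) (\<rho> n)) \<le> B"
  shows "(L2_norm (cyl T) p)\<^sup>2 \<le> B"
proof (rule field_le_epsilon)
  fix e :: real assume "0 < e"
  then obtain s where s: "sine_span s" "L2_norm (cyl T) (\<lambda>q. p q - s q) < sqrt e"
    using sine_span_dense[OF p, of "sqrt e"] by auto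
  obtain N \<psi> where \<psi>: "\<And>n. continuous_on UNIV (\<psi> n)" and se: "s = (\<lambda>q. \<Sum>n=1..N. eig n (fst q) * \<psi> n (snd q))"
    using sine_span_sum[OF s(1)] by blast
  have L\<psi>: "L2_on {0<..<T} (\<psi> n)" and L\<rho>: "L2_on {0<..<T} (\<rho> n)" for n
    using \<psi> \<rho> by (auto intro!: L2_on_ival intro: continuous_on_subset)
  have Lt: "L2_on (cyl T) (tensor (eig n) (\<psi> n))" for n by (intro L2_on_tensor L2_on_eig L\<psi>)
  have Ls: "L2_on (cyl T) s" by (rule sine_span_L2[OF s(1)])
  have ps: "L2_inner (cyl T) p s = (\<Sum>n=1..N. \<beta> n * L2_inner {0<..<T} (\<psi> n) (\<rho> n))"
    unfolding L2_inner_commute[of _ p] se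
    by (subst L2_inner_sum_left[OF Lt p]) (auto intro!: sum.cong simp: L2_inner_commute[of _ _ p] \<beta> \<psi>)
  have ss: "L2_inner (cyl T) s s = (\<Sum>n=1..N. L2_inner {0<..<T} (\<psi> n) (\<psi> n))"
  proof -
    have "L2_inner (cyl T) s s = (\<Sum>n=1..N. L2_inner (cyl T) (tensor (eig n) (\<psi> n)) s)"
      by (subst (1) se) (rule L2_inner_sum_left[OF Lt Ls])
    also have "\<dots> = (\<Sum>n=1..N. L2_inner {0<..<T} (\<psi> n) (\<psi> n))"
    proof (rule sum.cong[OF refl])
      fix n assume n: "n \<in> {1..N}"
      have "L2_inner (cyl T) (tensor (eig n) (\<psi> n)) s = (\<Sum>m=1..N. L2_inner (cyl T) (tensor (eig m) (\<psi> m)) (tensor (eig n) (\<psi> n)))"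
        by (subst L2_inner_commute, subst se, rule L2_inner_sum_left[OF Lt Lt])
      also have "\<dots> = (\<Sum>m=1..N. if m = n then L2_inner {0<..<T} (\<psi> n) (\<psi> n) else 0)"
        using n by (intro sum.cong refl) (auto simp: L2_inner_tensor L2_on_eig L\<psi> eig_orthonormal)
      also have "\<dots> = L2_inner {0<..<T} (\<psi> n) (\<psi> n)" using n by simp
      finally show "L2_inner (cyl T) (tensor (eig n) (\<psi> n)) s = L2_inner {0<..<T} (\<psi> n) (\<psi> n)" .
    qed
    finally show ?thesis .
  qed
  have "(L2_norm (cyl T) (\<lambda>q. p q - s q))\<^sup>2 \<le> (sqrt e)\<^sup>2"
    using s(2) by (intro power_mono) (auto simp: L2_norm_nonneg)
  then have le: "L2_inner (cyl T) (\<lambda>q. p q - s q) (\<lambda>q. p q - s q) \<le> e" using \<open>0 < e\<close> by (simp add: L2_norm_power2)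
  have "L2_inner (cyl T) p p - 2 * L2_inner (cyl T) p s + L2_inner (cyl T) s s \<le> e"
    using L2_inner_self_add[OF p Ls, of "-1"] le by simp
  moreover have "2 * L2_inner (cyl T) p s - L2_inner (cyl T) s s \<le> B"
  proof -
    have "2 * L2_inner (cyl T) p s - L2_inner (cyl T) s s
       = (\<Sum>n=1..N. 2 * (\<beta> n * L2_inner {0<..<T} (\<psi> n) (\<rho> n)) - L2_inner {0<..<T} (\<psi> n) (\<psi> n))"
      by (simp add: ps ss sum_subtractf sum_distrib_left)
    also have "\<dots> \<le> (\<Sum>n=1..N. (\<beta> n)\<^sup>2 * L2_inner {0<..<T} (\<rho> n) (\<rho> n))"
    \<comment> \<open>Termwise, this is \<open>0 \<le> \<parallel>\<psi>\<^sub>n - \<beta>\<^sub>n \<rho>\<^sub>n\<parallel>\<^sup>2\<close>.\<close>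
    proof (rule sum_mono)
      fix n
      have "0 \<le> L2_inner {0<..<T} (\<lambda>t. \<psi> n t + (- \<beta> n) * \<rho> n t) (\<lambda>t. \<psi> n t + (- \<beta> n) * \<rho> n t)"
        by (rule L2_inner_self_nonneg)
      then show "2 * (\<beta> n * L2_inner {0<..<T} (\<psi> n) (\<rho> n)) - L2_inner {0<..<T} (\<psi> n) (\<psi> n)
         \<le> (\<beta> n)\<^sup>2 * L2_inner {0<..<T} (\<rho> n) (\<rho> n)"
        unfolding L2_inner_self_add[OF L\<psi> L\<rho>] by simp
    qed
    also have "\<dots> \<le> B" by (rule B)
    finally show ?thesis .
  qed
  ultimately show "(L2_norm (cyl T) p)\<^sup>2 \<le> B + e" by (simp add: L2_norm_power2)
qed

text \<open>
  A function of \<open>x\<close> alone is a function on \<open>(0,1) \<times> (0,1)\<close> whose modes are constant in time.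
\<close>

corollary sine_bessel_converse:
  assumes f: "L2_on unit_ival f" and B: "\<And>N. (\<Sum>n=1..N. (coef f n)\<^sup>2) \<le> B"
  shows "(L2_norm unit_ival f)\<^sup>2 \<le> B"
proof -
  have L1: "L2_on unit_ival (\<lambda>_. 1)" by (intro L2_on_ival continuous_intros)
  have one: "L2_inner unit_ival (\<lambda>_. 1) (\<lambda>_. 1) = 1" by (simp add: L2_inner_def set_lebesgue_integral_def)
  have "(L2_norm (cyl 1) (tensor f (\<lambda>_. 1)))\<^sup>2 \<le> B"
  proof (rule mode_bessel_converse[where \<rho> = "\<lambda>n t. 1" and \<beta> = "coef f"])
    show "L2_on (cyl 1) (tensor f (\<lambda>_. 1))" by (rule L2_on_tensor[OF f L1])
    fix n \<psi> assume "1 \<le> (n::nat)" and \<psi>: "continuous_on UNIV (\<psi> :: real \<Rightarrow> real)"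
    have "L2_on unit_ival \<psi>" using \<psi> by (intro L2_on_ival) (rule continuous_on_subset, auto)
    then show "L2_inner (cyl 1) (tensor f (\<lambda>_. 1)) (tensor (eig n) \<psi>) = coef f n * L2_inner unit_ival \<psi> (\<lambda>_. 1)"
      using L2_inner_tensor[OF f L1 L2_on_eig(1)[of n]] by (simp add: coef_def L2_inner_commute[of _ \<psi>])
  next
    show "(\<Sum>n=1..N. (coef f n)\<^sup>2 * L2_inner unit_ival (\<lambda>_. 1) (\<lambda>_. 1)) \<le> B" for N
      unfolding one using B[of N] by simp
  qed auto
  then show ?thesis
    using L2_inner_tensor[OF f L1 f L1] one by (simp add: L2_norm_power2)
qed

section \<open>Optimality conditions\<close>

lemma terminal_coef_difference:
  assumes T: "T > 0" and u: "L2_on (cyl T) u" and y0: "L2_on unit_ival y0" and yT: "L2_on unit_ival yT"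
    and sol: "heat_weak_solution T y0 u y"
  shows "coef (\<lambda>x. y (x, T) - yT x) n = L2_inner (cyl T) u (tensor (eig n) (adjoint_mode T n)) - dcoef T y0 yT n"
proof -
  have "L2_on unit_ival (\<lambda>x. y (x, T))"
    using sol T by (auto simp: heat_weak_solution_def C_L2_def)
  then have "coef (\<lambda>x. y (x, T) - yT x) n = coef (\<lambda>x. y (x, T)) n - coef yT n"
    unfolding coef_def by (rule L2_inner_diff_left[OF _ yT L2_on_eig(1)])
  then show ?thesis
    using coef_terminal_state[OF T u y0 sol, of n] by (simp add: dcoef_def)
qed

text \<open>
  Variation of the control by \<open>\<tau> e\<^sub>n \<otimes> \<psi>\<close> moves the terminal state by \<open>\<tau> \<langle>\<psi>, \<rho>\<^sub>n\<rangle> e\<^sub>n\<close>, with \<open>\<rho>\<^sub>n\<close> the adjoint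
  mode, and the penalized cost is quadratic in \<open>\<tau>\<close>.
\<close>

lemma optimal_pen_modes:
  assumes T: "T > 0" and y0: "L2_on unit_ival y0" and yT: "L2_on unit_ival yT"
    and opt: "optimal_pen T y0 yT \<alpha> u" and sol: "heat_weak_solution T y0 u y"
    and \<psi>: "continuous_on UNIV \<psi>"
  shows "L2_inner (cyl T) u (tensor (eig n) \<psi>)
    = - \<alpha> * coef (\<lambda>x. y (x, T) - yT x) n * L2_inner {0<..<T} \<psi> (adjoint_mode T n)"
proof -
  obtain y' where u: "L2_on (cyl T) u" and sol': "heat_weak_solution T y0 u y'"
    and min: "\<And>v z. L2_on (cyl T) v \<Longrightarrow> heat_weak_solution T y0 v z \<Longrightarrow> J_pen T yT \<alpha> u y' \<le> J_pen T yT \<alpha> v z"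
    using opt by (auto simp: optimal_pen_def)
  let ?r = "\<lambda>x. y' (x, T) - yT x" and ?h = "tensor (eig n) \<psi>" and ?z = "response n \<psi> T"
  have r: "L2_on unit_ival ?r"
    using sol' T yT by (intro L2_on_diff) (auto simp: heat_weak_solution_def C_L2_def)
  have c\<psi>: "continuous_on {0..T} \<psi>" using \<psi> by (rule continuous_on_subset) auto
  have h: "L2_on (cyl T) ?h" by (intro L2_on_tensor L2_on_eig L2_on_ival c\<psi>)
  have "L2_inner (cyl T) u ?h + \<alpha> * (L2_inner unit_ival ?r (eig n) * ?z) = 0"
  proof (rule quadratic_nonneg_imp_linear_zero)
    fix \<tau>
    let ?v = "\<lambda>q. u q + eig n (fst q) * (\<tau> * \<psi> (snd q))"
    let ?y = "\<lambda>q. y' q + eig n (fst q) * response n (\<lambda>t. \<tau> * \<psi> t) (snd q)"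
    have v: "?v = (\<lambda>q. u q + \<tau> * ?h q)" by (auto simp: mult_ac)
    have "J_pen T yT \<alpha> u y' \<le> J_pen T yT \<alpha> ?v ?y"
    proof (rule min)
      show "L2_on (cyl T) ?v" unfolding v by (intro L2_on_add u L2_on_cmult h)
      show "heat_weak_solution T y0 ?v ?y"
        by (intro add_mode_control T u sol' continuous_intros c\<psi>)
    qed
    moreover have "J_pen T yT \<alpha> ?v ?y = 1/2 * (L2_inner (cyl T) u u + 2 * \<tau> * L2_inner (cyl T) u ?h + \<tau>\<^sup>2 * L2_inner (cyl T) ?h ?h)
       + \<alpha>/2 * (L2_inner unit_ival ?r ?r + 2 * (\<tau> * ?z) * L2_inner unit_ival ?r (eig n) + (\<tau> * ?z)\<^sup>2 * L2_inner unit_ival (eig n) (eig n))"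
    proof -
      have "(\<lambda>x. ?y (x, T) - yT x) = (\<lambda>x. ?r x + (\<tau> * ?z) * eig n x)"
        by (auto simp: response_cmult)
      then show ?thesis
        unfolding J_pen_def v L2_norm_power2 L2_inner_self_add[OF u h] 
        by (simp only: L2_inner_self_add[OF r L2_on_eig(1)])
    qed
    ultimately have "0 \<le> 2 * (1/2 * (2 * \<tau> * L2_inner (cyl T) u ?h + \<tau>\<^sup>2 * L2_inner (cyl T) ?h ?h)
       + \<alpha>/2 * (2 * (\<tau> * ?z) * L2_inner unit_ival ?r (eig n) + (\<tau> * ?z)\<^sup>2 * L2_inner unit_ival (eig n) (eig n)))"
      by (simp add: J_pen_def L2_norm_power2 algebra_simps)
    also have "\<dots> = 2 * \<tau> * (L2_inner (cyl T) u ?h + \<alpha> * (L2_inner unit_ival ?r (eig n) * ?z))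
        + \<tau>\<^sup>2 * (L2_inner (cyl T) ?h ?h + \<alpha> * ?z\<^sup>2 * L2_inner unit_ival (eig n) (eig n))"
      by (simp add: field_simps power2_eq_square)
    finally show "0 \<le> 2 * \<tau> * (L2_inner (cyl T) u ?h + \<alpha> * (L2_inner unit_ival ?r (eig n) * ?z))
        + \<tau>\<^sup>2 * (L2_inner (cyl T) ?h ?h + \<alpha> * ?z\<^sup>2 * L2_inner unit_ival (eig n) (eig n))" .
  qed
  moreover have "L2_inner unit_ival ?r (eig n) = coef (\<lambda>x. y (x, T) - yT x) n"
    using terminal_coef_difference[OF T u y0 yT sol] terminal_coef_difference[OF T u y0 yT sol'] by (simp add: coef_def)
  moreover have "?z = L2_inner {0<..<T} \<psi> (adjoint_mode T n)" by (rule response_terminal[OF c\<psi> T])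
  ultimately show ?thesis by simp
qed

text \<open>
  The optimality condition for \<open>\<psi> = \<rho>\<^sub>n\<close> reads \<open>\<langle>u, e\<^sub>n \<otimes> \<rho>\<^sub>n\<rangle> = -\<alpha> r\<^sub>n a\<^sub>n\<close>, while Duhamel's formula says that
  the left-hand side is \<open>r\<^sub>n + d\<^sub>n\<close>.
\<close>

lemma optimal_pen_residual:
  assumes T: "T > 0" and y0: "L2_on unit_ival y0" and yT: "L2_on unit_ival yT" and \<alpha>: "\<alpha> > 0"
    and opt: "optimal_pen T y0 yT \<alpha> u" and sol: "heat_weak_solution T y0 u y" and n: "n \<ge> 1"
  shows "coef (\<lambda>x. y (x, T) - yT x) n = - dcoef T y0 yT n / (1 + \<alpha> * acoef T n)"
proof -
  have u: "L2_on (cyl T) u" using opt by (simp add: optimal_pen_def)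
  have "0 < \<alpha> * acoef T n" using \<alpha> acoef_pos[OF T n] by simp
  then show ?thesis
    using terminal_coef_difference[OF T u y0 yT sol, of n]
      optimal_pen_modes[OF T y0 yT opt sol adjoint_mode_continuous[of UNIV T n], of n] adjoint_mode_norm[OF T n]
    by (simp add: field_simps)
qed

text \<open>
  Variations \<open>e\<^sub>n \<otimes> \<psi>\<close> with \<open>\<psi>\<close> orthogonal to the adjoint mode leave the terminal state unchanged, so they are
  admissible and the optimal control is orthogonal to them. What remains is the component along the
  adjoint mode, which the terminal constraint prescribes.
\<close>

lemma optimal_hard_modes:
  assumes T: "T > 0" and y0: "L2_on unit_ival y0" and yT: "L2_on unit_ival yT"
    and opt: "optimal_hard T y0 yT u" and \<psi>: "continuous_on UNIV \<psi>" and n: "n \<ge> 1"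
  shows "L2_inner (cyl T) u (tensor (eig n) \<psi>)
    = dcoef T y0 yT n / acoef T n * L2_inner {0<..<T} \<psi> (adjoint_mode T n)"
proof -
  obtain y where u: "L2_on (cyl T) u" and sol: "heat_weak_solution T y0 u y"
    and hit: "AE x\<in>unit_ival in lborel. y (x, T) = yT x"
    and min: "\<And>v. feasible T y0 yT v \<Longrightarrow> J_hard T u \<le> J_hard T v"
    using opt by (auto simp: optimal_hard_def feasible_def)
  have LyT: "L2_on unit_ival (\<lambda>x. y (x, T))" using sol T by (auto simp: heat_weak_solution_def C_L2_def)
  have "coef (\<lambda>x. y (x, T)) n = coef yT n"
    unfolding coef_def by (rule L2_inner_cong_AE[OF LyT yT L2_on_eig(1) hit])
  then have moment: "L2_inner (cyl T) u (tensor (eig n) (adjoint_mode T n)) = dcoef T y0 yT n"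
    using coef_terminal_state[OF T u y0 sol, of n] by (simp add: dcoef_def)
  have orth: "L2_inner (cyl T) u (tensor (eig n) \<rho>) = 0"
    if \<rho>: "continuous_on UNIV \<rho>" and perp: "L2_inner {0<..<T} \<rho> (adjoint_mode T n) = 0" for \<rho>
  proof (rule quadratic_nonneg_imp_linear_zero)
    fix \<tau>
    let ?h = "tensor (eig n) \<rho>"
    have c\<rho>: "continuous_on {0..T} \<rho>" using \<rho> by (rule continuous_on_subset) auto
    have h: "L2_on (cyl T) ?h" by (intro L2_on_tensor L2_on_eig L2_on_ival c\<rho>)
    let ?v = "\<lambda>q. u q + eig n (fst q) * (\<tau> * \<rho> (snd q))"
    have v: "?v = (\<lambda>q. u q + \<tau> * ?h q)" by (auto simp: mult_ac)
    have "feasible T y0 yT ?v"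
      unfolding feasible_def
    proof (intro conjI exI)
      show "L2_on (cyl T) ?v" unfolding v by (intro L2_on_add u L2_on_cmult h)
      show "heat_weak_solution T y0 ?v (\<lambda>q. y q + eig n (fst q) * response n (\<lambda>t. \<tau> * \<rho> t) (snd q))"
        by (intro add_mode_control T u sol continuous_intros c\<rho>)
      show "AE x\<in>unit_ival in lborel. y (x, T) + eig n (fst (x, T)) * response n (\<lambda>t. \<tau> * \<rho> t) (snd (x, T)) = yT x"
        using hit response_terminal[OF c\<rho> T, of n] perp by (simp add: response_cmult)
    qed
    from min[OF this] show "0 \<le> 2 * \<tau> * L2_inner (cyl T) u ?h + \<tau>\<^sup>2 * L2_inner (cyl T) ?h ?h"
      unfolding v J_hard_def L2_norm_power2 L2_inner_self_add[OF u h] by simp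
  qed
  have a: "acoef T n > 0" by (rule acoef_pos[OF T n])
  \<comment> \<open>Subtract from \<open>\<psi>\<close> its projection onto the adjoint mode.\<close>
  define \<kappa> where "\<kappa> = L2_inner {0<..<T} \<psi> (adjoint_mode T n) / acoef T n"
  have L: "L2_on {0<..<T} \<psi>" "L2_on {0<..<T} (adjoint_mode T n)"
    using \<psi> adjoint_mode_continuous by (auto intro!: L2_on_ival intro: continuous_on_subset)
  have "L2_inner (cyl T) u (tensor (eig n) (\<lambda>t. \<psi> t - \<kappa> * adjoint_mode T n t)) = 0"
  proof (rule orth)
    show "continuous_on UNIV (\<lambda>t. \<psi> t - \<kappa> * adjoint_mode T n t)" by (intro continuous_intros \<psi> adjoint_mode_continuous)
    show "L2_inner {0<..<T} (\<lambda>t. \<psi> t - \<kappa> * adjoint_mode T n t) (adjoint_mode T n) = 0"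
      using a unfolding L2_inner_diff_left[OF L(1) L2_on_cmult[OF L(2)] L(2)] L2_inner_cmult_left
      by (simp add: adjoint_mode_norm[OF T n] \<kappa>_def)
  qed
  moreover have "L2_inner (cyl T) u (tensor (eig n) (\<lambda>t. \<psi> t - \<kappa> * adjoint_mode T n t))
     = L2_inner (cyl T) u (tensor (eig n) \<psi>) - \<kappa> * L2_inner (cyl T) u (tensor (eig n) (adjoint_mode T n))"
  proof -
    have t: "L2_on (cyl T) (tensor (eig n) \<psi>)" "L2_on (cyl T) (tensor (eig n) (adjoint_mode T n))"
      by (intro L2_on_tensor L2_on_eig L)+
    have "L2_inner (cyl T) (\<lambda>q. eig n (fst q) * \<psi> (snd q) - \<kappa> * (eig n (fst q) * adjoint_mode T n (snd q))) u
       = L2_inner (cyl T) (tensor (eig n) \<psi>) u - \<kappa> * L2_inner (cyl T) (tensor (eig n) (adjoint_mode T n)) u"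
      by (simp add: L2_inner_diff_left t u L2_on_cmult L2_inner_cmult_left)
    then show ?thesis by (simp add: L2_inner_commute[of _ u] right_diff_distrib mult.left_commute)
  qed
  ultimately show ?thesis using moment by (simp add: \<kappa>_def)
qed

section \<open>Convergence rates\<close>

lemma damping_bound:
  fixes a \<alpha> p :: real
  assumes "a > 0" "\<alpha> > 0" "0 \<le> p" "p \<le> 2"
  shows "1 / (1 + \<alpha> * a)\<^sup>2 \<le> 1 / (a powr p) / \<alpha> powr p"
proof -
  have "(\<alpha> * a) powr p \<le> (1 + \<alpha> * a) powr p" using assms by (intro powr_mono2) auto
  also have "\<dots> \<le> (1 + \<alpha> * a) powr 2" using assms by (intro powr_mono) auto
  also have "\<dots> = (1 + \<alpha> * a)\<^sup>2" using assms by (simp add: powr_numeral add_pos_pos)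
  finally have "1 / (1 + \<alpha> * a)\<^sup>2 \<le> 1 / (\<alpha> * a) powr p"
    using assms by (intro divide_left_mono mult_pos_pos) auto
  then show ?thesis using assms by (simp add: powr_mult mult.commute)
qed

lemma sum_le_suminf_shifted:
  fixes f g :: "nat \<Rightarrow> real"
  assumes g: "summable (\<lambda>n. g (Suc n))" "\<And>n. n \<ge> 1 \<Longrightarrow> 0 \<le> g n"
    and le: "\<And>n. n \<ge> 1 \<Longrightarrow> f n \<le> g n / c" and c: "c > 0"
  shows "(\<Sum>n=1..N. f n) \<le> (\<Sum>n. g (Suc n)) / c"
proof -
  have "(\<Sum>n=1..N. f n) \<le> (\<Sum>n=1..N. g n / c)" by (intro sum_mono le) auto
  also have "\<dots> = (\<Sum>n<N. g (Suc n)) / c"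
    by (simp add: sum_divide_distrib sum.atLeast1_atMost_eq)
  also have "\<dots> \<le> (\<Sum>n. g (Suc n)) / c"
    using c g by (intro divide_right_mono sum_le_suminf) auto
  finally show ?thesis .
qed

text \<open>
  Adding \<open>1\<close> keeps the constant positive when all the \<open>d\<^sub>n\<close> vanish.
\<close>

lemma sqrt_rate:
  fixes A S \<alpha> p :: real
  assumes "A\<^sup>2 \<le> S / \<alpha> powr (2 * p)" "\<alpha> > 0"
  shows "A \<le> (sqrt S + 1) / \<alpha> powr p"
proof -
  have "\<alpha> powr (2 * p) = (\<alpha> powr p)\<^sup>2" by (simp add: power2_eq_square powr_add[symmetric])
  then have "A \<le> sqrt (S / (\<alpha> powr p)\<^sup>2)" using assms by (intro real_le_rsqrt) simp
  also have "\<dots> = sqrt S / \<alpha> powr p" by (simp add: real_sqrt_divide)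
  also have "\<dots> \<le> (sqrt S + 1) / \<alpha> powr p" by (intro divide_right_mono) auto
  finally show ?thesis .
qed

theorem theorem3p5:
  fixes T :: real and y0 yT :: "real \<Rightarrow> real"
    and ustar :: "real \<times> real \<Rightarrow> real"
    and ua ya :: "real \<Rightarrow> real \<times> real \<Rightarrow> real"
  assumes "T > 0"
    and "L2_on {0<..<1} y0" and "L2_on {0<..<1} yT"
    and "\<And>\<alpha>. \<alpha> > 0 \<Longrightarrow> optimal_pen T y0 yT \<alpha> (ua \<alpha>)"
    and "\<And>\<alpha>. \<alpha> > 0 \<Longrightarrow> heat_weak_solution T y0 (ua \<alpha>) (ya \<alpha>)"
  shows "(\<forall>\<theta>. 0 \<le> \<theta> \<and> \<theta> \<le> 1/2 \<and> source_cond T y0 yT \<theta> \<longrightarrow>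
            (\<exists>C>0. \<forall>\<alpha>>0.
               L2_norm {0<..<1} (\<lambda>x. ya \<alpha> (x, T) - yT x) \<le> C / \<alpha> powr (1/2 + \<theta>)))
       \<and> (\<forall>\<theta>. 0 < \<theta> \<and> \<theta> \<le> 1 \<and> source_cond T y0 yT \<theta> \<and> optimal_hard T y0 yT ustar \<longrightarrow>
            (\<exists>D>0. \<forall>\<alpha>>0.
               L2_norm (cyl T) (\<lambda>q. ua \<alpha> q - ustar q) \<le> D / \<alpha> powr \<theta>))"
proof -
  note T = assms(1) and y0 = assms(2) and yT = assms(3) and opt = assms(4) and sol = assms(5)
  let ?d = "dcoef T y0 yT" and ?a = "acoef T"
  define w where "w \<theta> n = \<bar>?d n\<bar>\<^sup>2 / ?a n powr (1 + 2 * \<theta>)" for \<theta> n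
  have w0: "0 \<le> w \<theta> n" for \<theta> n by (simp add: w_def)
  have Sp: "0 \<le> (\<Sum>n. w \<theta> (Suc n))" if "source_cond T y0 yT \<theta>" for \<theta>
    using that w0 by (intro suminf_nonneg) (auto simp: source_cond_def w_def)
  note res = optimal_pen_residual[OF T y0 yT _ opt sol]
  have part1: "L2_norm unit_ival (\<lambda>x. ya \<alpha> (x, T) - yT x) \<le> (sqrt (\<Sum>n. w \<theta> (Suc n)) + 1) / \<alpha> powr (1/2 + \<theta>)"
    if \<theta>: "0 \<le> \<theta>" "\<theta> \<le> 1/2" "source_cond T y0 yT \<theta>" and \<alpha>: "\<alpha> > 0" for \<theta> \<alpha>
  proof (rule sqrt_rate[OF _ \<alpha>], rule sine_bessel_converse)
    show "L2_on unit_ival (\<lambda>x. ya \<alpha> (x, T) - yT x)"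
      using sol[OF \<alpha>] T yT by (intro L2_on_diff) (auto simp: heat_weak_solution_def C_L2_def)
    fix N
    show "(\<Sum>n=1..N. (coef (\<lambda>x. ya \<alpha> (x, T) - yT x) n)\<^sup>2) \<le> (\<Sum>n. w \<theta> (Suc n)) / \<alpha> powr (2 * (1/2 + \<theta>))"
    proof (rule sum_le_suminf_shifted)
      show "summable (\<lambda>n. w \<theta> (Suc n))" using \<theta>(3) by (simp add: source_cond_def w_def)
      fix n :: nat assume n: "n \<ge> 1"
      have "(coef (\<lambda>x. ya \<alpha> (x, T) - yT x) n)\<^sup>2 = (?d n)\<^sup>2 * (1 / (1 + \<alpha> * ?a n)\<^sup>2)"
        unfolding res[OF \<alpha> \<alpha> \<alpha> n] by (simp add: power_divide)
      also have "\<dots> \<le> (?d n)\<^sup>2 * (1 / (?a n powr (1 + 2 * \<theta>)) / \<alpha> powr (1 + 2 * \<theta>))"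
        using \<theta> by (intro mult_left_mono damping_bound acoef_pos T n \<alpha>) auto
      finally show "(coef (\<lambda>x. ya \<alpha> (x, T) - yT x) n)\<^sup>2 \<le> w \<theta> n / \<alpha> powr (2 * (1/2 + \<theta>))"
        by (simp add: w_def)
    qed (use w0 \<alpha> in auto)
  qed
  have part2: "L2_norm (cyl T) (\<lambda>q. ua \<alpha> q - ustar q) \<le> (sqrt (\<Sum>n. w \<theta> (Suc n)) + 1) / \<alpha> powr \<theta>"
    if \<theta>: "0 < \<theta>" "\<theta> \<le> 1" "source_cond T y0 yT \<theta>" and hard: "optimal_hard T y0 yT ustar" and \<alpha>: "\<alpha> > 0" for \<theta> \<alpha>
  proof (rule sqrt_rate[OF _ \<alpha>])
    define \<beta> where "\<beta> n = - \<alpha> * coef (\<lambda>x. ya \<alpha> (x, T) - yT x) n - ?d n / ?a n" for n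
    have u: "L2_on (cyl T) (ua \<alpha>)" "L2_on (cyl T) ustar"
      using opt[OF \<alpha>] hard by (auto simp: optimal_pen_def optimal_hard_def feasible_def)
    show "(L2_norm (cyl T) (\<lambda>q. ua \<alpha> q - ustar q))\<^sup>2 \<le> (\<Sum>n. w \<theta> (Suc n)) / \<alpha> powr (2 * \<theta>)"
    proof (rule mode_bessel_converse[where \<rho> = "adjoint_mode T" and \<beta> = \<beta>])
      show "L2_on (cyl T) (\<lambda>q. ua \<alpha> q - ustar q)" by (rule L2_on_diff[OF u])
      fix n :: nat and \<psi> :: "real \<Rightarrow> real" assume n: "1 \<le> n" and \<psi>: "continuous_on UNIV \<psi>"
      have "L2_on (cyl T) (tensor (eig n) \<psi>)"
        using \<psi> by (auto intro!: L2_on_tensor L2_on_eig L2_on_ival intro: continuous_on_subset)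
      then show "L2_inner (cyl T) (\<lambda>q. ua \<alpha> q - ustar q) (tensor (eig n) \<psi>) = \<beta> n * L2_inner {0<..<T} \<psi> (adjoint_mode T n)"
        using optimal_pen_modes[OF T y0 yT opt[OF \<alpha>] sol[OF \<alpha>] \<psi>, of n] optimal_hard_modes[OF T y0 yT hard \<psi> n]
        by (simp add: L2_inner_diff_left[OF u] \<beta>_def left_diff_distrib)
    next
      fix N
      show "(\<Sum>n=1..N. (\<beta> n)\<^sup>2 * L2_inner {0<..<T} (adjoint_mode T n) (adjoint_mode T n))
          \<le> (\<Sum>n. w \<theta> (Suc n)) / \<alpha> powr (2 * \<theta>)"
      proof (rule sum_le_suminf_shifted)
        show "summable (\<lambda>n. w \<theta> (Suc n))" using \<theta>(3) by (simp add: source_cond_def w_def)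
        fix n :: nat assume n: "n \<ge> 1"
        have a: "?a n > 0" by (rule acoef_pos[OF T n])
        have pos: "1 + \<alpha> * ?a n > 0" using a \<alpha> by (simp add: add_pos_pos)
        have "\<beta> n = - ?d n / (?a n * (1 + \<alpha> * ?a n))"
          unfolding \<beta>_def res[OF \<alpha> \<alpha> \<alpha> n] using a pos by (simp add: field_simps)
        then have "(\<beta> n)\<^sup>2 * ?a n = (?d n)\<^sup>2 / ?a n * (1 / (1 + \<alpha> * ?a n)\<^sup>2)"
          using a by (simp add: power_divide power_mult_distrib power2_eq_square)
        also have "\<dots> \<le> (?d n)\<^sup>2 / ?a n * (1 / (?a n powr (2 * \<theta>)) / \<alpha> powr (2 * \<theta>))"
          using \<theta> a by (intro mult_left_mono damping_bound a \<alpha>) auto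
        finally show "(\<beta> n)\<^sup>2 * L2_inner {0<..<T} (adjoint_mode T n) (adjoint_mode T n) \<le> w \<theta> n / \<alpha> powr (2 * \<theta>)"
          using a by (simp add: w_def adjoint_mode_norm[OF T n] powr_add)
      qed (use w0 \<alpha> in auto)
    qed (rule adjoint_mode_continuous)
  qed
  show ?thesis
  proof (intro conjI allI impI)
    fix \<theta> assume "0 \<le> \<theta> \<and> \<theta> \<le> 1/2 \<and> source_cond T y0 yT \<theta>"
    then show "\<exists>C>0. \<forall>\<alpha>>0. L2_norm unit_ival (\<lambda>x. ya \<alpha> (x, T) - yT x) \<le> C / \<alpha> powr (1/2 + \<theta>)"
      using part1 Sp by (intro exI[of _ "sqrt (\<Sum>n. w \<theta> (Suc n)) + 1"]) (auto simp: add_nonneg_pos)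
  next
    fix \<theta> assume "0 < \<theta> \<and> \<theta> \<le> 1 \<and> source_cond T y0 yT \<theta> \<and> optimal_hard T y0 yT ustar"
    then show "\<exists>D>0. \<forall>\<alpha>>0. L2_norm (cyl T) (\<lambda>q. ua \<alpha> q - ustar q) \<le> D / \<alpha> powr \<theta>"
      using part2 Sp by (intro exI[of _ "sqrt (\<Sum>n. w \<theta> (Suc n)) + 1"]) (auto simp: add_nonneg_pos)
  qed
qed

end
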